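(* For every entangled bipartite state $\rho$, $$\frac{E_D(\rho)}{E_c(\rho)}\le \mathcal S_E^{as}(\rho)\le 1,$$ equivalently $\dfrac{E_b(\rho)}{E_c(\rho)}\ge\mathcal A_E^{as}(\rho)$, where $E_b=E_c-E_D$. In particular, if $\mathcal A_E^{as}(\rho)>0$ then $E_D(\rho)<E_c(\rho)$.
   Context: $V$ is the swap of subsystems, $V(x\otimes y)=y\otimes x$. For bipartite states $\rho,\sigma$, the transition rate $R(\rho\to\sigma)$ is the supremum of all $r\ge0$ such that there exist LOCC operations $\Lambda_n$ and integers $m_n$ with $m_n/n\to r$ and $\|\Lambda_n(\rho^{\otimes n})-\sigma^{\otimes m_n}\|_1\to0$. The round-trip rate is $R(\rho\rightleftharpoons\sigma)=R(\rho\to\sigma)R(\sigma\to\rho)$ with $0\cdot\infty=\infty\cdot0=0$. The symmetry of entanglement is $\mathcal S_E^{as}(\rho)=R(\rho\to V\rho V^\dagger)$, which equals $\sup_\sigma R(\rho\rightleftharpoons\sigma)$ over all swap-invariant states $\sigma$ ($V\sigma V=\sigma$); the asymmetry of entanglement is $\mathcal A_E^{as}=1-\mathcal S_E^{as}$. With $\psi_+=\frac1{\sqrt2}(|00\rangle+|11\rangle)$, distillable entanglement is $E_D(\rho)=R(\rho\to\psi_+)$ and entanglement cost is $E_c(\rho)=1/R(\psi_+\to\rho)$; $E_c(\rho)>0$ for every entangled state $\rho$. *)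

theory Defs
  imports "Jordan_Normal_Form.Char_Poly" "HOL-Library.Extended_Real"
begin

text \<open>A bipartite system with local dimensions a (Alice) and b (Bob) is C^a (x) C^b,
  with product basis vector |i> (x) |j> encoded as the index i*b + j (Kronecker convention).
  Operators are complex matrices of type complex mat (Jordan_Normal_Form).\<close>

definition adj :: "complex mat \<Rightarrow> complex mat" where
  "adj A = mat (dim_col A) (dim_row A) (\<lambda>(i,j). cnj (A $$ (j,i)))"

definition kron :: "complex mat \<Rightarrow> complex mat \<Rightarrow> complex mat" where
  "kron A B = mat (dim_row A * dim_row B) (dim_col A * dim_col B)
     (\<lambda>(i,j). A $$ (i div dim_row B, j div dim_col B) * B $$ (i mod dim_row B, j mod dim_col B))"

definition psd :: "nat \<Rightarrow> complex mat \<Rightarrow> bool" where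
  "psd n A \<longleftrightarrow> A \<in> carrier_mat n n \<and>
     (\<forall>v \<in> carrier_vec n. let q = (\<Sum>i<n. cnj (v $ i) * (A *\<^sub>v v) $ i) in q \<in> \<real> \<and> Re q \<ge> 0)"

definition density :: "nat \<Rightarrow> complex mat \<Rightarrow> bool" where
  "density n \<rho> \<longleftrightarrow> psd n \<rho> \<and> (\<Sum>i<n. \<rho> $$ (i,i)) = 1"

definition separable :: "nat \<Rightarrow> nat \<Rightarrow> complex mat \<Rightarrow> bool" where
  "separable a b \<rho> \<longleftrightarrow> density (a*b) \<rho> \<and>
     (\<exists>(N::nat) (p::nat \<Rightarrow> real) \<alpha> \<beta>.
        (\<forall>k<N. p k \<ge> 0 \<and> density a (\<alpha> k) \<and> density b (\<beta> k)) \<and> (\<Sum>k<N. p k) = 1 \<and>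
        \<rho> = mat (a*b) (a*b) (\<lambda>(r,s). \<Sum>k<N. complex_of_real (p k) * kron (\<alpha> k) (\<beta> k) $$ (r,s)))"

definition entangled :: "nat \<Rightarrow> nat \<Rightarrow> complex mat \<Rightarrow> bool" where
  "entangled a b \<rho> \<longleftrightarrow> density (a*b) \<rho> \<and> \<not> separable a b \<rho>"

text \<open>Trace norm ||X||_1 = Tr sqrt(X^dagger X): sum of the square roots of the eigenvalues
  of X^dagger X, counted with algebraic multiplicity.\<close>
definition trace_norm :: "complex mat \<Rightarrow> real" where
  "trace_norm X = (let p = char_poly (adj X * X) in
     \<Sum>\<mu> \<in> {\<mu>. poly p \<mu> = 0}. real (order \<mu> p) * sqrt (cmod \<mu>))"

definition digit :: "nat \<Rightarrow> nat \<Rightarrow> nat \<Rightarrow> nat" where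
  "digit a k x = (x div a ^ k) mod a"

text \<open>n-fold tensor power of a bipartite state on (a,b), regarded as a bipartite state
  on (a^n, b^n) (Alice holds all A-copies, Bob all B-copies).  For n = 0 it is the
  trivial state [1] on (1,1).\<close>
definition tpow :: "nat \<Rightarrow> nat \<Rightarrow> complex mat \<Rightarrow> nat \<Rightarrow> complex mat" where
  "tpow a b \<rho> n = mat (a^n * b^n) (a^n * b^n) (\<lambda>(r,s).
     \<Prod>k<n. \<rho> $$ (digit a k (r div b^n) * b + digit b k (r mod b^n),
                   digit a k (s div b^n) * b + digit b k (s mod b^n)))"

text \<open>Swap conjugation V rho V^dagger: maps a state on (a,b) to a state on (b,a).\<close>
definition swap_state :: "nat \<Rightarrow> nat \<Rightarrow> complex mat \<Rightarrow> complex mat" where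
  "swap_state a b \<rho> = mat (b*a) (b*a) (\<lambda>(r,s).
     \<rho> $$ ((r mod a) * b + r div a, (s mod a) * b + s div a))"

text \<open>Maximally entangled two-qubit state psi_+ = (|00> + |11>)/sqrt 2, as a density matrix.\<close>
definition psi_plus :: "complex mat" where
  "psi_plus = mat 4 4 (\<lambda>(r,s). if r \<in> {0,3} \<and> s \<in> {0,3} then 1/2 else 0)"

definition instrument :: "nat \<Rightarrow> nat \<Rightarrow> nat \<Rightarrow> (nat \<Rightarrow> complex mat) \<Rightarrow> bool" where
  "instrument N c a K \<longleftrightarrow> (\<forall>k<N. K k \<in> carrier_mat c a) \<and>
     (\<forall>r<a. \<forall>s<a. (\<Sum>k<N. (adj (K k) * K k) $$ (r,s)) = (if r = s then 1 else 0))"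

text \<open>LOCC a b c d \<Lambda>: \<Lambda> is a (finite-round) LOCC operation from the bipartite system
  (a,b) to the bipartite system (c,d).  Each round, one party performs a local instrument
  (arbitrary Kraus operators, possibly changing its local dimension), announces the outcome,
  and the remaining protocol may depend on it.\<close>
inductive LOCC :: "nat \<Rightarrow> nat \<Rightarrow> nat \<Rightarrow> nat \<Rightarrow> (complex mat \<Rightarrow> complex mat) \<Rightarrow> bool" where
  LOCC_id: "LOCC a b a b (\<lambda>\<rho>. \<rho>)"
| LOCC_Alice: "\<lbrakk> instrument N c a K; \<forall>k<N. LOCC c b e f (\<Lambda> k) \<rbrakk> \<Longrightarrow>
     LOCC a b e f (\<lambda>\<rho>. mat (e*f) (e*f) (\<lambda>(r,s). \<Sum>k<N.
        \<Lambda> k (kron (K k) (1\<^sub>m b) * \<rho> * adj (kron (K k) (1\<^sub>m b))) $$ (r,s)))"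
| LOCC_Bob: "\<lbrakk> instrument N d b K; \<forall>k<N. LOCC a d e f (\<Lambda> k) \<rbrakk> \<Longrightarrow>
     LOCC a b e f (\<lambda>\<rho>. mat (e*f) (e*f) (\<lambda>(r,s). \<Sum>k<N.
        \<Lambda> k (kron (1\<^sub>m a) (K k) * \<rho> * adj (kron (1\<^sub>m a) (K k))) $$ (r,s)))"

definition rate :: "nat \<Rightarrow> nat \<Rightarrow> complex mat \<Rightarrow> nat \<Rightarrow> nat \<Rightarrow> complex mat \<Rightarrow> ereal" where
  "rate a b \<rho> c d \<sigma> = Sup {ereal r | r. r \<ge> 0 \<and>
     (\<exists>(\<Lambda> :: nat \<Rightarrow> complex mat \<Rightarrow> complex mat) (m :: nat \<Rightarrow> nat).
        (\<forall>n. LOCC (a^n) (b^n) (c^(m n)) (d^(m n)) (\<Lambda> n)) \<and>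
        (\<lambda>n. real (m n) / real n) \<longlonglongrightarrow> r \<and>
        (\<lambda>n. trace_norm (\<Lambda> n (tpow a b \<rho> n) - tpow c d \<sigma> (m n))) \<longlonglongrightarrow> 0)}"

definition sym_ent :: "nat \<Rightarrow> nat \<Rightarrow> complex mat \<Rightarrow> ereal" where
  "sym_ent a b \<rho> = rate a b \<rho> b a (swap_state a b \<rho>)"

definition asym_ent :: "nat \<Rightarrow> nat \<Rightarrow> complex mat \<Rightarrow> ereal" where
  "asym_ent a b \<rho> = 1 - sym_ent a b \<rho>"

definition E_D :: "nat \<Rightarrow> nat \<Rightarrow> complex mat \<Rightarrow> ereal" where
  "E_D a b \<rho> = rate a b \<rho> 2 2 psi_plus"

text \<open>Entanglement cost E_c(rho) = 1 / R(psi_+ -> rho) (with 1/0 = \<infinity>, 1/\<infinity> = 0).\<close>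
definition E_c :: "nat \<Rightarrow> nat \<Rightarrow> complex mat \<Rightarrow> ereal" where
  "E_c a b \<rho> = inverse (rate 2 2 psi_plus a b \<rho>)"

definition E_b :: "nat \<Rightarrow> nat \<Rightarrow> complex mat \<Rightarrow> ereal" where
  "E_b a b \<rho> = E_c a b \<rho> - E_D a b \<rho>"

end

theory Submission
  imports Defs "Jordan_Normal_Form.Schur_Decomposition"
begin

text \<open>
  Rates compose, R(\<rho> \<rightarrow> \<sigma>) R(\<sigma> \<rightarrow> \<tau>) \<le> R(\<rho> \<rightarrow> \<tau>), and are invariant under exchanging the parties on both
  sides. Since \<psi>+ is swap invariant, E_D / E_c = R(\<rho> \<rightarrow> \<psi>+) R(\<psi>+ \<rightarrow> \<rho>) is a lower bound for
  R(\<rho> \<rightarrow> V\<rho>V). In the other direction the square of R(\<rho> \<rightarrow> V\<rho>V) is at most R(\<rho> \<rightarrow> \<rho>), and a finite number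
  x with x * x \<le> x is at most 1, so it suffices that no state is converted into an entangled \<rho> at
  infinite rate.

  For this, let M be an informationally complete product measurement on one copy. Separating the outcome
  distribution of \<rho> from the compact convex set of outcome distributions of separable states gives
  weights g > 0 whose mean is at most 1 on separable states while the mean of ln g under \<rho> is some
  \<eta> > 0. The bound on separable states is multiplicative over copies because a product measurement on
  some copies of a separable state leaves the others separable. If \<Lambda> maps n copies of \<tau> close to m
  copies of \<rho>, then \<Lambda>(\<tau>^n) \<le> \<Lambda>(1), where \<Lambda>(1) is separable with trace D^n, and Jensen's inequality
  bounds m \<eta> by n ln D up to a vanishing error.

  Teleportation shows that R(\<psi>+ \<rightarrow> \<rho>) > 0, hence E_c is a positive real number and the remaining claims are
  arithmetic.
\<close>

section \<open>Inner products and the spectral theorem\<close>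

text \<open>Counting dimensions cannot exclude an infinite rate into \<rho>: the target dimension
  grows with the number of copies, and separable states really are available for free in any number.
  The obstruction has to be additive over copies of \<rho>, at most linear in the number of input
  copies, and stable under approximation. Products of a sign-changing witness need not be witnesses
  again. Products of the weights g do work, because they are nonnegative and attached to outcomes of
  local measurements, so that conditioning on some outcomes leaves a product operator on the rest.
  Such weights arise as g = 1 - t v, a perturbation of the constant 1 by a separating functional v:
  the gain in the mean of ln g under \<rho> is of first order in t, the loss from curvature of
  second order. Approximation is harmless since the logarithm of the weight on m copies is at most a
  multiple of m, so that an error \<epsilon> costs at most a multiple of m \<epsilon>. The input
  enters only through its domination by the identity, so the bound depends on its dimension
  alone.\<close>

definition ip :: "nat \<Rightarrow> (nat \<Rightarrow> complex) \<Rightarrow> (nat \<Rightarrow> complex) \<Rightarrow> complex" where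
  "ip n x y = (\<Sum>i<n. cnj (x i) * y i)"

definition mv :: "nat \<Rightarrow> (nat \<Rightarrow> nat \<Rightarrow> complex) \<Rightarrow> (nat \<Rightarrow> complex) \<Rightarrow> nat \<Rightarrow> complex" where
  "mv n A x i = (\<Sum>j<n. A i j * x j)"

definition orthonormal :: "nat \<Rightarrow> (nat \<Rightarrow> nat \<Rightarrow> complex) \<Rightarrow> bool" where
  "orthonormal n u \<longleftrightarrow> (\<forall>k<n. \<forall>l<n. ip n (u k) (u l) = (if k = l then 1 else 0))"

definition herm :: "nat \<Rightarrow> (nat \<Rightarrow> nat \<Rightarrow> complex) \<Rightarrow> bool" where
  "herm n A \<longleftrightarrow> (\<forall>i<n. \<forall>j<n. A j i = cnj (A i j))"

lemma ip_cong: "(\<And>i. i < n \<Longrightarrow> x i = x' i) \<Longrightarrow> (\<And>i. i < n \<Longrightarrow> y i = y' i) \<Longrightarrow> ip n x y = ip n x' y'"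
  by (simp add: ip_def)

lemma ip_cnj: "cnj (ip n x y) = ip n y x"
  by (simp add: ip_def mult.commute)

lemma ip_sum_right: "ip n x (\<lambda>i. \<Sum>q\<in>Q. c q * y q i) = (\<Sum>q\<in>Q. c q * ip n x (y q))"
proof -
  have "ip n x (\<lambda>i. \<Sum>q\<in>Q. c q * y q i) = (\<Sum>i<n. \<Sum>q\<in>Q. c q * (cnj (x i) * y q i))"
    by (simp add: ip_def sum_distrib_left mult_ac)
  also have "\<dots> = (\<Sum>q\<in>Q. \<Sum>i<n. c q * (cnj (x i) * y q i))" by (rule sum.swap)
  finally show ?thesis by (simp add: ip_def sum_distrib_left)
qed

lemma ip_sum_left: "ip n (\<lambda>i. \<Sum>q\<in>Q. c q * x q i) y = (\<Sum>q\<in>Q. cnj (c q) * ip n (x q) y)"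
proof -
  have "ip n (\<lambda>i. \<Sum>q\<in>Q. c q * x q i) y = cnj (ip n y (\<lambda>i. \<Sum>q\<in>Q. c q * x q i))"
    by (simp add: ip_cnj)
  also have "\<dots> = (\<Sum>q\<in>Q. cnj (c q) * cnj (ip n y (x q)))"
    by (simp add: ip_sum_right)
  finally show ?thesis by (simp add: ip_cnj)
qed

lemma ip_scale_right: "ip n x (\<lambda>i. c * y i) = c * ip n x y"
  by (simp add: ip_def sum_distrib_left mult_ac)

lemma ip_self: "ip n x x = complex_of_real (\<Sum>i<n. (cmod (x i))\<^sup>2)"
  unfolding ip_def of_real_sum
  by (intro sum.cong refl) (simp add: complex_norm_square mult.commute del: of_real_power)

lemma ip_mv_herm:
  assumes "herm n A"
  shows "ip n x (mv n A y) = ip n (mv n A x) y"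
proof -
  have "ip n x (mv n A y) = (\<Sum>i<n. \<Sum>j<n. cnj (x i) * A i j * y j)"
    by (simp add: ip_def mv_def sum_distrib_left mult_ac)
  also have "\<dots> = (\<Sum>j<n. \<Sum>i<n. cnj (x i) * A i j * y j)" by (rule sum.swap)
  also have "\<dots> = (\<Sum>j<n. \<Sum>i<n. cnj (A j i * x i) * y j)"
  proof (intro sum.cong refl)
    fix i j assume "i \<in> {..<n}" "j \<in> {..<n}"
    hence "A j i = cnj (A i j)" using assms unfolding herm_def by blast
    thus "cnj (x j) * A j i * y i = cnj (A i j * x j) * y i" by simp
  qed
  also have "\<dots> = ip n (mv n A x) y"
    by (simp add: ip_def mv_def sum_distrib_right)
  finally show ?thesis .
qed

lemma mv_sum: "mv n A (\<lambda>j. \<Sum>q\<in>Q. c q * x q j) i = (\<Sum>q\<in>Q. c q * mv n A (x q) i)"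
proof -
  have "mv n A (\<lambda>j. \<Sum>q\<in>Q. c q * x q j) i = (\<Sum>j<n. \<Sum>q\<in>Q. c q * (A i j * x q j))"
    by (simp add: mv_def sum_distrib_left mult_ac)
  also have "\<dots> = (\<Sum>q\<in>Q. \<Sum>j<n. c q * (A i j * x q j))" by (rule sum.swap)
  finally show ?thesis by (simp add: mv_def sum_distrib_left)
qed

text \<open>Orthonormality says that the conjugate transpose is a left inverse of the matrix with
  columns \<open>w k\<close>; for square matrices it is then a right inverse as well, which is
  completeness.\<close>

lemma orthonormal_complete:
  assumes "orthonormal n w" "i < n" "j < n"
  shows "(\<Sum>k<n. w k i * cnj (w k j)) = (if i = j then 1 else 0)"
proof -
  define W where "W = mat n n (\<lambda>(i,k). w k i)"
  define V where "V = mat n n (\<lambda>(k,i). cnj (w k i))"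
  have "V * W = 1\<^sub>m n"
    using assms(1) by (intro eq_matI)
      (auto simp: V_def W_def scalar_prod_def orthonormal_def ip_def lessThan_atLeast0)
  hence "W * V = 1\<^sub>m n"
    by (rule mat_mult_left_right_inverse[rotated 2]) (auto simp: V_def W_def)
  hence "(W * V) $$ (i,j) = (1\<^sub>m n) $$ (i,j)" by simp
  thus ?thesis using assms by (simp add: W_def V_def scalar_prod_def lessThan_atLeast0)
qed

lemma orthonormal_expand:
  assumes "orthonormal n w" "i < n"
  shows "y i = (\<Sum>k<n. ip n (w k) y * w k i)"
proof -
  have "(\<Sum>k<n. ip n (w k) y * w k i) = (\<Sum>k<n. \<Sum>j<n. y j * (w k i * cnj (w k j)))"
    unfolding ip_def sum_distrib_right by (intro sum.cong refl) (simp add: mult_ac)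
  also have "\<dots> = (\<Sum>j<n. \<Sum>k<n. y j * (w k i * cnj (w k j)))" by (rule sum.swap)
  also have "\<dots> = (\<Sum>j<n. y j * (if i = j then 1 else 0))"
    using assms by (intro sum.cong refl) (simp add: orthonormal_complete sum_distrib_left[symmetric])
  also have "\<dots> = y i" using assms by (simp add: sum.delta if_distrib cong: if_cong)
  finally show ?thesis by simp
qed

text \<open>\<open>gram_schmidt\<close> orthogonalises a basis starting with \<open>v\<close> but
  does not normalise it. Dividing by the lengths \<open>c k\<close> leaves the first vector
  unchanged because \<open>v\<close> already has length 1.\<close>

lemma orthonormal_extension:
  assumes n: "n > 0" and v: "ip n v v = 1"
  shows "\<exists>w. orthonormal n w \<and> (\<forall>i<n. w 0 i = v i)"
proof -
  interpret cof_vec_space n "TYPE(complex)" .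
  define vv where "vv = vec n v"
  have vv: "vv \<in> carrier_vec n" by (simp add: vv_def)
  have v0: "vv \<noteq> 0\<^sub>v n"
  proof
    assume h: "vv = 0\<^sub>v n"
    have "v i = 0" if "i < n" for i
    proof -
      have "v i = vv $ i" using that by (simp add: vv_def)
      thus ?thesis using h that by simp
    qed
    thus False using v by (simp add: ip_def)
  qed
  define b where "b = basis_completion vv"
  define ws where "ws = gram_schmidt n b"
  from basis_completion[OF vv v0, folded b_def]
  have dist_b: "distinct b" and indep: "\<not> lin_dep (set b)" and b: "set b \<subseteq> carrier_vec n"
    and hdb: "hd b = vv" and len_b: "length b = n" by auto
  from hdb len_b n obtain vs where bv: "b = vv # vs" by (cases b) auto
  from gram_schmidt_result[OF b dist_b indep refl, folded ws_def]
  have ws: "set ws \<subseteq> carrier_vec n" "corthogonal ws" "length ws = n" by (auto simp: len_b)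
  from gram_schmidt_hd[OF vv, of vs, folded bv] have hdws: "hd ws = vv" unfolding ws_def .
  have ws0: "ws ! 0 = vv" using hdws ws(3) n by (cases ws) auto
  define y where "y k i = (ws ! k) $ i" for k i
  have wsc: "ws ! k \<in> carrier_vec n" if "k < n" for k using ws that by auto
  have cip: "ip n (y l) (y k) = ws ! k \<bullet>c ws ! l" if "k < n" "l < n" for k l
    using wsc[OF that(1)] wsc[OF that(2)]
    by (auto simp: ip_def y_def scalar_prod_def lessThan_atLeast0 mult.commute)
  define c where "c k = sqrt (\<Sum>i<n. (cmod (y k i))\<^sup>2)" for k
  have c2: "complex_of_real (c k) * complex_of_real (c k) = ip n (y k) (y k)" for k
    unfolding c_def ip_self of_real_mult[symmetric] by (simp add: sum_nonneg)
  have nz: "ip n (y k) (y l) = 0 \<longleftrightarrow> k \<noteq> l" if "k < n" "l < n" for k l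
    using cip[OF that(2,1)] corthogonalD[OF ws(2), of l k] that ws(3) by auto
  have cnz: "c k \<noteq> 0" if "k < n" for k
    using nz[OF that that] c2[of k] by auto
  define w where "w k i = y k i / complex_of_real (c k)" for k i
  have "ip n (w k) (w l) = ip n (y k) (y l) / (complex_of_real (c k) * complex_of_real (c l))" for k l
    by (simp add: ip_def w_def sum_divide_distrib)
  hence on: "orthonormal n w"
    unfolding orthonormal_def using nz cnz c2 by auto
  have yv: "y 0 i = v i" if "i < n" for i using that by (simp add: y_def ws0 vv_def)
  have "ip n (y 0) (y 0) = 1" using v yv by (simp add: ip_def)
  hence "c 0 = 1" using c2[of 0] unfolding c_def ip_self by (simp add: of_real_eq_1_iff del: of_real_sum)
  hence "\<forall>i<n. w 0 i = v i" using yv by (simp add: w_def)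
  with on show ?thesis by blast
qed

lemma eigenvector_exists:
  assumes "n > 0"
  shows "\<exists>e v. ip n v v = 1 \<and> (\<forall>i<n. mv n A v i = e * v i)"
proof -
  define M where "M = mat n n (\<lambda>(i,j). A i j)"
  have M: "M \<in> carrier_mat n n" by (simp add: M_def)
  from char_poly_factorized[OF M] obtain as where
    as: "char_poly M = (\<Prod>a\<leftarrow>as. [:- a, 1:])" "length as = n" by blast
  with assms obtain e es where "as = e # es" by (cases as) auto
  hence "poly (char_poly M) e = 0" using as by simp
  hence "eigenvalue M e" using eigenvalue_root_char_poly[OF M] by simp
  then obtain x where x: "x \<in> carrier_vec n" "x \<noteq> 0\<^sub>v n" "M *\<^sub>v x = e \<cdot>\<^sub>v x"
    using M by (auto simp: eigenvalue_def eigenvector_def)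
  define s where "s = (\<Sum>i<n. (cmod (x $ i))\<^sup>2)"
  have "\<exists>i<n. x $ i \<noteq> 0"
  proof (rule ccontr)
    assume "\<not> ?thesis"
    hence "x = 0\<^sub>v n" using x(1) by (intro eq_vecI) auto
    with x(2) show False by simp
  qed
  hence s: "s > 0" unfolding s_def by (auto intro!: sum_pos2)
  define v where "v i = x $ i / complex_of_real (sqrt s)" for i
  have "ip n v v = ip n (($) x) (($) x) / complex_of_real (sqrt s * sqrt s)"
    unfolding ip_def v_def sum_divide_distrib of_real_mult by (intro sum.cong refl) simp
  also have "\<dots> = 1" using s by (simp add: ip_self s_def[symmetric])
  finally have 1: "ip n v v = 1" .
  have "mv n A v i = e * v i" if i: "i < n" for i
  proof -
    have "(\<Sum>j<n. A i j * x $ j) = (M *\<^sub>v x) $ i"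
      using i x(1) by (auto simp: M_def scalar_prod_def lessThan_atLeast0)
    also have "\<dots> = e * x $ i" using x i by simp
    finally show ?thesis by (simp add: mv_def v_def sum_divide_distrib[symmetric])
  qed
  with 1 show ?thesis by blast
qed

text \<open>Deflation: the orthogonal complement of an eigenvector is invariant under a Hermitian
  matrix. \<open>A'\<close> is the compression to that complement in the basis
  \<open>w (Suc p)\<close>, and its eigenvectors are lifted back through this basis.\<close>

lemma hermitian_eigenbasis:
  "herm n A \<Longrightarrow> \<exists>u e. orthonormal n u \<and> (\<forall>k<n. \<forall>i<n. mv n A (u k) i = e k * u k i)"
proof (induction n arbitrary: A)
  case 0
  show ?case by (simp add: orthonormal_def)
next
  case (Suc n)
  let ?N = "Suc n"
  obtain e v where v: "ip ?N v v = 1" "\<forall>i<?N. mv ?N A v i = e * v i"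
    using eigenvector_exists[of ?N A] by auto
  obtain w where w: "orthonormal ?N w" "\<forall>i<?N. w 0 i = v i"
    using orthonormal_extension[OF _ v(1)] by auto
  define A' where "A' p q = ip ?N (w (Suc p)) (mv ?N A (w (Suc q)))" for p q
  have "herm n A'"
    unfolding herm_def A'_def using ip_mv_herm[OF Suc.prems] by (simp add: ip_cnj)
  from Suc.IH[OF this] obtain u' e' where
    u': "orthonormal n u'" "\<forall>k<n. \<forall>i<n. mv n A' (u' k) i = e' k * u' k i" by blast
  define u where "u k = (case k of 0 \<Rightarrow> w 0 | Suc k \<Rightarrow> (\<lambda>i. \<Sum>q<n. u' k q * w (Suc q) i))" for k
  define f where "f k = (case k of 0 \<Rightarrow> e | Suc k \<Rightarrow> e' k)" for k
  have wd: "ip ?N (w k) (w l) = (if k = l then 1 else 0)" if "k < ?N" "l < ?N" for k l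
    using w(1) that by (simp add: orthonormal_def)
  have S: "ip ?N (w l) (u (Suc k)) = (\<Sum>q<n. u' k q * (if l = Suc q then 1 else 0))" if "l < ?N" for k l
    using that by (simp add: u_def ip_sum_right wd)
  have c00: "ip ?N (u 0) (u 0) = 1" by (simp add: u_def wd)
  have c0S: "ip ?N (u 0) (u (Suc k)) = 0" for k using S[of 0 k] by (simp add: u_def)
  have cS0: "ip ?N (u (Suc k)) (u 0) = 0" for k using arg_cong[OF c0S[of k], of cnj] by (simp add: ip_cnj)
  have cSS: "ip ?N (u (Suc k)) (u (Suc l)) = (if k = l then 1 else 0)" if "k < n" "l < n" for k l
  proof -
    have "ip ?N (u (Suc k)) (u (Suc l)) = (\<Sum>q<n. cnj (u' k q) * ip ?N (w (Suc q)) (u (Suc l)))"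
      by (subst u_def) (simp add: ip_sum_left)
    also have "\<dots> = (\<Sum>q<n. cnj (u' k q) * u' l q)"
      by (intro sum.cong refl) (simp add: S if_distrib cong: if_cong)
    also have "\<dots> = (if k = l then 1 else 0)" using u'(1) that by (simp add: orthonormal_def ip_def)
    finally show ?thesis .
  qed
  have on: "orthonormal ?N u"
    unfolding orthonormal_def
  proof (intro allI impI)
    fix k l assume "k < ?N" "l < ?N"
    thus "ip ?N (u k) (u l) = (if k = l then 1 else 0)"
      using c00 c0S cS0 cSS by (cases k; cases l) auto
  qed
  have "mv ?N A (u k) i = f k * u k i" if k: "k < ?N" and i: "i < ?N" for k i
  proof (cases k)
    case 0
    have "mv ?N A (u 0) i = mv ?N A v i" using w(2) by (simp add: mv_def u_def)
    thus ?thesis using v(2) i w(2) 0 by (simp add: u_def f_def)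
  next
    case (Suc k')
    let ?y = "mv ?N A (u k)"
    \<comment> \<open>Invariance of the complement: A moves to the other side of the inner product,
      where it meets its eigenvector \<open>w 0\<close>.\<close>
    have y0: "ip ?N (w 0) ?y = 0"
    proof -
      have "ip ?N (w 0) ?y = ip ?N (mv ?N A (w 0)) (u k)" by (rule ip_mv_herm[OF Suc.prems])
      also have "\<dots> = ip ?N (\<lambda>i. e * w 0 i) (u k)"
      proof (rule ip_cong)
        fix i assume "i < ?N"
        moreover have "mv ?N A (w 0) i = mv ?N A v i" using w(2) by (simp add: mv_def)
        ultimately show "mv ?N A (w 0) i = e * w 0 i" using v(2) w(2) by simp
      qed simp
      also have "\<dots> = cnj e * ip ?N (w 0) (u k)"
        unfolding ip_def sum_distrib_left by (intro sum.cong refl) simp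
      also have "\<dots> = 0" using S[of 0 k'] Suc by simp
      finally show ?thesis .
    qed
    have yS: "ip ?N (w (Suc p)) ?y = e' k' * u' k' p" if p: "p < n" for p
    proof -
      have "ip ?N (w (Suc p)) ?y = ip ?N (w (Suc p)) (\<lambda>i. \<Sum>q<n. u' k' q * mv ?N A (w (Suc q)) i)"
        by (rule ip_cong) (simp_all add: Suc u_def mv_sum)
      also have "\<dots> = mv n A' (u' k') p"
        by (simp add: ip_sum_right A'_def mv_def[of n A'] mult.commute)
      finally show ?thesis using u'(2) p k Suc by simp
    qed
    have "?y i = (\<Sum>m<?N. ip ?N (w m) ?y * w m i)" by (rule orthonormal_expand[OF w(1) i])
    also have "\<dots> = (\<Sum>p<n. e' k' * u' k' p * w (Suc p) i)"
      by (simp only: sum.lessThan_Suc_shift y0) (simp add: yS)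
    also have "\<dots> = f k * u k i" by (simp add: Suc f_def u_def sum_distrib_left mult_ac)
    finally show ?thesis .
  qed
  with on show ?case by blast
qed

definition spectral :: "nat \<Rightarrow> (nat \<Rightarrow> nat \<Rightarrow> complex) \<Rightarrow> (nat \<Rightarrow> nat \<Rightarrow> complex) \<Rightarrow> (nat \<Rightarrow> real) \<Rightarrow> bool" where
  "spectral n A u l \<longleftrightarrow> orthonormal n u \<and>
    (\<forall>i<n. \<forall>j<n. A i j = (\<Sum>k<n. complex_of_real (l k) * u k i * cnj (u k j)))"

theorem hermitian_spectral:
  assumes "herm n A"
  shows "\<exists>u l. spectral n A u l"
proof -
  obtain u e where u: "orthonormal n u" "\<forall>k<n. \<forall>i<n. mv n A (u k) i = e k * u k i"
    using hermitian_eigenbasis[OF assms] by blast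
  have ev: "ip n (u k) (mv n A (u k)) = e k" if "k < n" for k
  proof -
    have "ip n (u k) (mv n A (u k)) = ip n (u k) (\<lambda>i. e k * u k i)"
      using u(2) that by (intro ip_cong) blast+
    thus ?thesis using u(1) that by (simp add: ip_scale_right orthonormal_def)
  qed
  have re: "complex_of_real (Re (e k)) = e k" if "k < n" for k
  proof -
    have "cnj (e k) = cnj (ip n (u k) (mv n A (u k)))" by (simp only: ev[OF that])
    also have "\<dots> = ip n (mv n A (u k)) (u k)" by (rule ip_cnj)
    also have "\<dots> = e k" by (simp only: ip_mv_herm[OF assms, symmetric] ev[OF that])
    finally have "cnj (e k) = e k" .
    thus ?thesis by (simp add: complex_eq_iff)
  qed
  have "A i j = (\<Sum>k<n. complex_of_real (Re (e k)) * u k i * cnj (u k j))" if ij: "i < n" "j < n" for i j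
  proof -
    have "(\<Sum>k<n. complex_of_real (Re (e k)) * u k i * cnj (u k j)) = (\<Sum>k<n. mv n A (u k) i * cnj (u k j))"
    proof (intro sum.cong refl)
      fix k assume k: "k \<in> {..<n}"
      hence "mv n A (u k) i = e k * u k i" using u(2) ij by blast
      with re[of k] k show "complex_of_real (Re (e k)) * u k i * cnj (u k j) = mv n A (u k) i * cnj (u k j)"
        by simp
    qed
    also have "\<dots> = (\<Sum>k<n. \<Sum>m<n. A i m * (u k m * cnj (u k j)))"
      by (simp add: mv_def sum_distrib_right mult.assoc)
    also have "\<dots> = (\<Sum>m<n. \<Sum>k<n. A i m * (u k m * cnj (u k j)))" by (rule sum.swap)
    also have "\<dots> = (\<Sum>m<n. A i m * (if m = j then 1 else 0))"
      using ij u(1) by (intro sum.cong refl) (simp add: orthonormal_complete sum_distrib_left[symmetric])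
    also have "\<dots> = A i j" using ij by (simp add: if_distrib cong: if_cong)
    finally show ?thesis ..
  qed
  hence "spectral n A u (\<lambda>k. Re (e k))" using u(1) by (simp add: spectral_def)
  thus ?thesis by blast
qed

section \<open>Positive kernels\<close>

text \<open>Matrices are handled as kernels \<open>nat \<Rightarrow> nat \<Rightarrow> complex\<close> of which only the entries with indices
  below the dimension matter. Tensor powers, Kronecker products and swaps then become pullbacks along
  index maps and pointwise products, so their positivity follows from the Schur product theorem.\<close>

definition qf :: "nat \<Rightarrow> (nat \<Rightarrow> nat \<Rightarrow> complex) \<Rightarrow> (nat \<Rightarrow> complex) \<Rightarrow> complex" where
  "qf n A v = (\<Sum>i<n. \<Sum>j<n. cnj (v i) * A i j * v j)"

definition psdk :: "nat \<Rightarrow> (nat \<Rightarrow> nat \<Rightarrow> complex) \<Rightarrow> bool" where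
  "psdk n A \<longleftrightarrow> (\<forall>v. 0 \<le> qf n A v)"

definition tr :: "nat \<Rightarrow> (nat \<Rightarrow> nat \<Rightarrow> complex) \<Rightarrow> complex" where
  "tr n A = (\<Sum>i<n. A i i)"

definition ker :: "complex mat \<Rightarrow> nat \<Rightarrow> nat \<Rightarrow> complex" where
  "ker M i j = M $$ (i,j)"

lemma qf_cong:
  "(\<And>i j. i < n \<Longrightarrow> j < n \<Longrightarrow> A i j = B i j) \<Longrightarrow> (\<And>i. i < n \<Longrightarrow> v i = w i) \<Longrightarrow> qf n A v = qf n B w"
  by (simp add: qf_def)

lemma psdk_cong: "(\<And>i j. i < n \<Longrightarrow> j < n \<Longrightarrow> A i j = B i j) \<Longrightarrow> psdk n A = psdk n B"
  unfolding psdk_def using qf_cong[of n A B] by simp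

lemma tr_cong: "(\<And>i. i < n \<Longrightarrow> A i i = B i i) \<Longrightarrow> tr n A = tr n B"
  by (simp add: tr_def)

lemma psd_iff: "psd n M \<longleftrightarrow> M \<in> carrier_mat n n \<and> psdk n (ker M)"
proof -
  have *: "(\<Sum>i<n. cnj (v $ i) * (M *\<^sub>v v) $ i) = qf n (ker M) (($) v)"
    if "M \<in> carrier_mat n n" "v \<in> carrier_vec n" for v
    using that by (auto simp: qf_def ker_def scalar_prod_def sum_distrib_left lessThan_atLeast0 mult_ac
        intro!: sum.cong)
  have **: "qf n (ker M) v = qf n (ker M) (($) (vec n v))" for v
    by (rule qf_cong) auto
  have "psd n M \<longleftrightarrow> M \<in> carrier_mat n n \<and> (\<forall>v\<in>carrier_vec n. 0 \<le> qf n (ker M) (($) v))"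
    unfolding psd_def Let_def
  proof (intro conj_cong refl ball_cong)
    fix v :: "complex vec" assume "M \<in> carrier_mat n n" "v \<in> carrier_vec n"
    from *[OF this]
    show "((\<Sum>i<n. cnj (v $ i) * (M *\<^sub>v v) $ i) \<in> \<real> \<and> 0 \<le> Re (\<Sum>i<n. cnj (v $ i) * (M *\<^sub>v v) $ i))
      = (0 \<le> qf n (ker M) (($) v))"
      by (simp only: less_eq_complex_def complex_is_Real_iff) auto
  qed
  also have "\<dots> \<longleftrightarrow> M \<in> carrier_mat n n \<and> psdk n (ker M)"
  proof (intro conj_cong refl iffI)
    assume h: "\<forall>v\<in>carrier_vec n. 0 \<le> qf n (ker M) (($) v)"
    show "psdk n (ker M)" unfolding psdk_def
    proof
      fix v show "0 \<le> qf n (ker M) v" unfolding **[of v] using h by simp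
    qed
  qed (simp add: psdk_def)
  finally show ?thesis .
qed

lemma density_iff: "density n M \<longleftrightarrow> M \<in> carrier_mat n n \<and> psdk n (ker M) \<and> tr n (ker M) = 1"
  by (auto simp: density_def psd_iff tr_def ker_def)

lemma qf_add: "qf n (\<lambda>i j. A i j + B i j) v = qf n A v + qf n B v"
  by (simp add: qf_def algebra_simps sum.distrib)

lemma qf_diff: "qf n (\<lambda>i j. A i j - B i j) v = qf n A v - qf n B v"
  by (simp add: qf_def algebra_simps sum_subtractf)

lemma qf_scale: "qf n (\<lambda>i j. c * A i j) v = c * qf n A v"
  by (simp add: qf_def sum_distrib_left mult_ac)

lemma qf_sum: "qf n (\<lambda>i j. \<Sum>k\<in>K. A k i j) v = (\<Sum>k\<in>K. qf n (A k) v)"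
  by (induction K rule: infinite_finite_induct) (simp_all add: qf_add, simp_all add: qf_def)

lemma psdk_add: "psdk n A \<Longrightarrow> psdk n B \<Longrightarrow> psdk n (\<lambda>i j. A i j + B i j)"
  by (simp add: psdk_def qf_add)

lemma psdk_sum: "(\<And>k. k \<in> K \<Longrightarrow> psdk n (A k)) \<Longrightarrow> psdk n (\<lambda>i j. \<Sum>k\<in>K. A k i j)"
  by (simp add: psdk_def qf_sum sum_nonneg)

lemma psdk_scale: "0 \<le> c \<Longrightarrow> psdk n A \<Longrightarrow> psdk n (\<lambda>i j. c * A i j)"
  by (simp add: psdk_def qf_scale)

lemma qf_rank1: "qf n (\<lambda>i j. v i * cnj (v j)) x = complex_of_real ((cmod (ip n v x))\<^sup>2)"
proof -
  have "qf n (\<lambda>i j. v i * cnj (v j)) x = (\<Sum>i<n. cnj (x i) * v i) * (\<Sum>j<n. cnj (v j) * x j)"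
    by (simp add: qf_def sum_product mult_ac)
  also have "\<dots> = ip n x v * ip n v x" by (simp add: ip_def)
  also have "\<dots> = ip n v x * cnj (ip n v x)" by (simp add: ip_cnj mult.commute)
  finally show ?thesis by (simp only: complex_norm_square)
qed

lemma psdk_rank1: "psdk n (\<lambda>i j. v i * cnj (v j))"
  by (simp add: psdk_def qf_rank1 less_eq_complex_def)

lemma psdk_gramI:
  assumes "\<And>i j. i < n \<Longrightarrow> j < n \<Longrightarrow> A i j = (\<Sum>k\<in>K. v k i * cnj (v k j))"
  shows "psdk n A"
proof -
  have "psdk n (\<lambda>i j. \<Sum>k\<in>K. v k i * cnj (v k j))"
    by (intro psdk_sum psdk_rank1)
  thus ?thesis using psdk_cong[of n A "\<lambda>i j. \<Sum>k\<in>K. v k i * cnj (v k j)"] assms by simp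
qed

text \<open>Vectors supported on two coordinates see exactly a 2-by-2 block. Values 1, -1, i, -i for
  x and y extract Hermitian symmetry and entry bounds from positivity.\<close>

lemma qf_two_point:
  assumes "i < n" "j < n" "i \<noteq> j"
  shows "qf n A (\<lambda>k. if k = i then x else if k = j then y else 0)
    = cnj x * A i i * x + cnj x * A i j * y + cnj y * A j i * x + cnj y * A j j * y"
proof -
  let ?v = "\<lambda>k. if k = i then x else if k = j then y else 0"
  have s: "(\<Sum>k<n. f k) = f i + f j" if "\<And>k. k \<noteq> i \<Longrightarrow> k \<noteq> j \<Longrightarrow> f k = 0" for f :: "nat \<Rightarrow> complex"
  proof -
    have "(\<Sum>k<n. f k) = sum f {i,j}"
      using assms that by (intro sum.mono_neutral_right) auto
    thus ?thesis using assms by simp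
  qed
  have "qf n A ?v = (\<Sum>k<n. cnj (?v k) * (\<Sum>m<n. A k m * ?v m))"
    by (simp add: qf_def sum_distrib_left mult_ac)
  also have "\<dots> = (\<Sum>k<n. cnj (?v k) * (A k i * x + A k j * y))"
    using assms by (subst s[of "\<lambda>m. A _ m * ?v m"]) auto
  also have "\<dots> = cnj x * (A i i * x + A i j * y) + cnj y * (A j i * x + A j j * y)"
    using assms by (subst s) auto
  finally show ?thesis by (simp add: algebra_simps)
qed

lemma qf_point:
  assumes "i < n"
  shows "qf n A (\<lambda>k. if k = i then x else 0) = cnj x * A i i * x"
proof -
  let ?v = "\<lambda>k. if k = i then x else 0"
  have s: "(\<Sum>k<n. f k) = f i" if "\<And>k. k \<noteq> i \<Longrightarrow> f k = 0" for f :: "nat \<Rightarrow> complex"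
  proof -
    have "(\<Sum>k<n. f k) = sum f {i}"
      using assms that by (intro sum.mono_neutral_right) auto
    thus ?thesis by simp
  qed
  have "qf n A ?v = (\<Sum>j<n. cnj (?v i) * A i j * ?v j)"
    unfolding qf_def by (rule s) simp
  also have "\<dots> = cnj (?v i) * A i i * ?v i" by (rule s) simp
  finally show ?thesis by simp
qed

text \<open>The order on the complex numbers makes \<open>0 \<le> qf n A v\<close> include that the
  value is real. Testing e_i + e_j then relates the imaginary parts of A i j and A j i, testing e_i
  + i e_j their real parts.\<close>

lemma psdk_herm:
  assumes "psdk n A"
  shows "herm n A"
proof -
  have im: "Im (qf n A v) = 0" for v
    using assms unfolding psdk_def less_eq_complex_def by simp
  have d: "Im (A i i) = 0" if "i < n" for i
    using im[of "\<lambda>k. if k = i then 1 else 0"] qf_point[OF that, of A 1] by simp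
  show ?thesis unfolding herm_def
  proof (intro allI impI)
    fix i j assume ij: "i < n" "j < n"
    show "A j i = cnj (A i j)"
    proof (cases "i = j")
      case True
      thus ?thesis using d[of i] ij by (simp add: complex_eq_iff)
    next
      case False
      have "Im (A i j) + Im (A j i) = 0"
        using im[of "\<lambda>k. if k = i then 1 else if k = j then 1 else 0"]
          qf_two_point[OF ij False, of A 1 1] d ij by simp
      moreover have "Re (A i j) - Re (A j i) = 0"
        using im[of "\<lambda>k. if k = i then 1 else if k = j then \<i> else 0"]
          qf_two_point[OF ij False, of A 1 \<i>] d ij by simp
      ultimately show ?thesis by (simp add: complex_eq_iff)
    qed
  qed
qed

lemma psdk_diag: "psdk n A \<Longrightarrow> i < n \<Longrightarrow> 0 \<le> A i i"
  using qf_point[of i n A 1] spec[of "\<lambda>v. 0 \<le> qf n A v" "\<lambda>k. if k = i then 1 else 0"]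
  by (simp add: psdk_def)

lemma psdk_tr: "psdk n A \<Longrightarrow> 0 \<le> tr n A"
  unfolding tr_def by (rule sum_nonneg) (simp add: psdk_diag)

definition gram :: "nat \<Rightarrow> (nat \<Rightarrow> nat \<Rightarrow> complex) \<Rightarrow> (nat \<Rightarrow> nat \<Rightarrow> complex) \<Rightarrow> bool" where
  "gram n A v \<longleftrightarrow> (\<forall>i<n. \<forall>j<n. A i j = (\<Sum>k<n. v k i * cnj (v k j)))"

lemma gramD: "gram n A v \<Longrightarrow> i < n \<Longrightarrow> j < n \<Longrightarrow> A i j = (\<Sum>k<n. v k i * cnj (v k j))"
  by (simp add: gram_def)

lemma spectralD:
  "spectral n A u l \<Longrightarrow> i < n \<Longrightarrow> j < n \<Longrightarrow> A i j = (\<Sum>k<n. complex_of_real (l k) * u k i * cnj (u k j))"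
  by (simp add: spectral_def)

lemma spectral_orthonormal: "spectral n A u l \<Longrightarrow> orthonormal n u"
  by (simp add: spectral_def)

lemma tr_spectral:
  assumes "spectral n A u l"
  shows "tr n A = complex_of_real (\<Sum>k<n. l k)"
proof -
  have "tr n A = (\<Sum>i<n. \<Sum>k<n. complex_of_real (l k) * u k i * cnj (u k i))"
    unfolding tr_def using spectralD[OF assms] by (intro sum.cong refl) blast
  also have "\<dots> = (\<Sum>k<n. \<Sum>i<n. complex_of_real (l k) * u k i * cnj (u k i))" by (rule sum.swap)
  also have "\<dots> = (\<Sum>k<n. complex_of_real (l k) * ip n (u k) (u k))"
    by (simp add: ip_def sum_distrib_left mult_ac)
  also have "\<dots> = (\<Sum>k<n. complex_of_real (l k))"
    using spectral_orthonormal[OF assms] by (simp add: orthonormal_def)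
  finally show ?thesis by simp
qed

lemma qf_spectral:
  assumes "spectral n A u l"
  shows "qf n A x = complex_of_real (\<Sum>k<n. l k * (cmod (ip n (u k) x))\<^sup>2)"
proof -
  have "qf n A x = qf n (\<lambda>i j. \<Sum>k<n. complex_of_real (l k) * (u k i * cnj (u k j))) x"
    using spectralD[OF assms] by (intro qf_cong) (simp_all only: mult.assoc)
  also have "\<dots> = (\<Sum>k<n. complex_of_real (l k) * complex_of_real ((cmod (ip n (u k) x))\<^sup>2))"
    by (simp only: qf_sum qf_scale qf_rank1)
  finally show ?thesis by simp
qed

lemma qf_eigenvector:
  assumes "spectral n A u l" "k < n"
  shows "qf n A (u k) = complex_of_real (l k)"
proof -
  have "(\<Sum>m<n. l m * (cmod (ip n (u m) (u k)))\<^sup>2) = (\<Sum>m<n. if m = k then l m else 0)"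
    using spectral_orthonormal[OF assms(1)] assms(2)
    by (intro sum.cong refl) (auto simp: orthonormal_def)
  thus ?thesis using assms(2) unfolding qf_spectral[OF assms(1)] by simp
qed

lemma psdk_spectral:
  assumes "psdk n A"
  shows "\<exists>u l. spectral n A u l \<and> (\<forall>k<n. l k \<ge> 0)"
proof -
  obtain u l where u: "spectral n A u l"
    using hermitian_spectral[OF psdk_herm[OF assms]] by blast
  have "l k \<ge> 0" if k: "k < n" for k
  proof -
    have "0 \<le> qf n A (u k)" using assms unfolding psdk_def by blast
    thus ?thesis unfolding qf_eigenvector[OF u k] by (simp add: less_eq_complex_def)
  qed
  thus ?thesis using u by blast
qed

lemma psdk_gram:
  assumes "psdk n A"
  shows "\<exists>v. gram n A v"
proof -
  obtain u l where u: "spectral n A u l" "\<forall>k<n. l k \<ge> 0"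
    using psdk_spectral[OF assms] by blast
  define v where "v k i = complex_of_real (sqrt (l k)) * u k i" for k i
  have "A i j = (\<Sum>k<n. v k i * cnj (v k j))" if ij: "i < n" "j < n" for i j
    unfolding spectralD[OF u(1) ij]
  proof (intro sum.cong refl)
    fix k assume "k \<in> {..<n}"
    hence "l k = sqrt (l k) * sqrt (l k)" using u(2) by simp
    hence "complex_of_real (l k) = complex_of_real (sqrt (l k)) * complex_of_real (sqrt (l k))"
      by (simp only: of_real_mult[symmetric])
    thus "complex_of_real (l k) * u k i * cnj (u k j) = v k i * cnj (v k j)"
      by (simp add: v_def mult_ac)
  qed
  hence "gram n A v" by (simp add: gram_def)
  thus ?thesis by blast
qed

lemma parseval:
  assumes "orthonormal n u"
  shows "(\<Sum>k<n. (cmod (ip n (u k) x))\<^sup>2) = (\<Sum>i<n. (cmod (x i))\<^sup>2)"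
proof -
  have "complex_of_real (\<Sum>i<n. (cmod (x i))\<^sup>2) = ip n x x" by (simp only: ip_self)
  also have "\<dots> = ip n x (\<lambda>i. \<Sum>k<n. ip n (u k) x * u k i)"
    using orthonormal_expand[OF assms] by (intro ip_cong) auto
  also have "\<dots> = (\<Sum>k<n. ip n (u k) x * cnj (ip n (u k) x))"
    by (simp only: ip_sum_right) (simp add: ip_cnj)
  also have "\<dots> = complex_of_real (\<Sum>k<n. (cmod (ip n (u k) x))\<^sup>2)"
    unfolding of_real_sum by (simp only: complex_norm_square)
  finally show ?thesis by (simp only: of_real_eq_iff)
qed

text \<open>Every eigenvalue is at most the trace. For trace 1 this is domination by the identity;
  for trace 0 it makes the form vanish.\<close>

lemma psdk_qf_le:
  assumes "psdk n A"
  shows "Re (qf n A x) \<le> Re (tr n A) * (\<Sum>i<n. (cmod (x i))\<^sup>2)"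
proof -
  obtain u l where u: "spectral n A u l" "\<forall>k<n. l k \<ge> 0"
    using psdk_spectral[OF assms] by blast
  have "Re (qf n A x) = (\<Sum>k<n. l k * (cmod (ip n (u k) x))\<^sup>2)"
    unfolding qf_spectral[OF u(1)] by simp
  also have "\<dots> \<le> (\<Sum>k<n. (\<Sum>m<n. l m) * (cmod (ip n (u k) x))\<^sup>2)"
    using u(2) by (intro sum_mono mult_right_mono member_le_sum) auto
  also have "\<dots> = Re (tr n A) * (\<Sum>i<n. (cmod (x i))\<^sup>2)"
    by (simp add: tr_spectral[OF u(1)] sum_distrib_left[symmetric] parseval[OF spectral_orthonormal[OF u(1)]])
  finally show ?thesis .
qed

text \<open>Gram vectors can be composed with any index map, injective or not. Hence digit
  extraction and exchange of tensor factors preserve positivity.\<close>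

lemma psdk_pullback:
  assumes "psdk m A" "\<And>i. i < n \<Longrightarrow> f i < m"
  shows "psdk n (\<lambda>i j. A (f i) (f j))"
proof -
  obtain v where v: "gram m A v" using psdk_gram[OF assms(1)] by blast
  show ?thesis
    by (rule psdk_gramI[where K = "{..<m}" and v = "\<lambda>k i. v k (f i)"]) (simp add: gramD[OF v] assms(2))
qed

text \<open>Pointwise products of Gram vectors of A and B, indexed by pairs, are Gram vectors of the
  pointwise product.\<close>

lemma psdk_schur_product:
  assumes "psdk n A" "psdk n B"
  shows "psdk n (\<lambda>i j. A i j * B i j)"
proof -
  obtain v where v: "gram n A v" using psdk_gram[OF assms(1)] by blast
  obtain w where w: "gram n B w" using psdk_gram[OF assms(2)] by blast
  show ?thesis
  proof (rule psdk_gramI[where K = "{..<n} \<times> {..<n}" and v = "\<lambda>p i. v (fst p) i * w (snd p) i"])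
    fix i j assume ij: "i < n" "j < n"
    have "A i j * B i j = (\<Sum>k<n. \<Sum>l<n. (v k i * cnj (v k j)) * (w l i * cnj (w l j)))"
      by (simp only: gramD[OF v ij] gramD[OF w ij] sum_product)
    also have "\<dots> = (\<Sum>p\<in>{..<n} \<times> {..<n}. (v (fst p) i * cnj (v (fst p) j)) * (w (snd p) i * cnj (w (snd p) j)))"
      by (simp only: sum.cartesian_product split_def)
    also have "\<dots> = (\<Sum>p\<in>{..<n} \<times> {..<n}. v (fst p) i * w (snd p) i * cnj (v (fst p) j * w (snd p) j))"
      by (intro sum.cong refl) (simp add: mult_ac)
    finally show "A i j * B i j = \<dots>" .
  qed
qed

section \<open>The trace norm of Hermitian matrices\<close>

text \<open>Serves to turn the multiplicity-weighted sum over the root set in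
  \<open>trace_norm\<close> into a sum over a list of eigenvalues.\<close>

lemma sum_roots_linear_factors:
  fixes f :: "complex \<Rightarrow> real"
  assumes "p = (\<Prod>a\<leftarrow>as. [:- a, 1:])"
  shows "(\<Sum>\<mu>\<in>{\<mu>. poly p \<mu> = 0}. real (Polynomial.order \<mu> p) * f \<mu>) = (\<Sum>a\<leftarrow>as. f a)"
proof -
  have nz: "(\<Prod>a\<leftarrow>as. [:- a, 1:]) \<noteq> 0" for as :: "complex list"
    by (auto simp: prod_list_zero_iff)
  have ord: "Polynomial.order \<mu> [:- a, 1:] = (if \<mu> = a then 1 else 0)" for \<mu> a :: complex
    using order_power_n_n[of a 1] by (auto intro: order_0I)
  \<comment> \<open>S is fixed and may exceed the root set, so the induction over the list never has
    to change it; additional points have order 0.\<close>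
  have *: "(\<Sum>\<mu>\<in>S. real (Polynomial.order \<mu> (\<Prod>a\<leftarrow>as. [:- a, 1:])) * f \<mu>) = (\<Sum>a\<leftarrow>as. f a)"
    if "finite S" "set as \<subseteq> S" for S and as :: "complex list"
    using that
  proof (induction as)
    case Nil
    show ?case by (simp add: order_0I)
  next
    case (Cons a as)
    have o: "Polynomial.order \<mu> (\<Prod>a\<leftarrow>a # as. [:- a, 1:]) = (if \<mu> = a then 1 else 0) + Polynomial.order \<mu> (\<Prod>a\<leftarrow>as. [:- a, 1:])" for \<mu>
      unfolding list.map prod_list.Cons
      by (subst order_mult) (use nz[of "a # as"] in \<open>simp_all add: ord\<close>)
    have "(\<Sum>\<mu>\<in>S. real (Polynomial.order \<mu> (\<Prod>a\<leftarrow>a # as. [:- a, 1:])) * f \<mu>)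
      = (\<Sum>\<mu>\<in>S. (if \<mu> = a then f \<mu> else 0)) + (\<Sum>\<mu>\<in>S. real (Polynomial.order \<mu> (\<Prod>a\<leftarrow>as. [:- a, 1:])) * f \<mu>)"
      unfolding o sum.distrib[symmetric] by (intro sum.cong refl) (simp add: algebra_simps)
    also have "(\<Sum>\<mu>\<in>S. (if \<mu> = a then f \<mu> else 0)) = f a" using Cons.prems by simp
    finally show ?case using Cons by simp
  qed
  have "{\<mu>. poly p \<mu> = 0} = set as"
    unfolding assms by (induction as) auto
  thus ?thesis using *[of "set as" as] assms by simp
qed

lemma diag_mult_entry:
  fixes d :: "nat \<Rightarrow> complex"
  assumes M: "M \<in> carrier_mat n n" and k: "k < n" and j: "j < n"
  shows "(mat n n (\<lambda>(i,j). if i = j then d i else 0) * M) $$ (k,j) = d k * M $$ (k,j)"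
proof -
  have "(mat n n (\<lambda>(i,j). if i = j then d i else 0) * M) $$ (k,j)
    = (\<Sum>m = 0..<n. (if k = m then d k else 0) * M $$ (m,j))"
    using assms by (auto simp: scalar_prod_def intro!: sum.cong)
  also have "\<dots> = (\<Sum>m = 0..<n. if m = k then d k * M $$ (k,j) else 0)"
    by (intro sum.cong refl) auto
  finally show ?thesis using k by simp
qed

text \<open>For Hermitian X the matrix \<open>adj X * X\<close> is the square of X, hence similar to
  the diagonal matrix of squared eigenvalues, whose characteristic polynomial is already
  factorised.\<close>

lemma trace_norm_spectral:
  assumes X: "X \<in> carrier_mat n n" and sp: "spectral n (ker X) u l"
  shows "trace_norm X = (\<Sum>k<n. \<bar>l k\<bar>)"
proof -
  note u = spectral_orthonormal[OF sp] and l = spectralD[OF sp, unfolded ker_def]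
  define W where "W = mat n n (\<lambda>(i,k). u k i)"
  define V where "V = mat n n (\<lambda>(k,i). cnj (u k i))"
  define D where "D = mat n n (\<lambda>(i,j). if i = j then complex_of_real (l i) else 0)"
  define E where "E = mat n n (\<lambda>(i,j). if i = j then complex_of_real ((l i)\<^sup>2) else 0)"
  have c: "W \<in> carrier_mat n n" "V \<in> carrier_mat n n" "D \<in> carrier_mat n n" "E \<in> carrier_mat n n"
    by (simp_all add: W_def V_def D_def E_def)
  have VW: "V * W = 1\<^sub>m n"
    using u by (intro eq_matI)
      (auto simp: V_def W_def scalar_prod_def orthonormal_def ip_def lessThan_atLeast0)
  have WV: "W * V = 1\<^sub>m n"
    by (rule mat_mult_left_right_inverse[OF c(2,1) VW])
  have DV: "(D * V) $$ (k,j) = complex_of_real (l k) * cnj (u k j)" if "k < n" "j < n" for k j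
    unfolding D_def using that by (subst diag_mult_entry[OF c(2)]) (simp_all add: V_def)
  have XW: "X = W * (D * V)"
  proof (rule eq_matI)
    fix i j assume "i < dim_row (W * (D * V))" "j < dim_col (W * (D * V))"
    hence ij: "i < n" "j < n" using c by auto
    have "(W * (D * V)) $$ (i,j) = (\<Sum>k = 0..<n. W $$ (i,k) * (D * V) $$ (k,j))"
      using ij c by (simp add: scalar_prod_def)
    also have "\<dots> = (\<Sum>k<n. u k i * (complex_of_real (l k) * cnj (u k j)))"
      unfolding lessThan_atLeast0 using ij by (intro sum.cong refl) (auto simp: DV W_def)
    finally show "X $$ (i,j) = (W * (D * V)) $$ (i,j)" using l[OF ij] by (simp add: mult_ac)
  qed (use c X in auto)
  have "adj X = X"
  proof (rule eq_matI)
    fix i j assume "i < dim_row X" "j < dim_col X"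
    thus "adj X $$ (i,j) = X $$ (i,j)"
      using X l by (simp add: adj_def mult_ac)
  qed (use X in \<open>auto simp: adj_def\<close>)
  moreover have "X * X = W * E * V"
  proof -
    have DD: "D * D = E"
    proof (rule eq_matI)
      fix i j assume "i < dim_row E" "j < dim_col E"
      hence ij: "i < n" "j < n" using c by auto
      have "(D * D) $$ (i,j) = complex_of_real (l i) * D $$ (i,j)"
        using diag_mult_entry[OF c(3) ij, of "\<lambda>i. complex_of_real (l i)"] by (simp add: D_def)
      also have "\<dots> = E $$ (i,j)" using ij by (simp add: D_def E_def power2_eq_square)
      finally show "(D * D) $$ (i,j) = E $$ (i,j)" .
    qed (use c in auto)
    have "X * X = W * (D * V) * (W * (D * V))" by (simp only: XW[symmetric])
    also have "\<dots> = W * (D * (V * W * (D * V)))"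
      using c by (simp add: assoc_mult_mat[of _ n n _ n _ n])
    also have "\<dots> = W * (D * D * V)"
      using c by (simp add: VW assoc_mult_mat[of _ n n _ n _ n])
    also have "\<dots> = W * E * V" using c DD by (simp add: assoc_mult_mat[of _ n n _ n _ n])
    finally show ?thesis .
  qed
  ultimately have "similar_mat (adj X * X) E"
    unfolding similar_mat_def similar_mat_wit_def using c X VW WV by (intro exI[of _ W] exI[of _ V]) (auto simp: Let_def)
  hence "char_poly (adj X * X) = char_poly E" by (rule char_poly_similar)
  also have "\<dots> = (\<Prod>a\<leftarrow>diag_mat E. [:- a, 1:])"
    by (rule char_poly_upper_triangular[OF c(4)]) (auto simp: E_def)
  finally have "trace_norm X = (\<Sum>a\<leftarrow>diag_mat E. sqrt (cmod a))"
    unfolding trace_norm_def Let_def by (rule sum_roots_linear_factors)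
  also have "diag_mat E = map (\<lambda>k. complex_of_real ((l k)\<^sup>2)) [0..<n]"
    by (simp add: diag_mat_def E_def)
  also have "(\<Sum>a\<leftarrow>map (\<lambda>k. complex_of_real ((l k)\<^sup>2)) [0..<n]. sqrt (cmod a)) = (\<Sum>k<n. \<bar>l k\<bar>)"
    by (simp add: o_def norm_power interv_sum_list_conv_sum_set_nat lessThan_atLeast0)
  finally show ?thesis .
qed

text \<open>The Jordan decomposition into the positive and the negative part of the
  spectrum.\<close>

lemma trace_norm_decompose:
  assumes X: "X \<in> carrier_mat n n" and h: "herm n (ker X)"
  shows "\<exists>P Q. psdk n P \<and> psdk n Q \<and> (\<forall>i<n. \<forall>j<n. X $$ (i,j) = P i j - Q i j) \<and>
    trace_norm X = Re (tr n P) + Re (tr n Q)"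
proof -
  obtain u l where u: "spectral n (ker X) u l"
    using hermitian_spectral[OF h] by blast
  define S where "S m i j = (\<Sum>k<n. complex_of_real (m k) * u k i * cnj (u k j))" for m i j
  have sp: "spectral n (S m) u m" for m
    using spectral_orthonormal[OF u] by (simp add: spectral_def S_def)
  have S: "psdk n (S m)" if "\<And>k. m k \<ge> 0" for m
    unfolding psdk_def
  proof
    fix v
    have "(\<Sum>k<n. m k * (cmod (ip n (u k) v))\<^sup>2) \<ge> 0" using that by (simp add: sum_nonneg)
    thus "0 \<le> qf n (S m) v" by (simp only: qf_spectral[OF sp] less_eq_complex_def) simp
  qed
  let ?p = "\<lambda>k. max (l k) 0" and ?q = "\<lambda>k. max (- l k) 0"
  have 1: "X $$ (i,j) = S ?p i j - S ?q i j" if "i < n" "j < n" for i j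
  proof -
    have "X $$ (i,j) = (\<Sum>k<n. complex_of_real (l k) * u k i * cnj (u k j))"
      using spectralD[OF u that] by (simp add: ker_def)
    also have "\<dots> = S ?p i j - S ?q i j"
      unfolding S_def sum_subtractf[symmetric]
      by (intro sum.cong refl) (auto simp: max_def)
    finally show ?thesis .
  qed
  have "trace_norm X = (\<Sum>k<n. \<bar>l k\<bar>)" by (rule trace_norm_spectral[OF X u])
  also have "\<dots> = (\<Sum>k<n. ?p k) + (\<Sum>k<n. ?q k)"
    unfolding sum.distrib[symmetric] by (intro sum.cong refl) auto
  also have "\<dots> = Re (tr n (S ?p)) + Re (tr n (S ?q))"
    by (simp only: tr_spectral[OF sp] Re_complex_of_real)
  finally have 2: "trace_norm X = Re (tr n (S ?p)) + Re (tr n (S ?q))" .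
  have "psdk n (S ?p)" "psdk n (S ?q)" by (auto intro: S)
  with 1 2 show ?thesis by (intro exI[of _ "S ?p"] exI[of _ "S ?q"]) simp
qed

text \<open>With \<open>trace_norm_decompose\<close> this shows that the trace norm is the least
  total trace of a splitting X = P - Q into positive parts. The triangle inequality, contractivity
  under channels and the bound on outcome probabilities rest on this characterisation.\<close>

lemma trace_norm_le:
  assumes X: "X \<in> carrier_mat n n" and P: "psdk n P" and Q: "psdk n Q"
    and eq: "\<And>i j. i < n \<Longrightarrow> j < n \<Longrightarrow> X $$ (i,j) = P i j - Q i j"
  shows "trace_norm X \<le> Re (tr n P) + Re (tr n Q)"
proof -
  have "herm n (ker X)"
    unfolding herm_def ker_def
  proof (intro allI impI)
    fix i j assume ij: "i < n" "j < n"
    have "P j i = cnj (P i j)" "Q j i = cnj (Q i j)"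
      using psdk_herm[OF P] psdk_herm[OF Q] ij unfolding herm_def by blast+
    thus "X $$ (j,i) = cnj (X $$ (i,j))" by (simp add: eq ij)
  qed
  then obtain u l where u: "spectral n (ker X) u l"
    using hermitian_spectral by blast
  note on = spectral_orthonormal[OF u]
  have lk: "\<bar>l k\<bar> \<le> Re (qf n P (u k)) + Re (qf n Q (u k))" if k: "k < n" for k
  proof -
    have "l k = Re (qf n (ker X) (u k))" unfolding qf_eigenvector[OF u k] by simp
    also have "qf n (ker X) (u k) = qf n P (u k) - qf n Q (u k)"
      using eq by (subst qf_diff[symmetric], intro qf_cong) (auto simp: ker_def)
    finally have "l k = Re (qf n P (u k)) - Re (qf n Q (u k))" by simp
    moreover have "Re (qf n P (u k)) \<ge> 0" "Re (qf n Q (u k)) \<ge> 0"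
      using P Q by (auto simp: psdk_def less_eq_complex_def)
    ultimately show ?thesis by simp
  qed
  \<comment> \<open>The trace computed in the eigenbasis of X, by completeness of
    \<open>u\<close>.\<close>
  have trq: "(\<Sum>k<n. qf n P (u k)) = tr n P" for P
  proof -
    have "(\<Sum>k<n. qf n P (u k)) = (\<Sum>k<n. \<Sum>i<n. \<Sum>j<n. P i j * (u k j * cnj (u k i)))"
      by (simp add: qf_def mult_ac)
    also have "\<dots> = (\<Sum>i<n. \<Sum>k<n. \<Sum>j<n. P i j * (u k j * cnj (u k i)))" by (rule sum.swap)
    also have "\<dots> = (\<Sum>i<n. \<Sum>j<n. \<Sum>k<n. P i j * (u k j * cnj (u k i)))"
      by (intro sum.cong refl sum.swap)
    also have "\<dots> = (\<Sum>i<n. \<Sum>j<n. if j = i then P i i else 0)"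
      using on by (intro sum.cong refl) (simp add: orthonormal_complete sum_distrib_left[symmetric])
    also have "\<dots> = tr n P" by (simp add: tr_def)
    finally show ?thesis .
  qed
  have "trace_norm X = (\<Sum>k<n. \<bar>l k\<bar>)" by (rule trace_norm_spectral[OF X u])
  also have "\<dots> \<le> (\<Sum>k<n. Re (qf n P (u k)) + Re (qf n Q (u k)))"
    using lk by (intro sum_mono) simp
  also have "\<dots> = Re (tr n P) + Re (tr n Q)"
    by (simp add: sum.distrib trq[symmetric])
  finally show ?thesis .
qed

section \<open>LOCC maps\<close>

lemma sum_prod_index:
  fixes f :: "nat \<Rightarrow> 'a :: comm_monoid_add"
  shows "(\<Sum>r<a*b. f r) = (\<Sum>i<a. \<Sum>j<b. f (i*b+j))"
proof -
  have "(\<Sum>r<a*b. f r) = (\<Sum>i<a. sum f {i*b..<i*b+b})" by (rule sum.nat_group[symmetric])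
  also have "\<dots> = (\<Sum>i<a. \<Sum>j<b. f (i*b+j))"
  proof (rule sum.cong[OF refl])
    fix i
    show "sum f {i*b..<i*b+b} = (\<Sum>j<b. f (i*b+j))"
      using sum.shift_bounds_nat_ivl[of f 0 "i*b" b] by (simp add: lessThan_atLeast0 add.commute)
  qed
  finally show ?thesis .
qed

lemma pair_index_less: "i < a \<Longrightarrow> j < b \<Longrightarrow> i*b+j < a*(b::nat)"
proof -
  assume "i < a" "j < b"
  hence "i*b+j < i*b+b" by simp
  also have "\<dots> = (i+1)*b" by simp
  also have "\<dots> \<le> a*b" using \<open>i < a\<close> by (intro mult_right_mono) auto
  finally show ?thesis .
qed

lemma index_div_less: "r < a*b \<Longrightarrow> r div b < (a::nat)"
  by (simp add: less_mult_imp_div_less)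

lemma index_mod_less: "r < a*b \<Longrightarrow> r mod b < (b::nat)"
  by (cases "b = 0") auto

lemma div_mod_eq_iff: "r div b = s div b \<and> r mod b = s mod b \<longleftrightarrow> r = (s::nat)"
proof
  assume h: "r div b = s div b \<and> r mod b = s mod b"
  have "r = r div b * b + r mod b" by (rule div_mult_mod_eq[symmetric])
  also have "\<dots> = s div b * b + s mod b" using h by (simp only: h)
  also have "\<dots> = s" by (rule div_mult_mod_eq)
  finally show "r = s" .
qed simp

lemma delta_div_mod:
  "(if r div b = s div b then 1 else 0) * (if r mod b = s mod b then 1 else 0)
    = (if r = (s::nat) then 1 else (0::complex))"
  unfolding div_mod_eq_iff[of r b s, symmetric] by simp

lemma adj_carrier[simp]: "A \<in> carrier_mat m n \<Longrightarrow> adj A \<in> carrier_mat n m"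
  by (auto simp: adj_def)

lemma adj_entry: "A \<in> carrier_mat m n \<Longrightarrow> i < n \<Longrightarrow> j < m \<Longrightarrow> adj A $$ (i,j) = cnj (A $$ (j,i))"
  by (auto simp: adj_def)

lemma kron_carrier[simp]:
  "A \<in> carrier_mat m n \<Longrightarrow> B \<in> carrier_mat p q \<Longrightarrow> kron A B \<in> carrier_mat (m*p) (n*q)"
  by (auto simp: kron_def)

lemma kron_entry:
  "A \<in> carrier_mat m n \<Longrightarrow> B \<in> carrier_mat p q \<Longrightarrow> r < m*p \<Longrightarrow> s < n*q \<Longrightarrow>
   kron A B $$ (r,s) = A $$ (r div p, s div q) * B $$ (r mod p, s mod q)"
  by (auto simp: kron_def)

lemma mult_entry:
  "A \<in> carrier_mat m n \<Longrightarrow> B \<in> carrier_mat n p \<Longrightarrow> i < m \<Longrightarrow> j < p \<Longrightarrow>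
   (A * B) $$ (i,j) = (\<Sum>k<n. A $$ (i,k) * B $$ (k,j))"
  by (auto simp: scalar_prod_def lessThan_atLeast0)

lemma kron_mult:
  assumes A: "A \<in> carrier_mat m n" and B: "B \<in> carrier_mat p q"
    and C: "C \<in> carrier_mat n m'" and D: "D \<in> carrier_mat q p'"
  shows "kron A B * kron C D = kron (A * C) (B * D)"
proof (rule eq_matI)
  fix r s assume "r < dim_row (kron (A * C) (B * D))" "s < dim_col (kron (A * C) (B * D))"
  hence r: "r < m*p" and s: "s < m'*p'" using A B C D by (auto simp: kron_def)
  note rr = index_div_less[OF r] index_mod_less[OF r] and ss = index_div_less[OF s] index_mod_less[OF s]
  have "(kron A B * kron C D) $$ (r,s) = (\<Sum>k<n*q. kron A B $$ (r,k) * kron C D $$ (k,s))"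
    using A B C D r s by (intro mult_entry[of _ "m*p" _ _ "m'*p'"]) auto
  also have "\<dots> = (\<Sum>k<n*q. (A $$ (r div p, k div q) * C $$ (k div q, s div p'))
                  * (B $$ (r mod p, k mod q) * D $$ (k mod q, s mod p')))"
    using r s by (intro sum.cong refl) (simp add: kron_entry[OF A B] kron_entry[OF C D])
  also have "\<dots> = (\<Sum>i<n. \<Sum>j<q. (A $$ (r div p, i) * C $$ (i, s div p')) * (B $$ (r mod p, j) * D $$ (j, s mod p')))"
    unfolding sum_prod_index by (intro sum.cong refl) simp
  also have "\<dots> = (A * C) $$ (r div p, s div p') * (B * D) $$ (r mod p, s mod p')"
    using rr ss by (simp add: mult_entry[OF A C] mult_entry[OF B D] sum_product)
  also have "\<dots> = kron (A * C) (B * D) $$ (r,s)"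
    by (rule kron_entry[symmetric, OF mult_carrier_mat[OF A C] mult_carrier_mat[OF B D] r s])
  finally show "(kron A B * kron C D) $$ (r,s) = kron (A * C) (B * D) $$ (r,s)" .
qed (use A B C D in \<open>auto simp: kron_def\<close>)

lemma adj_kron:
  assumes A: "A \<in> carrier_mat m n" and B: "B \<in> carrier_mat p q"
  shows "adj (kron A B) = kron (adj A) (adj B)"
proof (rule eq_matI)
  fix r s assume "r < dim_row (kron (adj A) (adj B))" "s < dim_col (kron (adj A) (adj B))"
  hence r: "r < n*q" and s: "s < m*p" using A B by (auto simp: kron_def adj_def)
  note rr = index_div_less[OF r] index_mod_less[OF r] and ss = index_div_less[OF s] index_mod_less[OF s]
  show "adj (kron A B) $$ (r,s) = kron (adj A) (adj B) $$ (r,s)"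
    using r s rr ss
    by (simp add: adj_entry[OF kron_carrier[OF A B]] kron_entry[OF A B]
        kron_entry[OF adj_carrier[OF A] adj_carrier[OF B]] adj_entry[OF A] adj_entry[OF B])
qed (use A B in \<open>auto simp: kron_def adj_def\<close>)

lemma adj_one: "adj (1\<^sub>m n) = 1\<^sub>m n"
  by (rule eq_matI) (auto simp: adj_def)

definition cj :: "complex mat \<Rightarrow> complex mat \<Rightarrow> complex mat" where
  "cj F X = F * X * adj F"

lemma cj_carrier[simp]: "F \<in> carrier_mat m n \<Longrightarrow> X \<in> carrier_mat n n \<Longrightarrow> cj F X \<in> carrier_mat m m"
  by (auto simp: cj_def adj_def)

lemma cj_entry:
  assumes F: "F \<in> carrier_mat m n" and X: "X \<in> carrier_mat n n" and r: "r < m" and s: "s < m"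
  shows "cj F X $$ (r,s) = (\<Sum>p<n. \<Sum>q<n. F $$ (r,p) * X $$ (p,q) * cnj (F $$ (s,q)))"
proof -
  have "cj F X $$ (r,s) = (\<Sum>q<n. (F * X) $$ (r,q) * adj F $$ (q,s))"
    unfolding cj_def using r s by (intro mult_entry[OF mult_carrier_mat[OF F X] adj_carrier[OF F]])
  also have "\<dots> = (\<Sum>q<n. \<Sum>p<n. F $$ (r,p) * X $$ (p,q) * cnj (F $$ (s,q)))"
    using r s by (intro sum.cong refl)
      (simp add: mult_entry[OF F X] adj_entry[OF F] sum_distrib_right)
  also have "\<dots> = (\<Sum>p<n. \<Sum>q<n. F $$ (r,p) * X $$ (p,q) * cnj (F $$ (s,q)))" by (rule sum.swap)
  finally show ?thesis .
qed

lemma cj_psd: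
  assumes F: "F \<in> carrier_mat m n" and X: "psd n X"
  shows "psd m (cj F X)"
proof -
  have Xc: "X \<in> carrier_mat n n" and Xp: "psdk n (ker X)" using X by (auto simp: psd_iff)
  obtain v where v: "gram n (ker X) v" using psdk_gram[OF Xp] by blast
  have "psdk m (ker (cj F X))"
  proof (rule psdk_gramI[where K = "{..<n}" and v = "\<lambda>k r. \<Sum>p<n. F $$ (r,p) * v k p"])
    fix r s assume rs: "r < m" "s < m"
    have "ker (cj F X) r s = (\<Sum>p<n. \<Sum>q<n. F $$ (r,p) * X $$ (p,q) * cnj (F $$ (s,q)))"
      unfolding ker_def by (rule cj_entry[OF F Xc rs])
    also have "\<dots> = (\<Sum>p<n. \<Sum>q<n. \<Sum>k<n. (F $$ (r,p) * v k p) * cnj (F $$ (s,q) * v k q))"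
    proof (intro sum.cong refl)
      fix p q assume "p \<in> {..<n}" "q \<in> {..<n}"
      hence "X $$ (p,q) = (\<Sum>k<n. v k p * cnj (v k q))" using gramD[OF v] by (simp add: ker_def)
      thus "F $$ (r,p) * X $$ (p,q) * cnj (F $$ (s,q)) = (\<Sum>k<n. (F $$ (r,p) * v k p) * cnj (F $$ (s,q) * v k q))"
        by (simp add: sum_distrib_left sum_distrib_right mult_ac)
    qed
    also have "\<dots> = (\<Sum>p<n. \<Sum>k<n. \<Sum>q<n. (F $$ (r,p) * v k p) * cnj (F $$ (s,q) * v k q))"
      by (intro sum.cong refl sum.swap)
    also have "\<dots> = (\<Sum>k<n. \<Sum>p<n. \<Sum>q<n. (F $$ (r,p) * v k p) * cnj (F $$ (s,q) * v k q))"
      by (rule sum.swap)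
    also have "\<dots> = (\<Sum>k<n. (\<Sum>p<n. F $$ (r,p) * v k p) * cnj (\<Sum>q<n. F $$ (s,q) * v k q))"
      unfolding cnj_sum sum_product ..
    finally show "ker (cj F X) r s = \<dots>" .
  qed
  thus ?thesis using F Xc by (simp add: psd_iff)
qed

lemma cj_kron:
  assumes A: "A \<in> carrier_mat m n" and B: "B \<in> carrier_mat p q"
    and X: "X \<in> carrier_mat n n" and Y: "Y \<in> carrier_mat q q"
  shows "cj (kron A B) (kron X Y) = kron (cj A X) (cj B Y)"
  unfolding cj_def adj_kron[OF A B] kron_mult[OF A B X Y]
  by (rule kron_mult[OF mult_carrier_mat[OF A X] mult_carrier_mat[OF B Y] adj_carrier[OF A] adj_carrier[OF B]])

lemma cj_one: "X \<in> carrier_mat n n \<Longrightarrow> cj (1\<^sub>m n) X = X"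
  by (simp add: cj_def adj_one)

text \<open>Branch sums of \<open>LOCC\<close> have this form, so linearity of a protocol becomes a
  single law. Sums and differences of two matrices are the case N = 2, the zero matrix is the case N
  = 0.\<close>

definition lcomb :: "nat \<Rightarrow> nat \<Rightarrow> (nat \<Rightarrow> complex) \<Rightarrow> (nat \<Rightarrow> complex mat) \<Rightarrow> complex mat" where
  "lcomb n N c Y = mat n n (\<lambda>(r,s). \<Sum>k<N. c k * Y k $$ (r,s))"

lemma lcomb_carrier[simp]: "lcomb n N c Y \<in> carrier_mat n n"
  by (simp add: lcomb_def)

lemma lcomb_entry: "r < n \<Longrightarrow> s < n \<Longrightarrow> lcomb n N c Y $$ (r,s) = (\<Sum>k<N. c k * Y k $$ (r,s))"
  by (simp add: lcomb_def)

lemma lcomb_cong: "(\<And>k. k < N \<Longrightarrow> Y k = Z k) \<Longrightarrow> lcomb n N c Y = lcomb n N c Z"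
  unfolding lcomb_def by (intro cong_mat refl) (auto intro!: sum.cong)

lemma lcomb_swap:
  "lcomb n M d (\<lambda>j. lcomb n N c (Y j)) = lcomb n N c (\<lambda>k. lcomb n M d (\<lambda>j. Y j k))"
proof (rule eq_matI)
  fix r s assume "r < dim_row (lcomb n N c (\<lambda>k. lcomb n M d (\<lambda>j. Y j k)))"
    "s < dim_col (lcomb n N c (\<lambda>k. lcomb n M d (\<lambda>j. Y j k)))"
  hence rs: "r < n" "s < n" by (auto simp: lcomb_def)
  have "(\<Sum>j<M. \<Sum>k<N. d j * (c k * Y j k $$ (r,s))) = (\<Sum>k<N. \<Sum>j<M. d j * (c k * Y j k $$ (r,s)))"
    by (rule sum.swap)
  thus "lcomb n M d (\<lambda>j. lcomb n N c (Y j)) $$ (r,s) = lcomb n N c (\<lambda>k. lcomb n M d (\<lambda>j. Y j k)) $$ (r,s)"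
    using rs by (simp add: lcomb_entry sum_distrib_left mult_ac)
qed (auto simp: lcomb_def)

lemma cj_lcomb:
  assumes F: "F \<in> carrier_mat m n" and Y: "\<And>k. k < N \<Longrightarrow> Y k \<in> carrier_mat n n"
  shows "cj F (lcomb n N c Y) = lcomb m N c (\<lambda>k. cj F (Y k))"
proof (rule eq_matI)
  fix r s assume "r < dim_row (lcomb m N c (\<lambda>k. cj F (Y k)))" "s < dim_col (lcomb m N c (\<lambda>k. cj F (Y k)))"
  hence rs: "r < m" "s < m" by (auto simp: lcomb_def)
  have "cj F (lcomb n N c Y) $$ (r,s) = (\<Sum>p<n. \<Sum>q<n. \<Sum>k<N. c k * (F $$ (r,p) * Y k $$ (p,q) * cnj (F $$ (s,q))))"
    unfolding cj_entry[OF F lcomb_carrier rs]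
    by (intro sum.cong refl) (simp add: lcomb_entry sum_distrib_left sum_distrib_right mult_ac)
  also have "\<dots> = (\<Sum>p<n. \<Sum>k<N. \<Sum>q<n. c k * (F $$ (r,p) * Y k $$ (p,q) * cnj (F $$ (s,q))))"
    by (intro sum.cong refl sum.swap)
  also have "\<dots> = (\<Sum>k<N. \<Sum>p<n. \<Sum>q<n. c k * (F $$ (r,p) * Y k $$ (p,q) * cnj (F $$ (s,q))))"
    by (rule sum.swap)
  also have "\<dots> = (\<Sum>k<N. c k * cj F (Y k) $$ (r,s))"
    by (intro sum.cong refl) (simp add: cj_entry[OF F Y rs] sum_distrib_left)
  finally show "cj F (lcomb n N c Y) $$ (r,s) = lcomb m N c (\<lambda>k. cj F (Y k)) $$ (r,s)"
    using rs by (simp add: lcomb_entry)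
qed (use F in \<open>auto simp: cj_def adj_def lcomb_def\<close>)

definition lin_map :: "nat \<Rightarrow> nat \<Rightarrow> (complex mat \<Rightarrow> complex mat) \<Rightarrow> bool" where
  "lin_map n m L \<longleftrightarrow> (\<forall>X\<in>carrier_mat n n. L X \<in> carrier_mat m m) \<and>
     (\<forall>N c Y. (\<forall>k<N. Y k \<in> carrier_mat n n) \<longrightarrow> L (lcomb n N c Y) = lcomb m N c (\<lambda>k. L (Y k)))"

text \<open>The same condition as \<open>instrument\<close>; the separate name also covers families
  such as \<open>kron (K k) (1\<^sub>m b)\<close> that act on the joint system.\<close>

definition complete_kraus :: "nat \<Rightarrow> nat \<Rightarrow> nat \<Rightarrow> (nat \<Rightarrow> complex mat) \<Rightarrow> bool" where
  "complete_kraus N m n F \<longleftrightarrow> (\<forall>k<N. F k \<in> carrier_mat m n) \<and>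
     (\<forall>r<n. \<forall>s<n. (\<Sum>k<N. (adj (F k) * F k) $$ (r,s)) = (if r = s then 1 else 0))"

lemma instrument_iff_complete_kraus: "instrument = complete_kraus"
  by (intro ext) (simp add: instrument_def complete_kraus_def)

lemma sum_tr_cj:
  assumes F: "complete_kraus N m n F" and X: "X \<in> carrier_mat n n"
  shows "(\<Sum>k<N. tr m (ker (cj (F k) X))) = tr n (ker X)"
proof -
  have Fc: "F k \<in> carrier_mat m n" if "k < N" for k using F that by (simp add: complete_kraus_def)
  have "tr m (ker (cj (F k) X)) = (\<Sum>p<n. \<Sum>q<n. X $$ (p,q) * (adj (F k) * F k) $$ (q,p))" if k: "k < N" for k
  proof -
    have "tr m (ker (cj (F k) X)) = (\<Sum>r<m. \<Sum>p<n. \<Sum>q<n. X $$ (p,q) * (cnj (F k $$ (r,q)) * F k $$ (r,p)))"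
      unfolding tr_def ker_def by (intro sum.cong refl) (simp add: cj_entry[OF Fc[OF k] X] mult_ac)
    also have "\<dots> = (\<Sum>p<n. \<Sum>r<m. \<Sum>q<n. X $$ (p,q) * (cnj (F k $$ (r,q)) * F k $$ (r,p)))"
      by (rule sum.swap)
    also have "\<dots> = (\<Sum>p<n. \<Sum>q<n. \<Sum>r<m. X $$ (p,q) * (cnj (F k $$ (r,q)) * F k $$ (r,p)))"
      by (intro sum.cong refl sum.swap)
    also have "\<dots> = (\<Sum>p<n. \<Sum>q<n. X $$ (p,q) * (adj (F k) * F k) $$ (q,p))"
      by (intro sum.cong refl)
        (simp add: mult_entry[OF adj_carrier[OF Fc[OF k]] Fc[OF k]] adj_entry[OF Fc[OF k]] sum_distrib_left)
    finally show ?thesis .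
  qed
  hence "(\<Sum>k<N. tr m (ker (cj (F k) X))) = (\<Sum>k<N. \<Sum>p<n. \<Sum>q<n. X $$ (p,q) * (adj (F k) * F k) $$ (q,p))"
    by (intro sum.cong refl) simp
  also have "\<dots> = (\<Sum>p<n. \<Sum>k<N. \<Sum>q<n. X $$ (p,q) * (adj (F k) * F k) $$ (q,p))" by (rule sum.swap)
  also have "\<dots> = (\<Sum>p<n. \<Sum>q<n. \<Sum>k<N. X $$ (p,q) * (adj (F k) * F k) $$ (q,p))"
    by (intro sum.cong refl sum.swap)
  also have "\<dots> = (\<Sum>p<n. \<Sum>q<n. if q = p then X $$ (p,p) else 0)"
  proof (intro sum.cong refl)
    fix p q assume "p \<in> {..<n}" "q \<in> {..<n}"
    hence "(\<Sum>k<N. (adj (F k) * F k) $$ (q,p)) = (if q = p then 1 else 0)"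
      using F unfolding complete_kraus_def by blast
    thus "(\<Sum>k<N. X $$ (p,q) * (adj (F k) * F k) $$ (q,p)) = (if q = p then X $$ (p,p) else 0)"
      unfolding sum_distrib_left[symmetric] by simp
  qed
  also have "\<dots> = tr n (ker X)" by (simp add: tr_def ker_def)
  finally show ?thesis .
qed

lemma tr_lcomb: "tr n (ker (lcomb n N c Y)) = (\<Sum>k<N. c k * tr n (ker (Y k)))"
proof -
  have "tr n (ker (lcomb n N c Y)) = (\<Sum>i<n. \<Sum>k<N. c k * Y k $$ (i,i))"
    by (simp add: tr_def ker_def lcomb_entry)
  also have "\<dots> = (\<Sum>k<N. \<Sum>i<n. c k * Y k $$ (i,i))" by (rule sum.swap)
  finally show ?thesis by (simp add: tr_def ker_def sum_distrib_left)
qed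

lemma psd_lcomb:
  assumes "\<And>k. k < N \<Longrightarrow> psd n (Y k)" "\<And>k. k < N \<Longrightarrow> 0 \<le> c k"
  shows "psd n (lcomb n N c Y)"
proof -
  have "psdk n (\<lambda>r s. \<Sum>k\<in>{..<N}. c k * ker (Y k) r s)"
    using assms by (intro psdk_sum psdk_scale) (auto simp: psd_iff)
  thus ?thesis unfolding psd_iff
    by (subst psdk_cong[of n _ "\<lambda>r s. \<Sum>k\<in>{..<N}. c k * ker (Y k) r s"])
      (simp_all add: lcomb_entry ker_def)
qed

definition channel :: "nat \<Rightarrow> nat \<Rightarrow> (complex mat \<Rightarrow> complex mat) \<Rightarrow> bool" where
  "channel n m L \<longleftrightarrow> lin_map n m L \<and> (\<forall>X. psd n X \<longrightarrow> psd m (L X)) \<and>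
     (\<forall>X\<in>carrier_mat n n. tr m (ker (L X)) = tr n (ker X))"

lemma channel_lcomb:
  "channel n m L \<Longrightarrow> (\<And>k. k < N \<Longrightarrow> Y k \<in> carrier_mat n n) \<Longrightarrow> L (lcomb n N c Y) = lcomb m N c (\<lambda>k. L (Y k))"
  by (simp add: channel_def lin_map_def)

lemma channel_carrier: "channel n m L \<Longrightarrow> X \<in> carrier_mat n n \<Longrightarrow> L X \<in> carrier_mat m m"
  by (simp add: channel_def lin_map_def)

lemma channel_psd: "channel n m L \<Longrightarrow> psd n X \<Longrightarrow> psd m (L X)"
  by (simp add: channel_def)

lemma channel_tr: "channel n m L \<Longrightarrow> X \<in> carrier_mat n n \<Longrightarrow> tr m (ker (L X)) = tr n (ker X)"
  by (simp add: channel_def)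

text \<open>One round together with its continuations. Rounds of either party are instances once
  their Kraus operators are extended by an identity, so the induction over protocols reduces to this
  lemma.\<close>

lemma channel_kraus_step:
  assumes F: "complete_kraus N p n F" and L: "\<And>k. k < N \<Longrightarrow> channel p m (L k)"
  shows "channel n m (\<lambda>X. lcomb m N (\<lambda>_. 1) (\<lambda>k. L k (cj (F k) X)))"
proof -
  have Fc: "F k \<in> carrier_mat p n" if "k < N" for k using F that by (simp add: complete_kraus_def)
  have lin: "L k (lcomb p M c Y) = lcomb m M c (\<lambda>j. L k (Y j))"
    if "k < N" "\<And>j. j < M \<Longrightarrow> Y j \<in> carrier_mat p p" for k M c Y
    by (rule channel_lcomb[OF L[OF that(1)] that(2)])
  have "lin_map n m (\<lambda>X. lcomb m N (\<lambda>_. 1) (\<lambda>k. L k (cj (F k) X)))"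
    unfolding lin_map_def
  proof (intro conjI ballI allI impI)
    fix M c and Y :: "nat \<Rightarrow> complex mat" assume Y: "\<forall>k<M. Y k \<in> carrier_mat n n"
    have "lcomb m N (\<lambda>_. 1) (\<lambda>k. L k (cj (F k) (lcomb n M c Y)))
      = lcomb m N (\<lambda>_. 1) (\<lambda>k. lcomb m M c (\<lambda>j. L k (cj (F k) (Y j))))"
    proof (rule lcomb_cong)
      fix k assume k: "k < N"
      have "cj (F k) (lcomb n M c Y) = lcomb p M c (\<lambda>j. cj (F k) (Y j))"
        using Y by (intro cj_lcomb[OF Fc[OF k]]) blast
      thus "L k (cj (F k) (lcomb n M c Y)) = lcomb m M c (\<lambda>j. L k (cj (F k) (Y j)))"
        using Y Fc[OF k] by (simp add: lin[OF k])
    qed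
    also have "\<dots> = lcomb m M c (\<lambda>j. lcomb m N (\<lambda>_. 1) (\<lambda>k. L k (cj (F k) (Y j))))"
      by (rule lcomb_swap)
    finally show "lcomb m N (\<lambda>_. 1) (\<lambda>k. L k (cj (F k) (lcomb n M c Y))) = \<dots>" .
  qed simp
  moreover have "psd m (lcomb m N (\<lambda>_. 1) (\<lambda>k. L k (cj (F k) X)))" if "psd n X" for X
  proof (rule psd_lcomb)
    fix k assume k: "k < N"
    show "psd m (L k (cj (F k) X))"
      using L[OF k] cj_psd[OF Fc[OF k] that] unfolding channel_def by blast
  qed (simp add: less_eq_complex_def)
  moreover have "tr m (ker (lcomb m N (\<lambda>_. 1) (\<lambda>k. L k (cj (F k) X)))) = tr n (ker X)"
    if X: "X \<in> carrier_mat n n" for X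
  proof -
    have "tr m (ker (L k (cj (F k) X))) = tr p (ker (cj (F k) X))" if k: "k < N" for k
      using L[OF k] cj_carrier[OF Fc[OF k] X] unfolding channel_def by blast
    hence "(\<Sum>k<N. tr m (ker (L k (cj (F k) X)))) = (\<Sum>k<N. tr p (ker (cj (F k) X)))"
      by (intro sum.cong refl) simp
    thus ?thesis unfolding tr_lcomb using sum_tr_cj[OF F X] by simp
  qed
  ultimately show ?thesis by (simp add: channel_def)
qed

lemma channel_id: "channel n n (\<lambda>X. X)"
  by (simp add: channel_def lin_map_def)

section \<open>Protocols as channels, and their composition\<close>

lemma complete_kraus_kron_left:
  assumes "complete_kraus N c a K"
  shows "complete_kraus N (c*b) (a*b) (\<lambda>k. kron (K k) (1\<^sub>m b))"
proof -
  have Kc: "K k \<in> carrier_mat c a" if "k < N" for k using assms that by (simp add: complete_kraus_def)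
  have "(\<Sum>k<N. (adj (kron (K k) (1\<^sub>m b)) * kron (K k) (1\<^sub>m b)) $$ (r,s)) = (if r = s then 1 else 0)"
    if r: "r < a*b" and s: "s < a*b" for r s
  proof -
    note rr = index_div_less[OF r] index_mod_less[OF r] and ss = index_div_less[OF s] index_mod_less[OF s]
    have "(\<Sum>k<N. (adj (kron (K k) (1\<^sub>m b)) * kron (K k) (1\<^sub>m b)) $$ (r,s))
      = (\<Sum>k<N. (adj (K k) * K k) $$ (r div b, s div b) * (1\<^sub>m b) $$ (r mod b, s mod b))"
    proof (intro sum.cong refl)
      fix k assume "k \<in> {..<N}"
      hence K: "K k \<in> carrier_mat c a" using Kc by simp
      have "adj (kron (K k) (1\<^sub>m b)) * kron (K k) (1\<^sub>m b) = kron (adj (K k) * K k) (1\<^sub>m b)"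
        unfolding adj_kron[OF K one_carrier_mat] adj_one
        by (subst kron_mult[OF adj_carrier[OF K] one_carrier_mat K one_carrier_mat]) simp
      thus "(adj (kron (K k) (1\<^sub>m b)) * kron (K k) (1\<^sub>m b)) $$ (r,s)
        = (adj (K k) * K k) $$ (r div b, s div b) * (1\<^sub>m b) $$ (r mod b, s mod b)"
        using kron_entry[OF mult_carrier_mat[OF adj_carrier[OF K] K] one_carrier_mat r s] by simp
    qed
    also have "\<dots> = (if r div b = s div b then 1 else 0) * (if r mod b = s mod b then 1 else 0)"
      using assms rr ss unfolding complete_kraus_def by (simp add: sum_distrib_right[symmetric])
    also have "\<dots> = (if r = s then 1 else 0)"
      by (rule delta_div_mod)
    finally show ?thesis .
  qed
  thus ?thesis using Kc by (simp add: complete_kraus_def)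
qed

lemma complete_kraus_kron_right:
  assumes "complete_kraus N d b K"
  shows "complete_kraus N (a*d) (a*b) (\<lambda>k. kron (1\<^sub>m a) (K k))"
proof -
  have Kc: "K k \<in> carrier_mat d b" if "k < N" for k using assms that by (simp add: complete_kraus_def)
  have "(\<Sum>k<N. (adj (kron (1\<^sub>m a) (K k)) * kron (1\<^sub>m a) (K k)) $$ (r,s)) = (if r = s then 1 else 0)"
    if r: "r < a*b" and s: "s < a*b" for r s
  proof -
    note rr = index_div_less[OF r] index_mod_less[OF r] and ss = index_div_less[OF s] index_mod_less[OF s]
    have "(\<Sum>k<N. (adj (kron (1\<^sub>m a) (K k)) * kron (1\<^sub>m a) (K k)) $$ (r,s))
      = (\<Sum>k<N. (1\<^sub>m a) $$ (r div b, s div b) * (adj (K k) * K k) $$ (r mod b, s mod b))"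
    proof (intro sum.cong refl)
      fix k assume "k \<in> {..<N}"
      hence K: "K k \<in> carrier_mat d b" using Kc by simp
      have "adj (kron (1\<^sub>m a) (K k)) * kron (1\<^sub>m a) (K k) = kron (1\<^sub>m a) (adj (K k) * K k)"
        unfolding adj_kron[OF one_carrier_mat K] adj_one
        by (subst kron_mult[OF one_carrier_mat adj_carrier[OF K] one_carrier_mat K]) simp
      thus "(adj (kron (1\<^sub>m a) (K k)) * kron (1\<^sub>m a) (K k)) $$ (r,s)
        = (1\<^sub>m a) $$ (r div b, s div b) * (adj (K k) * K k) $$ (r mod b, s mod b)"
        using kron_entry[OF one_carrier_mat mult_carrier_mat[OF adj_carrier[OF K] K] r s] by simp
    qed
    also have "\<dots> = (if r div b = s div b then 1 else 0) * (if r mod b = s mod b then 1 else 0)"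
      using assms rr ss unfolding complete_kraus_def by (simp add: sum_distrib_left[symmetric])
    also have "\<dots> = (if r = s then 1 else 0)"
      by (rule delta_div_mod)
    finally show ?thesis .
  qed
  thus ?thesis using Kc by (simp add: complete_kraus_def)
qed

lemma LOCC_Alice':
  assumes "complete_kraus N c a K" "\<And>k. k < N \<Longrightarrow> LOCC c b e f (L k)"
  shows "LOCC a b e f (\<lambda>X. lcomb (e*f) N (\<lambda>_. 1) (\<lambda>k. L k (cj (kron (K k) (1\<^sub>m b)) X)))"
  using LOCC_Alice[of N c a K b e f L] assms
  by (simp add: instrument_iff_complete_kraus lcomb_def cj_def)

lemma LOCC_Bob':
  assumes "complete_kraus N d b K" "\<And>k. k < N \<Longrightarrow> LOCC a d e f (L k)"
  shows "LOCC a b e f (\<lambda>X. lcomb (e*f) N (\<lambda>_. 1) (\<lambda>k. L k (cj (kron (1\<^sub>m a) (K k)) X)))"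
  using LOCC_Bob[of N d b K a e f L] assms
  by (simp add: instrument_iff_complete_kraus lcomb_def cj_def)

lemma LOCC_induct' [consumes 1, case_names id Alice Bob]:
  assumes "LOCC a b c d L"
    and "\<And>a b. P a b a b (\<lambda>X. X)"
    and "\<And>N c a K b e f L. complete_kraus N c a K \<Longrightarrow> (\<And>k. k < N \<Longrightarrow> LOCC c b e f (L k)) \<Longrightarrow>
      (\<And>k. k < N \<Longrightarrow> P c b e f (L k)) \<Longrightarrow>
      P a b e f (\<lambda>X. lcomb (e*f) N (\<lambda>_. 1) (\<lambda>k. L k (cj (kron (K k) (1\<^sub>m b)) X)))"
    and "\<And>N d b K a e f L. complete_kraus N d b K \<Longrightarrow> (\<And>k. k < N \<Longrightarrow> LOCC a d e f (L k)) \<Longrightarrow>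
      (\<And>k. k < N \<Longrightarrow> P a d e f (L k)) \<Longrightarrow>
      P a b e f (\<lambda>X. lcomb (e*f) N (\<lambda>_. 1) (\<lambda>k. L k (cj (kron (1\<^sub>m a) (K k)) X)))"
  shows "P a b c d L"
  using assms(1)
proof (induction rule: LOCC.induct)
  case (LOCC_id a b)
  show ?case by (rule assms(2))
next
  case (LOCC_Alice N c a K b e f L)
  thus ?case using assms(3)[of N c a K b e f L]
    by (simp add: instrument_iff_complete_kraus lcomb_def cj_def)
next
  case (LOCC_Bob N d b K a e f L)
  thus ?case using assms(4)[of N d b K a e f L]
    by (simp add: instrument_iff_complete_kraus lcomb_def cj_def)
qed

lemma LOCC_channel: "LOCC a b c d L \<Longrightarrow> channel (a*b) (c*d) L"
proof (induction rule: LOCC_induct')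
  case (id a b)
  show ?case by (rule channel_id)
next
  case (Alice N c a K b e f L)
  show ?case by (rule channel_kraus_step[OF complete_kraus_kron_left[OF Alice(1)] Alice(3)])
next
  case (Bob N d b K a e f L)
  show ?case by (rule channel_kraus_step[OF complete_kraus_kron_right[OF Bob(1)] Bob(3)])
qed

text \<open>The rules of \<open>LOCC\<close> add rounds at the front, so the induction runs over the
  earlier protocol and \<open>G\<close> is attached at its leaves; linearity of \<open>G\<close>
  pulls it out of the branch sum. Linearity is available on matrices of the right size, hence the
  restriction to \<open>carrier_mat\<close>.\<close>

lemma LOCC_compose:
  assumes "LOCC a b c d L" "LOCC c d e f G"
  shows "\<exists>D. LOCC a b e f D \<and> (\<forall>X\<in>carrier_mat (a*b) (a*b). D X = G (L X))"
  using assms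
proof (induction rule: LOCC_induct')
  case (id a b)
  thus ?case by blast
next
  case (Alice N c a K b e' f' L)
  define D where "D k = (SOME D. LOCC c b e f D \<and> (\<forall>X\<in>carrier_mat (c*b) (c*b). D X = G (L k X)))" for k
  have "LOCC c b e f (D k) \<and> (\<forall>X\<in>carrier_mat (c*b) (c*b). D k X = G (L k X))" if "k < N" for k
    unfolding D_def by (rule someI_ex[OF Alice(3)[OF that Alice(4)]])
  hence D: "\<And>k. k < N \<Longrightarrow> LOCC c b e f (D k)"
       "\<And>k X. k < N \<Longrightarrow> X \<in> carrier_mat (c*b) (c*b) \<Longrightarrow> D k X = G (L k X)"
    by blast+
  have Kc: "kron (K k) (1\<^sub>m b) \<in> carrier_mat (c*b) (a*b)" if "k < N" for k
    using complete_kraus_kron_left[OF Alice(1), of b] that unfolding complete_kraus_def by blast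
  have "lcomb (e*f) N (\<lambda>_. 1) (\<lambda>k. D k (cj (kron (K k) (1\<^sub>m b)) X))
      = G (lcomb (e'*f') N (\<lambda>_. 1) (\<lambda>k. L k (cj (kron (K k) (1\<^sub>m b)) X)))"
    if X: "X \<in> carrier_mat (a*b) (a*b)" for X
  proof -
    have c: "L k (cj (kron (K k) (1\<^sub>m b)) X) \<in> carrier_mat (e'*f') (e'*f')" if "k < N" for k
      by (rule channel_carrier[OF LOCC_channel[OF Alice(2)[OF that]] cj_carrier[OF Kc[OF that] X]])
    have "G (lcomb (e'*f') N (\<lambda>_. 1) (\<lambda>k. L k (cj (kron (K k) (1\<^sub>m b)) X)))
      = lcomb (e*f) N (\<lambda>_. 1) (\<lambda>k. G (L k (cj (kron (K k) (1\<^sub>m b)) X)))"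
      by (rule channel_lcomb[OF LOCC_channel[OF Alice(4)] c])
    also have "\<dots> = lcomb (e*f) N (\<lambda>_. 1) (\<lambda>k. D k (cj (kron (K k) (1\<^sub>m b)) X))"
      using D(2) cj_carrier[OF Kc X] by (intro lcomb_cong) simp
    finally show ?thesis ..
  qed
  moreover have "LOCC a b e f (\<lambda>X. lcomb (e*f) N (\<lambda>_. 1) (\<lambda>k. D k (cj (kron (K k) (1\<^sub>m b)) X)))"
    by (rule LOCC_Alice'[OF Alice(1)]) (rule D(1))
  ultimately show ?case by (intro exI conjI ballI)
next
  case (Bob N d b K a e' f' L)
  define D where "D k = (SOME D. LOCC a d e f D \<and> (\<forall>X\<in>carrier_mat (a*d) (a*d). D X = G (L k X)))" for k
  have "LOCC a d e f (D k) \<and> (\<forall>X\<in>carrier_mat (a*d) (a*d). D k X = G (L k X))" if "k < N" for k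
    unfolding D_def by (rule someI_ex[OF Bob(3)[OF that Bob(4)]])
  hence D: "\<And>k. k < N \<Longrightarrow> LOCC a d e f (D k)"
       "\<And>k X. k < N \<Longrightarrow> X \<in> carrier_mat (a*d) (a*d) \<Longrightarrow> D k X = G (L k X)"
    by blast+
  have Kc: "kron (1\<^sub>m a) (K k) \<in> carrier_mat (a*d) (a*b)" if "k < N" for k
    using complete_kraus_kron_right[OF Bob(1), of a] that unfolding complete_kraus_def by blast
  have "lcomb (e*f) N (\<lambda>_. 1) (\<lambda>k. D k (cj (kron (1\<^sub>m a) (K k)) X))
      = G (lcomb (e'*f') N (\<lambda>_. 1) (\<lambda>k. L k (cj (kron (1\<^sub>m a) (K k)) X)))"
    if X: "X \<in> carrier_mat (a*b) (a*b)" for X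
  proof -
    have c: "L k (cj (kron (1\<^sub>m a) (K k)) X) \<in> carrier_mat (e'*f') (e'*f')" if "k < N" for k
      by (rule channel_carrier[OF LOCC_channel[OF Bob(2)[OF that]] cj_carrier[OF Kc[OF that] X]])
    have "G (lcomb (e'*f') N (\<lambda>_. 1) (\<lambda>k. L k (cj (kron (1\<^sub>m a) (K k)) X)))
      = lcomb (e*f) N (\<lambda>_. 1) (\<lambda>k. G (L k (cj (kron (1\<^sub>m a) (K k)) X)))"
      by (rule channel_lcomb[OF LOCC_channel[OF Bob(4)] c])
    also have "\<dots> = lcomb (e*f) N (\<lambda>_. 1) (\<lambda>k. D k (cj (kron (1\<^sub>m a) (K k)) X))"
      using D(2) cj_carrier[OF Kc X] by (intro lcomb_cong) simp
    finally show ?thesis ..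
  qed
  moreover have "LOCC a b e f (\<lambda>X. lcomb (e*f) N (\<lambda>_. 1) (\<lambda>k. D k (cj (kron (1\<^sub>m a) (K k)) X)))"
    by (rule LOCC_Bob'[OF Bob(1)]) (rule D(1))
  ultimately show ?case by (intro exI conjI ballI)
qed

section \<open>Contractivity of the trace norm\<close>

lemma lcomb_diff:
  assumes "X \<in> carrier_mat n n" "Y \<in> carrier_mat n n"
  shows "X - Y = lcomb n 2 (\<lambda>k. if k = 0 then 1 else - 1) (\<lambda>k. if k = 0 then X else Y)"
  using assms by (intro eq_matI) (auto simp: lcomb_def lessThan_Suc numeral_2_eq_2)

lemma lcomb_add:
  assumes "X \<in> carrier_mat n n" "Y \<in> carrier_mat n n"
  shows "X + Y = lcomb n 2 (\<lambda>_. 1) (\<lambda>k. if k = 0 then X else Y)"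
  using assms by (intro eq_matI) (auto simp: lcomb_def lessThan_Suc numeral_2_eq_2)

lemma lcomb_0: "lcomb n 0 c Y = 0\<^sub>m n n"
  by (intro eq_matI) (auto simp: lcomb_def)

lemma channel_diff:
  assumes L: "channel n m L" and X: "X \<in> carrier_mat n n" and Y: "Y \<in> carrier_mat n n"
  shows "L (X - Y) = L X - L Y"
proof -
  have "L (X - Y) = lcomb m 2 (\<lambda>k. if k = 0 then 1 else - 1) (\<lambda>k. L (if k = 0 then X else Y))"
    unfolding lcomb_diff[OF X Y] using X Y by (intro channel_lcomb[OF L]) auto
  also have "\<dots> = lcomb m 2 (\<lambda>k. if k = 0 then 1 else - 1) (\<lambda>k. if k = 0 then L X else L Y)"
    by (rule lcomb_cong) simp
  finally show ?thesis
    using lcomb_diff[OF channel_carrier[OF L X] channel_carrier[OF L Y]] by simp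
qed

lemma channel_add:
  assumes L: "channel n m L" and X: "X \<in> carrier_mat n n" and Y: "Y \<in> carrier_mat n n"
  shows "L (X + Y) = L X + L Y"
proof -
  have "L (X + Y) = lcomb m 2 (\<lambda>_. 1) (\<lambda>k. L (if k = 0 then X else Y))"
    unfolding lcomb_add[OF X Y] using X Y by (intro channel_lcomb[OF L]) auto
  also have "\<dots> = lcomb m 2 (\<lambda>_. 1) (\<lambda>k. if k = 0 then L X else L Y)"
    by (rule lcomb_cong) simp
  finally show ?thesis
    using lcomb_add[OF channel_carrier[OF L X] channel_carrier[OF L Y]] by simp
qed

lemma channel_zero:
  assumes "channel n m L"
  shows "L (0\<^sub>m n n) = 0\<^sub>m m m"
  using channel_lcomb[OF assms, of 0 "\<lambda>_. 0\<^sub>m n n" "\<lambda>_. 0"] by (simp add: lcomb_0)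

lemma herm_diff:
  assumes "psd n X" "psd n Y"
  shows "herm n (ker (X - Y))"
  unfolding herm_def
proof (intro allI impI)
  fix i j assume ij: "i < n" "j < n"
  have c: "X \<in> carrier_mat n n" "Y \<in> carrier_mat n n" using assms by (auto simp: psd_iff)
  have "herm n (ker X)" "herm n (ker Y)" using assms by (auto simp: psd_iff psdk_herm)
  hence "ker X j i = cnj (ker X i j)" "ker Y j i = cnj (ker Y i j)"
    using ij unfolding herm_def by blast+
  thus "ker (X - Y) j i = cnj (ker (X - Y) i j)" using c ij by (simp add: ker_def)
qed

lemma ker_mat: "i < n \<Longrightarrow> j < n \<Longrightarrow> ker (mat n n (\<lambda>(i,j). P i j)) i j = P i j"
  by (simp add: ker_def)

lemma psd_mat: "psdk n P \<Longrightarrow> psd n (mat n n (\<lambda>(i,j). P i j))"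
  unfolding psd_iff using psdk_cong[of n "ker (mat n n (\<lambda>(i,j). P i j))" P] by (simp add: ker_mat)

lemma tr_mat: "tr n (ker (mat n n (\<lambda>(i,j). P i j))) = tr n P"
  by (rule tr_cong) (simp add: ker_mat)

text \<open>A positive map sends the optimal splitting P - Q of X - Y to a splitting of the image,
  and preservation of the trace keeps its cost.\<close>

lemma trace_norm_channel:
  assumes L: "channel n m L" and X: "psd n X" and Y: "psd n Y"
  shows "trace_norm (L X - L Y) \<le> trace_norm (X - Y)"
proof -
  have c: "X \<in> carrier_mat n n" "Y \<in> carrier_mat n n" using X Y by (auto simp: psd_iff)
  have "X - Y \<in> carrier_mat n n" by (rule minus_carrier_mat[OF c(2)])
  from trace_norm_decompose[OF this herm_diff[OF X Y]]
  obtain P Q where PQ: "psdk n P" "psdk n Q" "\<forall>i<n. \<forall>j<n. (X - Y) $$ (i,j) = P i j - Q i j"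
    "trace_norm (X - Y) = Re (tr n P) + Re (tr n Q)" by blast
  let ?P = "mat n n (\<lambda>(i,j). P i j)" and ?Q = "mat n n (\<lambda>(i,j). Q i j)"
  have PQc: "?P \<in> carrier_mat n n" "?Q \<in> carrier_mat n n" by auto
  have "X - Y = ?P - ?Q"
  proof (rule eq_matI)
    fix i j assume "i < dim_row (?P - ?Q)" "j < dim_col (?P - ?Q)"
    hence ij: "i < n" "j < n" by auto
    hence "(X - Y) $$ (i,j) = P i j - Q i j" using PQ(3) by blast
    also have "\<dots> = (?P - ?Q) $$ (i,j)" using ij by simp
    finally show "(X - Y) $$ (i,j) = (?P - ?Q) $$ (i,j)" .
  qed (use c in auto)
  hence d: "L X - L Y = L ?P - L ?Q"
    using channel_diff[OF L c] channel_diff[OF L PQc] by simp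
  have LP: "psd m (L ?P)" "psd m (L ?Q)" using PQ by (auto intro: channel_psd[OF L] psd_mat)
  have "trace_norm (L X - L Y) \<le> Re (tr m (ker (L ?P))) + Re (tr m (ker (L ?Q)))"
    unfolding d using LP
    by (intro trace_norm_le) (auto simp: psd_iff ker_def)
  also have "\<dots> = trace_norm (X - Y)"
    by (simp add: channel_tr[OF L PQc(1)] channel_tr[OF L PQc(2)] tr_mat PQ(4))
  finally show ?thesis .
qed

text \<open>The sum of optimal splittings of X - Y and Y - Z is a splitting of X - Z.\<close>

lemma trace_norm_triangle:
  assumes X: "psd n X" and Y: "psd n Y" and Z: "psd n Z"
  shows "trace_norm (X - Z) \<le> trace_norm (X - Y) + trace_norm (Y - Z)"
proof -
  have c: "X \<in> carrier_mat n n" "Y \<in> carrier_mat n n" "Z \<in> carrier_mat n n"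
    using X Y Z by (auto simp: psd_iff)
  have "X - Y \<in> carrier_mat n n" by (rule minus_carrier_mat[OF c(2)])
  from trace_norm_decompose[OF this herm_diff[OF X Y]]
  obtain P Q where PQ: "psdk n P" "psdk n Q" "\<forall>i<n. \<forall>j<n. (X - Y) $$ (i,j) = P i j - Q i j"
    "trace_norm (X - Y) = Re (tr n P) + Re (tr n Q)" by blast
  have "Y - Z \<in> carrier_mat n n" by (rule minus_carrier_mat[OF c(3)])
  from trace_norm_decompose[OF this herm_diff[OF Y Z]]
  obtain P' Q' where PQ': "psdk n P'" "psdk n Q'" "\<forall>i<n. \<forall>j<n. (Y - Z) $$ (i,j) = P' i j - Q' i j"
    "trace_norm (Y - Z) = Re (tr n P') + Re (tr n Q')" by blast
  have "trace_norm (X - Z) \<le> Re (tr n (\<lambda>i j. P i j + P' i j)) + Re (tr n (\<lambda>i j. Q i j + Q' i j))"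
  proof (rule trace_norm_le)
    fix i j assume ij: "i < n" "j < n"
    have "(X - Y) $$ (i,j) = P i j - Q i j" "(Y - Z) $$ (i,j) = P' i j - Q' i j"
      using PQ(3) PQ'(3) ij by blast+
    moreover have "(X - Z) $$ (i,j) = (X - Y) $$ (i,j) + (Y - Z) $$ (i,j)" using c ij by simp
    ultimately show "(X - Z) $$ (i,j) = (P i j + P' i j) - (Q i j + Q' i j)" by simp
  qed (use c PQ PQ' in \<open>auto intro: psdk_add\<close>)
  thus ?thesis by (simp add: PQ(4) PQ'(4) tr_def sum.distrib)
qed

lemma trace_norm_nonneg: "psd n X \<Longrightarrow> psd n Y \<Longrightarrow> 0 \<le> trace_norm (X - Y)"
proof -
  assume X: "psd n X" and Y: "psd n Y"
  have "X - Y \<in> carrier_mat n n" using X Y by (simp add: psd_iff minus_carrier_mat)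
  from trace_norm_decompose[OF this herm_diff[OF X Y]]
  obtain P Q where "psdk n P" "psdk n Q" "trace_norm (X - Y) = Re (tr n P) + Re (tr n Q)" by blast
  thus ?thesis using psdk_tr[of n P] psdk_tr[of n Q] by (simp add: less_eq_complex_def)
qed

lemma trace_norm_self: "psd n X \<Longrightarrow> trace_norm (X - X) = 0"
proof -
  assume X: "psd n X"
  have "trace_norm (X - X) \<le> Re (tr n (\<lambda>_ _. 0)) + Re (tr n (\<lambda>_ _. 0))"
    using X by (intro trace_norm_le) (auto simp: psd_iff psdk_def qf_def)
  thus ?thesis using trace_norm_nonneg[OF X X] by (simp add: tr_def)
qed

section \<open>Exchanging the parties\<close>

definition sw :: "nat \<Rightarrow> nat \<Rightarrow> nat \<Rightarrow> nat" where
  "sw a b r = (r mod a) * b + r div a"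

lemma sw_less: "r < b*a \<Longrightarrow> sw a b r < a*b"
  unfolding sw_def using index_div_less[of r b a] index_mod_less[of r b a] by (intro pair_index_less)

lemma sw_div: "r < b*a \<Longrightarrow> sw a b r div b = r mod a"
  unfolding sw_def using index_div_less[of r b a] by simp

lemma sw_mod: "r < b*a \<Longrightarrow> sw a b r mod b = r div a"
  unfolding sw_def using index_div_less[of r b a] by simp

lemma sw_sw: "r < b*a \<Longrightarrow> sw b a (sw a b r) = r"
  using sw_div[of r b a] sw_mod[of r b a] by (simp add: sw_def[of b a])

lemma sum_sw: "(\<Sum>r<b*a. f (sw a b r)) = (\<Sum>p<a*b. f p)"
  by (rule sum.reindex_bij_witness[where i = "sw b a" and j = "sw a b"]) (auto simp: sw_sw sw_less)

lemma swap_state_alt: "swap_state a b X = mat (b*a) (b*a) (\<lambda>(r,s). X $$ (sw a b r, sw a b s))"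
  by (simp add: swap_state_def sw_def)

lemma swap_state_entry:
  "r < b*a \<Longrightarrow> s < b*a \<Longrightarrow> swap_state a b X $$ (r,s) = X $$ (sw a b r, sw a b s)"
  by (simp add: swap_state_alt)

lemma swap_state_carrier[simp]: "swap_state a b X \<in> carrier_mat (b*a) (b*a)"
  by (simp add: swap_state_alt)

lemma swap_swap: "X \<in> carrier_mat (a*b) (a*b) \<Longrightarrow> swap_state b a (swap_state a b X) = X"
  by (rule eq_matI) (auto simp: swap_state_entry sw_sw sw_less swap_state_alt)

lemma swap_lcomb:
  "swap_state a b (lcomb (a*b) N c Y) = lcomb (b*a) N c (\<lambda>k. swap_state a b (Y k))"
  by (rule eq_matI) (auto simp: swap_state_alt lcomb_def sw_less)

lemma swap_channel: "channel (a*b) (b*a) (swap_state a b)"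
  unfolding channel_def lin_map_def
proof (intro conjI ballI allI impI)
  fix X assume X: "psd (a*b) X"
  hence "psdk (b*a) (\<lambda>r s. ker X (sw a b r) (sw a b s))"
    using psdk_pullback[of "a*b" "ker X" "b*a" "sw a b"] by (simp add: psd_iff sw_less)
  moreover have "psdk (b*a) (ker (swap_state a b X)) = psdk (b*a) (\<lambda>r s. ker X (sw a b r) (sw a b s))"
    by (rule psdk_cong) (simp add: ker_def swap_state_entry)
  ultimately show "psd (b*a) (swap_state a b X)" by (simp add: psd_iff)
next
  fix X :: "complex mat"
  have "tr (b*a) (ker (swap_state a b X)) = (\<Sum>r<b*a. X $$ (sw a b r, sw a b r))"
    by (simp add: tr_def ker_def swap_state_entry)
  also have "\<dots> = tr (a*b) (ker X)" unfolding tr_def ker_def by (rule sum_sw)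
  finally show "tr (b*a) (ker (swap_state a b X)) = tr (a*b) (ker X)" .
qed (simp_all add: swap_lcomb)

lemma cj_swap:
  assumes A: "A \<in> carrier_mat c a" and B: "B \<in> carrier_mat d b" and X: "X \<in> carrier_mat (a*b) (a*b)"
  shows "cj (kron B A) (swap_state a b X) = swap_state c d (cj (kron A B) X)"
proof (rule eq_matI)
  fix r s assume "r < dim_row (swap_state c d (cj (kron A B) X))" "s < dim_col (swap_state c d (cj (kron A B) X))"
  hence r: "r < d*c" and s: "s < d*c" by (auto simp: swap_state_alt)
  have k: "kron B A $$ (r,p) = kron A B $$ (sw c d r, sw a b p)" if "r < d*c" "p < b*a" for r p
    using that by (simp add: kron_entry[OF B A] kron_entry[OF A B] sw_less sw_div sw_mod)
  have "cj (kron B A) (swap_state a b X) $$ (r,s)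
    = (\<Sum>p<b*a. \<Sum>q<b*a. kron B A $$ (r,p) * swap_state a b X $$ (p,q) * cnj (kron B A $$ (s,q)))"
    using r s by (intro cj_entry[OF kron_carrier[OF B A] swap_state_carrier])
  also have "\<dots> = (\<Sum>p<b*a. \<Sum>q<b*a. kron A B $$ (sw c d r, sw a b p) * X $$ (sw a b p, sw a b q) * cnj (kron A B $$ (sw c d s, sw a b q)))"
    using r s by (intro sum.cong refl) (simp add: k swap_state_entry)
  also have "\<dots> = (\<Sum>p<b*a. \<Sum>q<a*b. kron A B $$ (sw c d r, sw a b p) * X $$ (sw a b p, q) * cnj (kron A B $$ (sw c d s, q)))"
    by (intro sum.cong refl sum_sw)
  also have "\<dots> = (\<Sum>p<a*b. \<Sum>q<a*b. kron A B $$ (sw c d r, p) * X $$ (p, q) * cnj (kron A B $$ (sw c d s, q)))"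
    by (rule sum_sw)
  also have "\<dots> = cj (kron A B) X $$ (sw c d r, sw c d s)"
    using r s by (intro cj_entry[OF kron_carrier[OF A B] X, symmetric]) (auto simp: sw_less)
  also have "\<dots> = swap_state c d (cj (kron A B) X) $$ (r,s)"
    using r s by (simp add: swap_state_entry)
  finally show "cj (kron B A) (swap_state a b X) $$ (r,s) = swap_state c d (cj (kron A B) X) $$ (r,s)" .
qed (use A B in \<open>auto simp: cj_def swap_state_alt kron_def adj_def\<close>)

text \<open>The mirrored protocol: each round of Alice becomes a round of Bob with the same Kraus
  operators, and conversely. \<open>cj_swap\<close> carries a single round across the
  exchange.\<close>

lemma LOCC_swap:
  assumes "LOCC a b c d L"
  shows "\<exists>L'. LOCC b a d c L' \<and> (\<forall>X\<in>carrier_mat (a*b) (a*b). L' (swap_state a b X) = swap_state c d (L X))"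
  using assms
proof (induction rule: LOCC_induct')
  case (id a b)
  show ?case by (intro exI[of _ "\<lambda>X. X"]) (simp add: LOCC_id)
next
  case (Alice N c a K b e f L)
  define D where "D k = (SOME D. LOCC b c f e D \<and> (\<forall>X\<in>carrier_mat (c*b) (c*b). D (swap_state c b X) = swap_state e f (L k X)))" for k
  have D: "LOCC b c f e (D k) \<and> (\<forall>X\<in>carrier_mat (c*b) (c*b). D k (swap_state c b X) = swap_state e f (L k X))" if "k < N" for k
    unfolding D_def by (rule someI_ex[OF Alice(3)[OF that]])
  have Kc: "K k \<in> carrier_mat c a" if "k < N" for k using Alice(1) that unfolding complete_kraus_def by blast
  have "LOCC b a f e (\<lambda>X. lcomb (f*e) N (\<lambda>_. 1) (\<lambda>k. D k (cj (kron (1\<^sub>m b) (K k)) X)))"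
    using D by (intro LOCC_Bob'[OF Alice(1)]) blast
  moreover have "lcomb (f*e) N (\<lambda>_. 1) (\<lambda>k. D k (cj (kron (1\<^sub>m b) (K k)) (swap_state a b X)))
    = swap_state e f (lcomb (e*f) N (\<lambda>_. 1) (\<lambda>k. L k (cj (kron (K k) (1\<^sub>m b)) X)))"
    if X: "X \<in> carrier_mat (a*b) (a*b)" for X
    unfolding swap_lcomb
  proof (rule lcomb_cong)
    fix k assume k: "k < N"
    have "cj (kron (K k) (1\<^sub>m b)) X \<in> carrier_mat (c*b) (c*b)"
      by (intro cj_carrier[OF kron_carrier[OF Kc[OF k] one_carrier_mat] X])
    thus "D k (cj (kron (1\<^sub>m b) (K k)) (swap_state a b X)) = swap_state e f (L k (cj (kron (K k) (1\<^sub>m b)) X))"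
      unfolding cj_swap[OF Kc[OF k] one_carrier_mat X] using D[OF k] by blast
  qed
  ultimately show ?case by (intro exI conjI ballI)
next
  case (Bob N d b K a e f L)
  define D where "D k = (SOME D. LOCC d a f e D \<and> (\<forall>X\<in>carrier_mat (a*d) (a*d). D (swap_state a d X) = swap_state e f (L k X)))" for k
  have D: "LOCC d a f e (D k) \<and> (\<forall>X\<in>carrier_mat (a*d) (a*d). D k (swap_state a d X) = swap_state e f (L k X))" if "k < N" for k
    unfolding D_def by (rule someI_ex[OF Bob(3)[OF that]])
  have Kc: "K k \<in> carrier_mat d b" if "k < N" for k using Bob(1) that unfolding complete_kraus_def by blast
  have "LOCC b a f e (\<lambda>X. lcomb (f*e) N (\<lambda>_. 1) (\<lambda>k. D k (cj (kron (K k) (1\<^sub>m a)) X)))"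
    using D by (intro LOCC_Alice'[OF Bob(1)]) blast
  moreover have "lcomb (f*e) N (\<lambda>_. 1) (\<lambda>k. D k (cj (kron (K k) (1\<^sub>m a)) (swap_state a b X)))
    = swap_state e f (lcomb (e*f) N (\<lambda>_. 1) (\<lambda>k. L k (cj (kron (1\<^sub>m a) (K k)) X)))"
    if X: "X \<in> carrier_mat (a*b) (a*b)" for X
    unfolding swap_lcomb
  proof (rule lcomb_cong)
    fix k assume k: "k < N"
    have "cj (kron (1\<^sub>m a) (K k)) X \<in> carrier_mat (a*d) (a*d)"
      by (intro cj_carrier[OF kron_carrier[OF one_carrier_mat Kc[OF k]] X])
    thus "D k (cj (kron (K k) (1\<^sub>m a)) (swap_state a b X)) = swap_state e f (L k (cj (kron (1\<^sub>m a) (K k)) X))"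
      unfolding cj_swap[OF one_carrier_mat Kc[OF k] X] using D[OF k] by blast
  qed
  ultimately show ?case by (intro exI conjI ballI)
qed

section \<open>The cone of separable operators\<close>

text \<open>Unnormalised, since branches of a protocol carry probabilities and the identity operator
  has to be included. Adding one product at a time turns additive statements into inductions over
  product operators.\<close>

inductive sepc :: "nat \<Rightarrow> nat \<Rightarrow> complex mat \<Rightarrow> bool" for a b where
  sepc_zero: "sepc a b (0\<^sub>m (a*b) (a*b))"
| sepc_add_kron: "sepc a b X \<Longrightarrow> psd a A \<Longrightarrow> psd b B \<Longrightarrow> sepc a b (X + kron A B)"

lemma sepc_carrier: "sepc a b X \<Longrightarrow> X \<in> carrier_mat (a*b) (a*b)"
  by (induction rule: sepc.induct) (auto simp: psd_iff)

lemma sepc_add: "sepc a b Y \<Longrightarrow> sepc a b X \<Longrightarrow> sepc a b (X + Y)"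
proof (induction rule: sepc.induct)
  case sepc_zero
  thus ?case using sepc_carrier[of a b X] by simp
next
  case (sepc_add_kron Y A B)
  have "X + (Y + kron A B) = (X + Y) + kron A B"
    using sepc_carrier[OF sepc_add_kron(1)] sepc_carrier[OF sepc_add_kron(5)] sepc_add_kron(2,3)
    by (intro assoc_add_mat[symmetric, of _ "a*b" "a*b"]) (auto simp: psd_iff)
  thus ?case using sepc.sepc_add_kron[OF sepc_add_kron(4)[OF sepc_add_kron(5)] sepc_add_kron(2,3)] by simp
qed

lemma sepc_kron: "psd a A \<Longrightarrow> psd b B \<Longrightarrow> sepc a b (kron A B)"
proof -
  assume h: "psd a A" "psd b B"
  hence "kron A B \<in> carrier_mat (a*b) (a*b)" by (simp add: psd_iff)
  thus ?thesis using sepc_add_kron[OF sepc_zero h] by simp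
qed

lemma sepc_sum:
  assumes "\<And>k. k < N \<Longrightarrow> sepc a b (Y k)"
  shows "sepc a b (lcomb (a*b) N (\<lambda>_. 1) Y)"
  using assms
proof (induction N)
  case 0
  show ?case by (simp add: lcomb_0 sepc_zero)
next
  case (Suc N)
  have "lcomb (a*b) (Suc N) (\<lambda>_. 1) Y = lcomb (a*b) N (\<lambda>_. 1) Y + Y N"
    using sepc_carrier[OF Suc.prems, of N] by (intro eq_matI) (auto simp: lcomb_def)
  thus ?case using Suc by (simp add: sepc_add)
qed

lemma channel_sepc:
  assumes L: "channel (a*b) (c*d) L" and k: "\<And>A B. psd a A \<Longrightarrow> psd b B \<Longrightarrow> sepc c d (L (kron A B))"
    and X: "sepc a b X"
  shows "sepc c d (L X)"
  using X
proof (induction rule: sepc.induct)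
  case sepc_zero
  show ?case by (simp add: channel_zero[OF L] sepc.sepc_zero)
next
  case (sepc_add_kron X A B)
  have "L (X + kron A B) = L X + L (kron A B)"
    using sepc_carrier[OF sepc_add_kron(1)] sepc_add_kron(2,3)
    by (intro channel_add[OF L]) (auto simp: psd_iff)
  thus ?case using sepc_add[OF k[OF sepc_add_kron(2,3)] sepc_add_kron(4)] by simp
qed

text \<open>A local Kraus operator acts on one factor of \<open>kron A B\<close> only, so every
  branch of a round sends products to products.\<close>

lemma LOCC_sepc:
  assumes "LOCC a b c d L" "sepc a b X"
  shows "sepc c d (L X)"
  using assms
proof (induction arbitrary: X rule: LOCC_induct')
  case (Alice N c a K b e f L)
  have Kc: "K k \<in> carrier_mat c a" if "k < N" for k using Alice(1) that unfolding complete_kraus_def by blast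
  show ?case
  proof (rule channel_sepc[OF LOCC_channel[OF LOCC_Alice'[OF Alice(1,2)]] _ Alice(4)])
    fix A B assume AB: "psd a A" "psd b B"
    show "sepc e f (lcomb (e*f) N (\<lambda>_. 1) (\<lambda>k. L k (cj (kron (K k) (1\<^sub>m b)) (kron A B))))"
    proof (intro sepc_sum Alice(3))
      fix k assume k: "k < N"
      have "cj (kron (K k) (1\<^sub>m b)) (kron A B) = kron (cj (K k) A) B"
        using AB by (subst cj_kron[OF Kc[OF k] one_carrier_mat]) (auto simp: psd_iff cj_one)
      thus "sepc c b (cj (kron (K k) (1\<^sub>m b)) (kron A B))"
        using cj_psd[OF Kc[OF k] AB(1)] AB(2) by (simp add: sepc_kron)
    qed
  qed
next
  case (Bob N d b K a e f L)
  have Kc: "K k \<in> carrier_mat d b" if "k < N" for k using Bob(1) that unfolding complete_kraus_def by blast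
  show ?case
  proof (rule channel_sepc[OF LOCC_channel[OF LOCC_Bob'[OF Bob(1,2)]] _ Bob(4)])
    fix A B assume AB: "psd a A" "psd b B"
    show "sepc e f (lcomb (e*f) N (\<lambda>_. 1) (\<lambda>k. L k (cj (kron (1\<^sub>m a) (K k)) (kron A B))))"
    proof (intro sepc_sum Bob(3))
      fix k assume k: "k < N"
      have "cj (kron (1\<^sub>m a) (K k)) (kron A B) = kron A (cj (K k) B)"
        using AB by (subst cj_kron[OF one_carrier_mat Kc[OF k]]) (auto simp: psd_iff cj_one)
      thus "sepc a d (cj (kron (1\<^sub>m a) (K k)) (kron A B))"
        using cj_psd[OF Kc[OF k] AB(2)] AB(1) by (simp add: sepc_kron)
    qed
  qed
qed

section \<open>Separation from the convex hull of a compact family\<close>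

lemma bounded_real_subsequence:
  fixes f :: "nat \<Rightarrow> real"
  assumes "\<And>n. \<bar>f n\<bar> \<le> C"
  shows "\<exists>r. strict_mono r \<and> convergent (\<lambda>n. f (r n))"
proof -
  obtain r :: "nat \<Rightarrow> nat" where r: "strict_mono r" "monoseq (\<lambda>n. f (r n))"
    using seq_monosub[of f] by blast
  have "Bseq (\<lambda>n. f (r n))" using assms by (intro BseqI'[of _ C]) simp
  hence "convergent (\<lambda>n. f (r n))" using r(2) by (rule Bseq_monoseq_convergent)
  thus ?thesis using r(1) by blast
qed

text \<open>Bolzano-Weierstrass applied index by index: convergence obtained for earlier indices
  survives the passage to further subsequences.\<close>

lemma bounded_family_subsequence:
  fixes f :: "'i \<Rightarrow> nat \<Rightarrow> real"
  assumes "finite I" "\<And>i n. i \<in> I \<Longrightarrow> \<bar>f i n\<bar> \<le> C"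
  shows "\<exists>r. strict_mono r \<and> (\<forall>i\<in>I. convergent (\<lambda>n. f i (r n)))"
  using assms
proof (induction I rule: finite_induct)
  case empty
  show ?case by (intro exI[of _ id]) (auto simp: strict_mono_def)
next
  case (insert i I)
  have "\<And>i n. i \<in> I \<Longrightarrow> \<bar>f i n\<bar> \<le> C" using insert.prems by simp
  from insert.IH[OF this]
  obtain r where r: "strict_mono r" "\<forall>i\<in>I. convergent (\<lambda>n. f i (r n))" by blast
  have "\<bar>f i (r n)\<bar> \<le> C" for n using insert.prems[of i "r n"] by simp
  hence "\<exists>q. strict_mono q \<and> convergent (\<lambda>n. f i (r (q n)))"
    by (rule bounded_real_subsequence)
  then obtain q where q: "strict_mono q" "convergent (\<lambda>n. f i (r (q n)))" by blast
  have "convergent (\<lambda>n. f j (r (q n)))" if "j \<in> insert i I" for j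
  proof (cases "j = i")
    case True
    thus ?thesis using q(2) by simp
  next
    case False
    hence "convergent (\<lambda>n. f j (r n))" using r(2) that by blast
    from convergent_subseq_convergent[OF this q(1)] show ?thesis by (simp only: o_def)
  qed
  moreover have "strict_mono (\<lambda>n. r (q n))" using r(1) q(1) by (simp add: strict_mono_def)
  ultimately show ?case by blast
qed

section \<open>Caratheodory's theorem\<close>

lemma linear_dependence:
  fixes v :: "'k \<Rightarrow> nat \<Rightarrow> real"
  assumes "finite K" "card K > M"
  shows "\<exists>c. (\<exists>k\<in>K. c k \<noteq> 0) \<and> (\<forall>i<M. (\<Sum>k\<in>K. c k * v k i) = 0)"
  using assms
proof (induction M arbitrary: K v)
  case 0
  hence "K \<noteq> {}" by auto
  then obtain k where "k \<in> K" by blast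
  thus ?case by (intro exI[of _ "\<lambda>_. 1"]) auto
next
  case (Suc M)
  show ?case
  proof (cases "\<forall>k\<in>K. v k M = 0")
    case True
    from Suc.IH[OF Suc.prems(1), of v] Suc.prems(2)
    obtain c where c: "\<exists>k\<in>K. c k \<noteq> 0" "\<forall>i<M. (\<Sum>k\<in>K. c k * v k i) = 0" by auto
    have "(\<Sum>k\<in>K. c k * v k i) = 0" if "i < Suc M" for i
      using c(2) True that by (cases "i = M") auto
    thus ?thesis using c(1) by blast
  next
    case False
    then obtain p where p: "p \<in> K" "v p M \<noteq> 0" by blast
    let ?K = "K - {p}"
    \<comment> \<open>Gaussian elimination with pivot p: coordinate M of every \<open>w k\<close>
      vanishes, and p leaves the index set.\<close>
    define w where "w k i = v k i - v k M / v p M * v p i" for k i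
    have "finite ?K" "card ?K > M" using Suc.prems p(1) by auto
    from Suc.IH[OF this, of w]
    obtain c where c: "\<exists>k\<in>?K. c k \<noteq> 0" "\<forall>i<M. (\<Sum>k\<in>?K. c k * w k i) = 0" by blast
    \<comment> \<open>The coefficient of p collects the multiples of \<open>v p\<close> subtracted
      in \<open>w\<close>, so that both combinations agree in every coordinate.\<close>
    define d where "d = c(p := - (\<Sum>k\<in>?K. c k * v k M / v p M))"
    have d: "(\<Sum>k\<in>K. d k * v k i) = (\<Sum>k\<in>?K. c k * w k i)" for i
    proof -
      have "(\<Sum>k\<in>K. d k * v k i) = d p * v p i + (\<Sum>k\<in>?K. d k * v k i)"
        using Suc.prems(1) p(1) by (simp add: sum.remove)
      also have "(\<Sum>k\<in>?K. d k * v k i) = (\<Sum>k\<in>?K. c k * v k i)"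
        by (intro sum.cong refl) (auto simp: d_def)
      also have "d p * v p i = - (\<Sum>k\<in>?K. c k * (v k M / v p M * v p i))"
        by (simp add: d_def sum_distrib_right mult.assoc)
      also have "\<dots> + (\<Sum>k\<in>?K. c k * v k i) = (\<Sum>k\<in>?K. c k * w k i)"
        by (simp add: w_def right_diff_distrib sum_subtractf)
      finally show ?thesis .
    qed
    have "(\<Sum>k\<in>K. d k * v k i) = 0" if "i < Suc M" for i
    proof (cases "i = M")
      case True
      have "w k M = 0" for k using p(2) by (simp add: w_def)
      thus ?thesis unfolding d True by simp
    next
      case False
      thus ?thesis using c(2) that d by simp
    qed
    moreover have "\<exists>k\<in>K. d k \<noteq> 0" using c(1) by (auto simp: d_def)
    ultimately show ?thesis by blast
  qed
qed

text \<open>\<open>comb L \<phi> T K p t y\<close>: the first \<open>L\<close> coordinates of \<open>y\<close> are those of the convex combination of the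
  points \<open>\<phi> (t k)\<close> with weights \<open>p k\<close>. The dimension \<open>L\<close> depends on the parameters of the problem, so the
  Euclidean spaces of the library, whose dimension is a type, do not apply.\<close>

definition comb :: "nat \<Rightarrow> ('t \<Rightarrow> nat \<Rightarrow> real) \<Rightarrow> 't set \<Rightarrow> nat set \<Rightarrow> (nat \<Rightarrow> real) \<Rightarrow> (nat \<Rightarrow> 't) \<Rightarrow> (nat \<Rightarrow> real) \<Rightarrow> bool" where
  "comb L \<phi> T K p t y \<longleftrightarrow> finite K \<and> (\<forall>k\<in>K. 0 \<le> p k \<and> t k \<in> T) \<and> sum p K = 1 \<and>
     (\<forall>x<L. y x = (\<Sum>k\<in>K. p k * \<phi> (t k) x))"

text \<open>A dependence d among the points whose coefficients sum to 0 is a direction in which the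
  weights can move without changing the point or the total weight. Moving until the first weight
  reaches 0 removes an index.\<close>

lemma caratheodory_step:
  assumes c: "comb L \<phi> T K p t y" and K: "card K > L + 1"
  shows "\<exists>k p'. k \<in> K \<and> comb L \<phi> T (K - {k}) p' t y"
proof -
  have fin: "finite K" and pos: "\<And>k. k \<in> K \<Longrightarrow> 0 \<le> p k" and one: "sum p K = 1"
    and y: "\<And>x. x < L \<Longrightarrow> y x = (\<Sum>k\<in>K. p k * \<phi> (t k) x)" and T: "\<And>k. k \<in> K \<Longrightarrow> t k \<in> T"
    using c by (auto simp: comb_def)
  \<comment> \<open>The additional coordinate L is constantly 1, so a linear dependence in L + 1
    coordinates has coefficients with sum 0.\<close>
  define v where "v k i = (if i < L then \<phi> (t k) i else 1)" for k i
  obtain d where d: "\<exists>k\<in>K. d k \<noteq> 0" "\<forall>i<L+1. (\<Sum>k\<in>K. d k * v k i) = 0"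
    using linear_dependence[OF fin K, of v] by blast
  have d0: "sum d K = 0" using d(2)[rule_format, of L] by (simp add: v_def)
  have dx: "(\<Sum>k\<in>K. d k * \<phi> (t k) x) = 0" if "x < L" for x
    using d(2)[rule_format, of x] that by (simp add: v_def)
  define P where "P = {k\<in>K. d k > 0}"
  have "P \<noteq> {}"
  proof
    assume "P = {}"
    hence np: "\<And>k. k \<in> K \<Longrightarrow> d k \<le> 0" by (auto simp: P_def not_less)
    hence "\<And>k. k \<in> K \<Longrightarrow> - d k = 0"
      using sum_nonneg_eq_0_iff[OF fin, of "\<lambda>k. - d k"] d0 by (simp add: sum_negf)
    with d(1) show False by simp
  qed
  moreover have finP: "finite P" using fin by (simp add: P_def)
  ultimately have "Min ((\<lambda>k. p k / d k) ` P) \<in> (\<lambda>k. p k / d k) ` P" by (intro Min_in) auto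
  then obtain m where m1: "m \<in> P" "Min ((\<lambda>k. p k / d k) ` P) = p m / d m" by blast
  have m: "m \<in> P" "\<And>k. k \<in> P \<Longrightarrow> p m / d m \<le> p k / d k"
    using m1 finP by (auto simp flip: m1(2))
  \<comment> \<open>Ratio test: the least \<open>p k / d k\<close> over the positive
    \<open>d k\<close> is the longest step that keeps all weights nonnegative.\<close>
  define \<theta> where "\<theta> = p m / d m"
  have dm: "d m > 0" and mK: "m \<in> K" using m(1) by (auto simp: P_def)
  have th: "\<theta> \<ge> 0" using pos[OF mK] dm by (simp add: \<theta>_def)
  define q where "q k = p k - \<theta> * d k" for k
  have qm: "q m = 0" using dm by (simp add: q_def \<theta>_def)
  have q: "q k \<ge> 0" if k: "k \<in> K" for k
  proof (cases "d k > 0")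
    case True
    hence "\<theta> \<le> p k / d k" using m(2)[of k] k by (simp add: P_def \<theta>_def)
    thus ?thesis using True by (simp add: q_def field_simps)
  next
    case False
    hence "\<theta> * d k \<le> 0" using th by (simp add: mult_nonneg_nonpos)
    thus ?thesis using pos[OF k] by (simp add: q_def)
  qed
  have rm: "(\<Sum>k\<in>K - {m}. q k * g k) = (\<Sum>k\<in>K. q k * g k)" for g
    using fin mK qm by (simp add: sum.remove)
  have "sum q (K - {m}) = 1"
    using rm[of "\<lambda>_. 1"] one d0 by (simp add: q_def sum_subtractf sum_distrib_left[symmetric])
  moreover have "y x = (\<Sum>k\<in>K - {m}. q k * \<phi> (t k) x)" if "x < L" for x
    unfolding rm y[OF that] using dx[OF that]
    by (simp add: q_def left_diff_distrib sum_subtractf mult.assoc sum_distrib_left[symmetric])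
  ultimately have "comb L \<phi> T (K - {m}) q t y"
    using fin q T by (simp add: comb_def)
  thus ?thesis using mK by blast
qed

lemma caratheodory:
  assumes "comb L \<phi> T K p t y"
  shows "\<exists>K p. card K \<le> L + 1 \<and> comb L \<phi> T K p t y"
  using assms
proof (induction "card K" arbitrary: K p rule: less_induct)
  case less
  show ?case
  proof (cases "card K \<le> L + 1")
    case True
    thus ?thesis using less.prems by blast
  next
    case False
    hence "card K > L + 1" by simp
    from caratheodory_step[OF less.prems this] obtain k p' where
      k: "k \<in> K" "comb L \<phi> T (K - {k}) p' t y" by blast
    have "finite K" using less.prems by (simp add: comb_def)
    hence "card (K - {k}) < card K" using k(1) by (intro psubset_card_mono) auto
    from less.hyps[OF this k(2)] show ?thesis .
  qed
qed

text \<open>One index set \<open>{..L}\<close> for all points of the hull lets weights and points of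
  a sequence of combinations be passed to the limit index by index. Missing indices get weight 0 and
  repeat a point of T.\<close>

lemma caratheodory_padded:
  assumes "comb L \<phi> T K p t y"
  shows "\<exists>p t. comb L \<phi> T {..L} p t y"
proof -
  obtain K p where K: "card K \<le> L + 1" and c: "comb L \<phi> T K p t y"
    using caratheodory[OF assms] by blast
  have fin: "finite K" and one: "sum p K = 1" using c by (auto simp: comb_def)
  have "K \<noteq> {}" using one by auto
  then obtain k0 where k0: "k0 \<in> K" by blast
  obtain h where h: "bij_betw h {0..<card K} K"
    using ex_bij_betw_nat_finite[OF fin] by blast
  define p' where "p' i = (if i < card K then p (h i) else 0)" for i
  define t' where "t' i = (if i < card K then t (h i) else t k0)" for i
  have s: "(\<Sum>i\<le>L. p' i * g (t' i)) = (\<Sum>k\<in>K. p k * g (t k))" for g :: "'a \<Rightarrow> real"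
  proof -
    have "(\<Sum>i\<le>L. p' i * g (t' i)) = (\<Sum>i\<in>{0..<card K}. p' i * g (t' i))"
      using K by (intro sum.mono_neutral_right) (auto simp: p'_def)
    also have "\<dots> = (\<Sum>i\<in>{0..<card K}. p (h i) * g (t (h i)))"
      by (intro sum.cong refl) (simp add: p'_def t'_def)
    also have "\<dots> = (\<Sum>k\<in>K. p k * g (t k))" by (rule sum.reindex_bij_betw[OF h])
    finally show ?thesis .
  qed
  have hK: "h i \<in> K" if "i < card K" for i using h that by (auto simp: bij_betw_def)
  have "0 \<le> p' i \<and> t' i \<in> T" for i
    using c hK k0 by (auto simp: comb_def p'_def t'_def)
  moreover have "sum p' {..L} = 1" using s[of "\<lambda>_. 1"] one by simp
  moreover have "y x = (\<Sum>i\<le>L. p' i * \<phi> (t' i) x)" if "x < L" for x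
    using c that s[of "\<lambda>t. \<phi> t x"] by (simp add: comb_def)
  ultimately have "comb L \<phi> T {..L} p' t' y" by (simp add: comb_def)
  thus ?thesis by blast
qed

text \<open>Sequential compactness of the image of T in the first L coordinates, phrased without a
  topology on T.\<close>

definition seq_compact_family :: "nat \<Rightarrow> ('t \<Rightarrow> nat \<Rightarrow> real) \<Rightarrow> 't set \<Rightarrow> bool" where
  "seq_compact_family L \<phi> T \<longleftrightarrow> (\<forall>s. (\<forall>n. s n \<in> T) \<longrightarrow>
     (\<exists>r t. strict_mono (r :: nat \<Rightarrow> nat) \<and> t \<in> T \<and> (\<forall>x<L. (\<lambda>n. \<phi> (s (r n)) x) \<longlonglongrightarrow> \<phi> t x)))"

lemma tendsto_subseq:
  fixes f :: "nat \<Rightarrow> real"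
  shows "f \<longlonglongrightarrow> l \<Longrightarrow> strict_mono r \<Longrightarrow> (\<lambda>n. f (r n)) \<longlonglongrightarrow> l"
  using LIMSEQ_subseq_LIMSEQ[of f l r] by (simp add: o_def)

lemma seq_compact_family_multi:
  fixes m :: nat
  assumes sc: "seq_compact_family L \<phi> T" and s: "\<And>k n. k < m \<Longrightarrow> s k n \<in> T"
  shows "\<exists>r t. strict_mono (r :: nat \<Rightarrow> nat) \<and> (\<forall>k<m. t k \<in> T \<and> (\<forall>x<L. (\<lambda>n. \<phi> (s k (r n)) x) \<longlonglongrightarrow> \<phi> (t k) x))"
  using s
proof (induction m)
  case 0
  show ?case by (intro exI[of _ id]) (auto simp: strict_mono_def)
next
  case (Suc m)
  have "\<And>k n. k < m \<Longrightarrow> s k n \<in> T" using Suc.prems by simp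
  from Suc.IH[OF this] obtain r t where r: "strict_mono r"
    "\<forall>k<m. t k \<in> T \<and> (\<forall>x<L. (\<lambda>n. \<phi> (s k (r n)) x) \<longlonglongrightarrow> \<phi> (t k) x)"
    by blast
  have "\<forall>n. s m (r n) \<in> T" using Suc.prems by simp
  from sc[unfolded seq_compact_family_def, rule_format, of "\<lambda>n. s m (r n)"] this
  obtain q u where q: "strict_mono q" "u \<in> T" "\<forall>x<L. (\<lambda>n. \<phi> (s m (r (q n))) x) \<longlonglongrightarrow> \<phi> u x"
    by blast
  define t' where "t' = t(m := u)"
  have "t' k \<in> T \<and> (\<forall>x<L. (\<lambda>n. \<phi> (s k ((r \<circ> q) n)) x) \<longlonglongrightarrow> \<phi> (t' k) x)" if "k < Suc m" for k
  proof (cases "k = m")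
    case True
    thus ?thesis using q by (simp add: t'_def)
  next
    case False
    hence k: "k < m" using that by simp
    have "(\<lambda>n. \<phi> (s k (r (q n))) x) \<longlonglongrightarrow> \<phi> (t k) x" if "x < L" for x
      using r(2) k that tendsto_subseq[OF _ q(1), of "\<lambda>n. \<phi> (s k (r n)) x"] by blast
    thus ?thesis using r(2) k False by (simp add: t'_def)
  qed
  moreover have "strict_mono (r \<circ> q)" using r(1) q(1) by (rule strict_mono_o)
  ultimately show ?case by blast
qed

text \<open>With padded combinations only L + 1 weights and L + 1 points vary, so finitely many
  successive subsequences make all of them converge.\<close>

lemma hull_seq_compact:
  assumes sc: "seq_compact_family L \<phi> T" and c: "\<And>n. comb L \<phi> T {..L} (p n) (t n) (y n)"
  shows "\<exists>r p' t' y'. strict_mono (r :: nat \<Rightarrow> nat) \<and> comb L \<phi> T {..L} p' t' y' \<and> (\<forall>x<L. (\<lambda>n. y (r n) x) \<longlonglongrightarrow> y' x)"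
proof -
  have pn: "0 \<le> p n k" if "k \<le> L" for n k using c[of n] that by (simp add: comb_def)
  have p1: "p n k \<le> 1" if "k \<le> L" for n k
  proof -
    have "p n k \<le> sum (p n) {..L}" using pn that by (intro member_le_sum) auto
    thus ?thesis using c[of n] by (simp add: comb_def)
  qed
  have "\<bar>p n k\<bar> \<le> 1" if "k \<in> {..L}" for k n using pn[of k n] p1[of k n] that by simp
  from bounded_family_subsequence[of "{..L}" "\<lambda>k n. p n k", OF _ this]
  obtain r where r: "strict_mono r" "\<forall>k\<in>{..L}. convergent (\<lambda>n. p (r n) k)" by auto
  define P where "P k = lim (\<lambda>n. p (r n) k)" for k
  have P: "(\<lambda>n. p (r n) k) \<longlonglongrightarrow> P k" if "k \<le> L" for k
    using r(2) that by (simp add: P_def convergent_LIMSEQ_iff)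
  have "\<And>k n. k < Suc L \<Longrightarrow> t (r n) k \<in> T" using c by (simp add: comb_def)
  from seq_compact_family_multi[OF sc, of "Suc L" "\<lambda>k n. t (r n) k", OF this]
  obtain q t' where q: "strict_mono q"
    "\<forall>k<Suc L. t' k \<in> T \<and> (\<forall>x<L. (\<lambda>n. \<phi> (t (r (q n)) k) x) \<longlonglongrightarrow> \<phi> (t' k) x)" by blast
  have Pq: "(\<lambda>n. p (r (q n)) k) \<longlonglongrightarrow> P k" if "k \<le> L" for k
    by (rule tendsto_subseq[OF P[OF that] q(1)])
  define y' where "y' x = (\<Sum>k\<le>L. P k * \<phi> (t' k) x)" for x
  have "P k \<ge> 0" if "k \<le> L" for k
    by (rule LIMSEQ_le_const[OF P[OF that]]) (use pn that in auto)
  moreover have "sum P {..L} = 1"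
  proof -
    have "(\<lambda>n. \<Sum>k\<le>L. p (r n) k) \<longlonglongrightarrow> sum P {..L}" by (intro tendsto_sum P) simp
    moreover have "(\<Sum>k\<le>L. p (r n) k) = 1" for n using c[of "r n"] by (simp add: comb_def)
    ultimately show ?thesis by (simp add: LIMSEQ_const_iff)
  qed
  ultimately have "comb L \<phi> T {..L} P t' y'" using q(2) by (simp add: comb_def y'_def)
  moreover have "(\<lambda>n. y ((r \<circ> q) n) x) \<longlonglongrightarrow> y' x" if x: "x < L" for x
  proof -
    have "y ((r \<circ> q) n) x = (\<Sum>k\<le>L. p (r (q n)) k * \<phi> (t (r (q n)) k) x)" for n
      using c[of "r (q n)"] x by (simp add: comb_def)
    moreover have "(\<lambda>n. \<Sum>k\<le>L. p (r (q n)) k * \<phi> (t (r (q n)) k) x) \<longlonglongrightarrow> y' x"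
      unfolding y'_def using q(2) x by (intro tendsto_sum tendsto_mult Pq) auto
    ultimately show ?thesis by simp
  qed
  moreover have "strict_mono (r \<circ> q)" using r(1) q(1) by (rule strict_mono_o)
  ultimately show ?thesis by blast
qed

lemma comb_mix:
  assumes c: "comb L \<phi> T K p t y" and u: "u \<in> T" and e: "0 \<le> e" "e \<le> 1"
  shows "\<exists>K p t. comb L \<phi> T K p t (\<lambda>x. (1 - e) * y x + e * \<phi> u x)"
proof -
  have fin: "finite K" using c by (simp add: comb_def)
  then obtain m where m: "m \<notin> K" using ex_new_if_finite[OF infinite_UNIV_nat] by blast
  define p' where "p' k = (if k = m then e else (1 - e) * p k)" for k
  define t' where "t' = t(m := u)"
  have s: "(\<Sum>k\<in>insert m K. p' k * g (t' k)) = e * g u + (1 - e) * (\<Sum>k\<in>K. p k * g (t k))" for g :: "'a \<Rightarrow> real"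
  proof -
    have "(\<Sum>k\<in>K. p' k * g (t' k)) = (\<Sum>k\<in>K. (1 - e) * (p k * g (t k)))"
      using m by (intro sum.cong refl) (auto simp: p'_def t'_def)
    thus ?thesis using m fin by (simp add: p'_def t'_def sum_distrib_left)
  qed
  have "comb L \<phi> T (insert m K) p' t' (\<lambda>x. (1 - e) * y x + e * \<phi> u x)"
    unfolding comb_def
  proof (intro conjI ballI allI impI)
    show "sum p' (insert m K) = 1" using s[of "\<lambda>_. 1"] c by (simp add: comb_def)
    fix x assume "x < L"
    thus "(1 - e) * y x + e * \<phi> u x = (\<Sum>k\<in>insert m K. p' k * \<phi> (t' k) x)"
      using s[of "\<lambda>t. \<phi> t x"] c by (simp add: comb_def)
  qed (use fin c e u in \<open>auto simp: comb_def p'_def t'_def\<close>)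
  thus ?thesis by blast
qed

text \<open>The point q of the hull nearest to y supplies the normal vector q - y. If some point of
  the family lay strictly below the supporting hyperplane at q, a short move from q towards it would
  come closer to y.\<close>

theorem hull_separation:
  assumes sc: "seq_compact_family L \<phi> T" and ne: "T \<noteq> {}"
    and y: "\<And>K p t. \<not> comb L \<phi> T K p t y"
  shows "\<exists>w c. (\<forall>t\<in>T. c \<le> (\<Sum>x<L. w x * \<phi> t x)) \<and> (\<Sum>x<L. w x * y x) < c"
proof -
  define D where "D z = (\<Sum>x<L. (z x - y x)\<^sup>2)" for z
  define S where "S = {z. \<exists>p t. comb L \<phi> T {..L} p t z}"
  have D0: "0 \<le> D z" for z by (simp add: D_def sum_nonneg)
  obtain t0 where "t0 \<in> T" using ne by blast
  hence "comb L \<phi> T {0} (\<lambda>_. 1) (\<lambda>_. t0) (\<phi> t0)" by (simp add: comb_def)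
  from caratheodory_padded[OF this] have Sne: "D ` S \<noteq> {}" by (auto simp: S_def)
  have bdd: "bdd_below (D ` S)" using D0 by (intro bdd_belowI[of _ 0]) auto
  define d where "d = Inf (D ` S)"
  have dle: "d \<le> D z" if "z \<in> S" for z
    unfolding d_def using that bdd by (intro cInf_lower) auto
  \<comment> \<open>Near-minimisers of the squared distance; a subsequence converges within the
    hull, so the infimum is attained.\<close>
  have "\<exists>z\<in>S. D z < d + 1 / (real n + 1)" for n
    using cInf_lessD[OF Sne, of "d + 1 / (real n + 1)"] by (auto simp: d_def)
  hence "\<forall>n. \<exists>z. z \<in> S \<and> D z < d + 1 / (real n + 1)" by blast
  from choice[OF this] obtain z where z: "\<And>n. z n \<in> S" "\<And>n. D (z n) < d + 1 / (real n + 1)" by blast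
  have "\<forall>n. \<exists>pt. comb L \<phi> T {..L} (fst pt) (snd pt) (z n)" using z(1) by (simp add: S_def)
  from choice[OF this] obtain pt where pt: "\<And>n. comb L \<phi> T {..L} (fst (pt n)) (snd (pt n)) (z n)" by blast
  from hull_seq_compact[OF sc, of "\<lambda>n. fst (pt n)" "\<lambda>n. snd (pt n)" z, OF pt]
  obtain r p' t' q where r: "strict_mono r" and q: "comb L \<phi> T {..L} p' t' q"
    and lim: "\<forall>x<L. (\<lambda>n. z (r n) x) \<longlonglongrightarrow> q x" by blast
  have "(\<lambda>n. D (z (r n))) \<longlonglongrightarrow> D q"
    unfolding D_def using lim by (intro tendsto_intros) auto
  moreover have "(\<lambda>n. d + 1 / (real (r n) + 1)) \<longlonglongrightarrow> d + 0"
  proof (intro tendsto_add tendsto_const)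
    have "(\<lambda>n. 1 / (real n + 1)) \<longlonglongrightarrow> 0"
      using LIMSEQ_inverse_real_of_nat by (simp add: inverse_eq_divide add.commute)
    from tendsto_subseq[OF this r] show "(\<lambda>n. 1 / (real (r n) + 1)) \<longlonglongrightarrow> 0" .
  qed
  ultimately have "D q \<le> d + 0"
    by (rule LIMSEQ_le) (use z(2) in \<open>auto intro: less_imp_le\<close>)
  hence Dq: "D q \<le> D z" if "z \<in> S" for z using dle[OF that] by simp
  define w where "w x = q x - y x" for x
  define c where "c = (\<Sum>x<L. w x * q x)"
  have sep: "c \<le> (\<Sum>x<L. w x * \<phi> u x)" if u: "u \<in> T" for u
  proof (rule ccontr)
    define A where "A = (\<Sum>x<L. w x * (\<phi> u x - q x))"
    define B where "B = (\<Sum>x<L. (\<phi> u x - q x)\<^sup>2)"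
    assume "\<not> ?thesis"
    hence A: "A < 0" by (simp add: A_def c_def right_diff_distrib sum_subtractf)
    have B: "B \<ge> 0" by (simp add: B_def sum_nonneg)
    have De: "D (\<lambda>x. (1 - e) * q x + e * \<phi> u x) = D q + 2 * e * A + e\<^sup>2 * B" for e
    proof -
      have "D (\<lambda>x. (1 - e) * q x + e * \<phi> u x)
        = (\<Sum>x<L. (q x - y x)\<^sup>2 + 2 * e * (w x * (\<phi> u x - q x)) + e\<^sup>2 * (\<phi> u x - q x)\<^sup>2)"
        unfolding D_def w_def by (intro sum.cong refl) (simp add: power2_eq_square algebra_simps)
      thus ?thesis by (simp add: D_def A_def B_def sum.distrib sum_distrib_left)
    qed
    \<comment> \<open>Small enough that the quadratic term \<open>e\<^sup>2 * B\<close> cannot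
      compensate the negative linear term \<open>2 * e * A\<close>; B + 1 avoids a zero
      denominator.\<close>
    define e where "e = min 1 (- A / (B + 1))"
    have "0 < - A / (B + 1)" using A B by (intro divide_pos_pos) auto
    hence e: "0 < e" "e \<le> 1" by (auto simp: e_def)
    have "e \<le> - A / (B + 1)" by (simp add: e_def)
    hence "e * (B + 1) \<le> - A / (B + 1) * (B + 1)" using B by (intro mult_right_mono) auto
    also have "\<dots> = - A" using B by simp
    finally have "e * (B + 1) \<le> - A" .
    hence eB: "e * B < - A" using e by (simp add: algebra_simps)
    have "\<exists>K p t. comb L \<phi> T K p t (\<lambda>x. (1 - e) * q x + e * \<phi> u x)"
      using e by (intro comb_mix[OF q u]) auto
    then obtain K p t where "comb L \<phi> T K p t (\<lambda>x. (1 - e) * q x + e * \<phi> u x)" by blast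
    from caratheodory_padded[OF this] have "(\<lambda>x. (1 - e) * q x + e * \<phi> u x) \<in> S" by (simp add: S_def)
    from Dq[OF this] have "0 \<le> 2 * e * A + e\<^sup>2 * B" unfolding De by simp
    also have "\<dots> = e * (2 * A + e * B)" by (simp add: power2_eq_square algebra_simps)
    finally have "0 \<le> 2 * A + e * B" using e(1) by (simp add: zero_le_mult_iff)
    with eB A show False by linarith
  qed
  have "\<exists>x<L. q x \<noteq> y x"
  proof (rule ccontr)
    assume "\<not> ?thesis"
    hence "comb L \<phi> T {..L} p' t' y" using q by (simp add: comb_def)
    with y show False by blast
  qed
  then obtain x0 where "x0 < L" "q x0 \<noteq> y x0" by blast
  hence "0 < (\<Sum>x<L. (w x)\<^sup>2)" by (intro sum_pos2[of _ x0]) (auto simp: w_def)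
  moreover have "c - (\<Sum>x<L. w x * y x) = (\<Sum>x<L. (w x)\<^sup>2)"
    unfolding c_def sum_subtractf[symmetric]
    by (intro sum.cong refl) (simp add: w_def power2_eq_square right_diff_distrib)
  ultimately have "(\<Sum>x<L. w x * y x) < c" by simp
  with sep show ?thesis by blast
qed

section \<open>Tensor powers and product measurements\<close>

text \<open>An index of \<open>m + 1\<close> copies of a bipartite system splits into the index \<open>lo\<close> of the copy with the least
  significant digits and the index \<open>hi\<close> of the remaining \<open>m\<close> copies.\<close>

definition lo :: "nat \<Rightarrow> nat \<Rightarrow> nat \<Rightarrow> nat \<Rightarrow> nat" where
  "lo a b m r = ((r div b ^ Suc m) mod a) * b + (r mod b ^ Suc m) mod b"

definition hi :: "nat \<Rightarrow> nat \<Rightarrow> nat \<Rightarrow> nat \<Rightarrow> nat" where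
  "hi a b m r = ((r div b ^ Suc m) div a) * b ^ m + (r mod b ^ Suc m) div b"

lemma pair_index_div: "j < b \<Longrightarrow> (i * b + j) div b = (i::nat)"
  by simp

lemma pair_index_mod: "j < b \<Longrightarrow> (i * b + j) mod b = (j::nat)"
  by simp

context
  fixes a b m r :: nat
  assumes r: "r < a ^ Suc m * b ^ Suc m"
begin

private lemma pos: "a > 0" "b > 0"
proof -
  have "a \<noteq> 0" "b \<noteq> 0" using r by (rule contrapos_pn, simp)+
  thus "a > 0" "b > 0" by simp_all
qed

private lemma il: "r div b ^ Suc m < a ^ m * a" "r mod b ^ Suc m < b ^ m * b"
  using index_div_less[OF r] index_mod_less[OF r] by (simp_all add: mult.commute)

lemma lo_div: "lo a b m r div b = (r div b ^ Suc m) mod a"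
  unfolding lo_def using pos by simp

lemma lo_mod: "lo a b m r mod b = (r mod b ^ Suc m) mod b"
  unfolding lo_def by simp

lemma lo_less: "lo a b m r < a * b"
  unfolding lo_def using pos by (intro pair_index_less) auto

lemma hi_div: "hi a b m r div b ^ m = (r div b ^ Suc m) div a"
  unfolding hi_def using index_div_less[OF il(2)] pos by simp

lemma hi_mod: "hi a b m r mod b ^ m = (r mod b ^ Suc m) div b"
  unfolding hi_def using index_div_less[OF il(2)] pos by simp

lemma hi_less: "hi a b m r < a ^ m * b ^ m"
  unfolding hi_def by (intro pair_index_less index_div_less il)

end

lemma hi_lo_inj:
  assumes r: "r < a ^ Suc m * b ^ Suc m" and s: "s < a ^ Suc m * b ^ Suc m"
  shows "lo a b m r = lo a b m s \<and> hi a b m r = hi a b m s \<longleftrightarrow> r = s"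
proof
  assume h: "lo a b m r = lo a b m s \<and> hi a b m r = hi a b m s"
  have "(r div b ^ Suc m) mod a = (s div b ^ Suc m) mod a" "(r mod b ^ Suc m) mod b = (s mod b ^ Suc m) mod b"
    "(r div b ^ Suc m) div a = (s div b ^ Suc m) div a" "(r mod b ^ Suc m) div b = (s mod b ^ Suc m) div b"
    unfolding lo_div[OF r, symmetric] lo_div[OF s, symmetric] lo_mod[OF r, symmetric] lo_mod[OF s, symmetric]
      hi_div[OF r, symmetric] hi_div[OF s, symmetric] hi_mod[OF r, symmetric] hi_mod[OF s, symmetric]
    using h by simp_all
  hence "r div b ^ Suc m = s div b ^ Suc m" "r mod b ^ Suc m = s mod b ^ Suc m"
    using div_mod_eq_iff[of "r div b ^ Suc m" a "s div b ^ Suc m"]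
      div_mod_eq_iff[of "r mod b ^ Suc m" b "s mod b ^ Suc m"] by blast+
  thus "r = s" using div_mod_eq_iff[of r "b ^ Suc m" s] by blast
qed simp

text \<open>The global index groups the digits by party, whereas induction over copies groups them
  by copy. This is the change of summation between the two.\<close>

lemma sum_hi_lo:
  fixes F :: "nat \<Rightarrow> nat \<Rightarrow> 'a :: comm_monoid_add"
  shows "(\<Sum>r<a ^ Suc m * b ^ Suc m. F (hi a b m r) (lo a b m r)) = (\<Sum>r'<a ^ m * b ^ m. \<Sum>r0<a * b. F r' r0)"
proof -
  have "(\<Sum>r<a ^ Suc m * b ^ Suc m. F (hi a b m r) (lo a b m r))
    = (\<Sum>i<a ^ m * a. \<Sum>j<b ^ m * b. F ((i div a) * b ^ m + j div b) ((i mod a) * b + j mod b))"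
    unfolding sum_prod_index[of _ "a ^ Suc m" "b ^ Suc m"]
  proof (intro sum.cong)
    fix i j assume "j \<in> {..<b ^ m * b}"
    hence "j < b ^ Suc m" by (simp add: mult.commute)
    hence "(i * b ^ Suc m + j) div b ^ Suc m = i" "(i * b ^ Suc m + j) mod b ^ Suc m = j"
      by (simp_all only: pair_index_div pair_index_mod)
    thus "F (hi a b m (i * b ^ Suc m + j)) (lo a b m (i * b ^ Suc m + j))
      = F (i div a * b ^ m + j div b) (i mod a * b + j mod b)"
      by (simp only: hi_def lo_def)
  qed (simp_all add: mult.commute)
  also have "\<dots> = (\<Sum>i'<a ^ m. \<Sum>i0<a. \<Sum>j'<b ^ m. \<Sum>j0<b. F (i' * b ^ m + j') (i0 * b + j0))"
    unfolding sum_prod_index by (intro sum.cong refl) simp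
  also have "\<dots> = (\<Sum>i'<a ^ m. \<Sum>j'<b ^ m. \<Sum>i0<a. \<Sum>j0<b. F (i' * b ^ m + j') (i0 * b + j0))"
    by (intro sum.cong refl sum.swap)
  also have "\<dots> = (\<Sum>r'<a ^ m * b ^ m. \<Sum>r0<a * b. F r' r0)"
    unfolding sum_prod_index ..
  finally show ?thesis .
qed

section \<open>Tensor powers of states\<close>

lemma digit_0: "digit a 0 x = x mod a"
  by (simp add: digit_def)

lemma digit_Suc: "digit a (Suc k) x = digit a k (x div a)"
  by (simp add: digit_def div_mult2_eq)

lemma tpow_carrier[simp]: "tpow a b \<rho> n \<in> carrier_mat (a^n * b^n) (a^n * b^n)"
  by (simp add: tpow_def)

text \<open>Peels off the copy that belongs to digit 0, which opens the closed product in
  \<open>tpow\<close> to induction on the number of copies.\<close>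

lemma tpow_Suc_entry:
  assumes r: "r < a ^ Suc m * b ^ Suc m" and s: "s < a ^ Suc m * b ^ Suc m"
  shows "tpow a b \<rho> (Suc m) $$ (r,s)
    = \<rho> $$ (lo a b m r, lo a b m s) * tpow a b \<rho> m $$ (hi a b m r, hi a b m s)"
proof -
  let ?f = "\<lambda>n r s k. \<rho> $$ (digit a k (r div b^n) * b + digit b k (r mod b^n),
                   digit a k (s div b^n) * b + digit b k (s mod b^n))"
  have "tpow a b \<rho> (Suc m) $$ (r,s) = (\<Prod>k<Suc m. ?f (Suc m) r s k)"
    using r s by (simp only: tpow_def index_mat prod.case)
  also have "\<dots> = ?f (Suc m) r s 0 * (\<Prod>k<m. ?f (Suc m) r s (Suc k))"
    by (rule prod.lessThan_Suc_shift)
  also have "?f (Suc m) r s 0 = \<rho> $$ (lo a b m r, lo a b m s)"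
    by (simp only: digit_0 lo_def)
  also have "(\<Prod>k<m. ?f (Suc m) r s (Suc k)) = (\<Prod>k<m. ?f m (hi a b m r) (hi a b m s) k)"
    by (simp only: digit_Suc hi_div[OF r] hi_div[OF s] hi_mod[OF r] hi_mod[OF s])
  also have "\<dots> = tpow a b \<rho> m $$ (hi a b m r, hi a b m s)"
    using hi_less[OF r] hi_less[OF s] by (simp only: tpow_def index_mat prod.case)
  finally show ?thesis .
qed

lemma tpow_0_entry: "tpow a b \<rho> 0 $$ (0,0) = 1"
  by (simp add: tpow_def)

lemma density_tpow:
  assumes "density (a*b) \<rho>"
  shows "density (a^n * b^n) (tpow a b \<rho> n)"
proof -
  have \<rho>: "psdk (a*b) (ker \<rho>)" "tr (a*b) (ker \<rho>) = 1" using assms by (auto simp: density_iff)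
  have "psdk (a^n * b^n) (ker (tpow a b \<rho> n)) \<and> tr (a^n * b^n) (ker (tpow a b \<rho> n)) = 1"
  proof (induction n)
    case 0
    show ?case by (simp add: psdk_def qf_def tr_def ker_def tpow_0_entry less_eq_complex_def)
  next
    case (Suc m)
    let ?N = "a ^ Suc m * b ^ Suc m"
    have e: "ker (tpow a b \<rho> (Suc m)) r s = ker \<rho> (lo a b m r) (lo a b m s) * ker (tpow a b \<rho> m) (hi a b m r) (hi a b m s)"
      if "r < ?N" "s < ?N" for r s using tpow_Suc_entry[OF that] by (simp only: ker_def)
    have "psdk ?N (\<lambda>r s. ker \<rho> (lo a b m r) (lo a b m s) * ker (tpow a b \<rho> m) (hi a b m r) (hi a b m s))"
    proof (rule psdk_schur_product)
      show "psdk ?N (\<lambda>r s. ker \<rho> (lo a b m r) (lo a b m s))"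
        by (rule psdk_pullback[OF \<rho>(1) lo_less])
      show "psdk ?N (\<lambda>r s. ker (tpow a b \<rho> m) (hi a b m r) (hi a b m s))"
        by (rule psdk_pullback[OF conjunct1[OF Suc] hi_less])
    qed
    moreover have "psdk ?N (ker (tpow a b \<rho> (Suc m)))
      = psdk ?N (\<lambda>r s. ker \<rho> (lo a b m r) (lo a b m s) * ker (tpow a b \<rho> m) (hi a b m r) (hi a b m s))"
      by (rule psdk_cong) (rule e)
    moreover have "tr ?N (ker (tpow a b \<rho> (Suc m))) = 1"
    proof -
      have "tr ?N (ker (tpow a b \<rho> (Suc m)))
        = (\<Sum>r<?N. ker \<rho> (lo a b m r) (lo a b m r) * ker (tpow a b \<rho> m) (hi a b m r) (hi a b m r))"
        unfolding tr_def by (intro sum.cong refl e) auto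
      also have "\<dots> = (\<Sum>r'<a ^ m * b ^ m. \<Sum>r0<a * b. ker \<rho> r0 r0 * ker (tpow a b \<rho> m) r' r')"
        by (rule sum_hi_lo)
      also have "\<dots> = (\<Sum>r'<a ^ m * b ^ m. ker (tpow a b \<rho> m) r' r')"
        using \<rho>(2) by (simp add: tr_def sum_distrib_right[symmetric])
      also have "\<dots> = 1" using Suc by (simp add: tr_def)
      finally show ?thesis .
    qed
    ultimately show ?case by blast
  qed
  thus ?thesis by (simp add: density_iff)
qed

lemma digit_less: "a > 0 \<Longrightarrow> digit a k x < a"
  by (simp add: digit_def)

lemma swap_tpow:
  assumes a: "a > 0" and b: "b > 0"
  shows "swap_state (a^n) (b^n) (tpow a b \<rho> n) = tpow b a (swap_state a b \<rho>) n"
proof (rule eq_matI)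
  fix r s assume "r < dim_row (tpow b a (swap_state a b \<rho>) n)" "s < dim_col (tpow b a (swap_state a b \<rho>) n)"
  hence r: "r < b^n * a^n" and s: "s < b^n * a^n" by (auto simp: tpow_def)
  have "swap_state (a^n) (b^n) (tpow a b \<rho> n) $$ (r,s) = tpow a b \<rho> n $$ (sw (a^n) (b^n) r, sw (a^n) (b^n) s)"
    by (rule swap_state_entry[OF r s])
  also have "\<dots> = (\<Prod>k<n. \<rho> $$ (digit a k (r mod a^n) * b + digit b k (r div a^n),
                              digit a k (s mod a^n) * b + digit b k (s div a^n)))"
    using sw_less[OF r] sw_less[OF s] by (simp add: tpow_def sw_div[OF r] sw_div[OF s] sw_mod[OF r] sw_mod[OF s])
  also have "\<dots> = (\<Prod>k<n. swap_state a b \<rho> $$ (digit b k (r div a^n) * a + digit a k (r mod a^n),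
                              digit b k (s div a^n) * a + digit a k (s mod a^n)))"
  proof (intro prod.cong refl)
    fix k
    have lt: "digit b k x * a + digit a k y < b * a" for x y
      by (intro pair_index_less digit_less a b)
    have sw: "sw a b (digit b k x * a + digit a k y) = digit a k y * b + digit b k x" for x y
      unfolding sw_def using digit_less[OF a, of k y] by simp
    show "\<rho> $$ (digit a k (r mod a^n) * b + digit b k (r div a^n), digit a k (s mod a^n) * b + digit b k (s div a^n))
      = swap_state a b \<rho> $$ (digit b k (r div a^n) * a + digit a k (r mod a^n), digit b k (s div a^n) * a + digit a k (s mod a^n))"
      unfolding swap_state_entry[OF lt lt] sw ..
  qed
  also have "\<dots> = tpow b a (swap_state a b \<rho>) n $$ (r,s)" using r s by (simp add: tpow_def)
  finally show "swap_state (a^n) (b^n) (tpow a b \<rho> n) $$ (r,s) = tpow b a (swap_state a b \<rho>) n $$ (r,s)" .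
qed (auto simp: tpow_def swap_state_def)

text \<open>The number x stands for m single-copy outcomes, its digits in base L; \<open>tv\<close>
  is the tensor product of the corresponding vectors of one party.\<close>

primrec tv :: "nat \<Rightarrow> nat \<Rightarrow> (nat \<Rightarrow> nat \<Rightarrow> complex) \<Rightarrow> nat \<Rightarrow> nat \<Rightarrow> nat \<Rightarrow> complex" where
  "tv L a e 0 x i = 1"
| "tv L a e (Suc m) x i = e (x mod L) (i mod a) * tv L a e m (x div L) (i div a)"

primrec gm :: "nat \<Rightarrow> (nat \<Rightarrow> real) \<Rightarrow> nat \<Rightarrow> nat \<Rightarrow> real" where
  "gm L g 0 x = 1"
| "gm L g (Suc m) x = g (x mod L) * gm L g m (x div L)"

text \<open>The vector v \<otimes> w in Kronecker indexing.\<close>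

definition pv :: "nat \<Rightarrow> (nat \<Rightarrow> complex) \<Rightarrow> (nat \<Rightarrow> complex) \<Rightarrow> nat \<Rightarrow> complex" where
  "pv b v w r = v (r div b) * w (r mod b)"

lemma qf_kron:
  "qf (n*p) (\<lambda>r s. A (r div p) (s div p) * B (r mod p) (s mod p)) (pv p v w) = qf n A v * qf p B w"
proof -
  have "qf (n*p) (\<lambda>r s. A (r div p) (s div p) * B (r mod p) (s mod p)) (pv p v w)
    = (\<Sum>i<n. \<Sum>j<p. \<Sum>k<n. \<Sum>l<p. (cnj (v i) * A i k * v k) * (cnj (w j) * B j l * w l))"
    unfolding qf_def pv_def sum_prod_index by (intro sum.cong refl) (simp add: mult_ac)
  also have "\<dots> = (\<Sum>i<n. \<Sum>k<n. \<Sum>j<p. \<Sum>l<p. (cnj (v i) * A i k * v k) * (cnj (w j) * B j l * w l))"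
    by (intro sum.cong refl sum.swap)
  also have "\<dots> = qf n A v * qf p B w"
    unfolding qf_def[of n] sum_distrib_right unfolding qf_def sum_distrib_left ..
  finally show ?thesis .
qed

text \<open>\<open>pcontr\<close> is the unnormalised state of the last system after outcome \<open>t\<close> on the first one.\<close>

definition pcontr :: "nat \<Rightarrow> nat \<Rightarrow> (nat \<Rightarrow> nat \<Rightarrow> complex) \<Rightarrow> (nat \<Rightarrow> complex) \<Rightarrow> nat \<Rightarrow> nat \<Rightarrow> complex" where
  "pcontr n a A t i j = (\<Sum>k<n. \<Sum>l<n. cnj (t k) * A (k*a+i) (l*a+j) * t l)"

text \<open>The partial trace over the last factor.\<close>

definition ptr :: "nat \<Rightarrow> (nat \<Rightarrow> nat \<Rightarrow> complex) \<Rightarrow> nat \<Rightarrow> nat \<Rightarrow> complex" where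
  "ptr a A k l = (\<Sum>i<a. A (k*a+i) (l*a+i))"

lemma qf_pcontr: "qf a (pcontr n a A t) v = qf (n*a) A (pv a t v)"
proof -
  have "qf (n*a) A (pv a t v)
    = (\<Sum>k<n. \<Sum>i<a. \<Sum>l<n. \<Sum>j<a. cnj (v i) * (cnj (t k) * A (k*a+i) (l*a+j) * t l) * v j)"
    unfolding qf_def pv_def sum_prod_index by (intro sum.cong refl) (simp add: mult_ac)
  also have "\<dots> = (\<Sum>i<a. \<Sum>k<n. \<Sum>l<n. \<Sum>j<a. cnj (v i) * (cnj (t k) * A (k*a+i) (l*a+j) * t l) * v j)"
    by (rule sum.swap)
  also have "\<dots> = (\<Sum>i<a. \<Sum>k<n. \<Sum>j<a. \<Sum>l<n. cnj (v i) * (cnj (t k) * A (k*a+i) (l*a+j) * t l) * v j)"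
    by (intro sum.cong refl sum.swap)
  also have "\<dots> = (\<Sum>i<a. \<Sum>j<a. \<Sum>k<n. \<Sum>l<n. cnj (v i) * (cnj (t k) * A (k*a+i) (l*a+j) * t l) * v j)"
    by (intro sum.cong refl sum.swap)
  also have "\<dots> = qf a (pcontr n a A t) v"
    unfolding qf_def pcontr_def by (simp only: sum_distrib_left sum_distrib_right)
  finally show ?thesis ..
qed

lemma psdk_pcontr: "psdk (n*a) A \<Longrightarrow> psdk a (pcontr n a A t)"
  by (simp add: psdk_def qf_pcontr)

lemma psdk_ptr:
  assumes "psdk (n*a) A"
  shows "psdk n (ptr a A)"
proof -
  have "psdk n (\<lambda>k l. \<Sum>i\<in>{..<a}. A (k*a+i) (l*a+i))"
    by (intro psdk_sum psdk_pullback[OF assms, where f = "\<lambda>k. k*a + _"] pair_index_less) auto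
  thus ?thesis by (simp add: ptr_def[abs_def])
qed

lemma tr_ptr: "tr n (ptr a A) = tr (n*a) A"
  by (simp add: tr_def ptr_def sum_prod_index)

text \<open>Ignoring the last system after an outcome on the others amounts to measuring the reduced
  operator. This hands the remaining copies to the induction hypothesis.\<close>

lemma tr_pcontr: "tr a (pcontr n a A t) = qf n (ptr a A) t"
proof -
  have "tr a (pcontr n a A t) = (\<Sum>k<n. \<Sum>i<a. \<Sum>l<n. cnj (t k) * A (k*a+i) (l*a+i) * t l)"
    unfolding tr_def pcontr_def by (rule sum.swap)
  also have "\<dots> = (\<Sum>k<n. \<Sum>l<n. \<Sum>i<a. cnj (t k) * A (k*a+i) (l*a+i) * t l)"
    by (intro sum.cong refl sum.swap)
  also have "\<dots> = qf n (ptr a A) t"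
    unfolding qf_def ptr_def by (simp only: sum_distrib_left sum_distrib_right)
  finally show ?thesis .
qed

lemma tv_Suc_pv: "tv L a e (Suc m) x = pv a (tv L a e m (x div L)) (e (x mod L))"
  by (rule ext) (simp add: pv_def)

lemma psdk_Re: "psdk n A \<Longrightarrow> Re (qf n A v) \<ge> 0"
  by (simp add: psdk_def less_eq_complex_def)

lemma gm_nonneg: "(\<And>x. g x \<ge> 0) \<Longrightarrow> gm L g m x \<ge> 0"
  by (induction m arbitrary: x) auto

text \<open>A may be entangled across Alice's copies and B across Bob's, yet conditioning on the
  outcomes of all copies but one leaves a product of positive operators on that copy. The
  single-copy bound applies to it, termwise because the weights are nonnegative, and what remains is
  the test of the partial traces on the other copies.\<close>

lemma product_test_tensor_power:
  assumes g: "\<And>x. g x \<ge> 0"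
    and one: "\<And>A B. psdk a A \<Longrightarrow> psdk b B \<Longrightarrow>
      (\<Sum>x<L. g x * (Re (qf a A (e x)) * Re (qf b B (f x)))) \<le> Re (tr a A) * Re (tr b B)"
    and A: "psdk (a^m) A" and B: "psdk (b^m) B"
  shows "(\<Sum>x<L^m. gm L g m x * (Re (qf (a^m) A (tv L a e m x)) * Re (qf (b^m) B (tv L b f m x))))
    \<le> Re (tr (a^m) A) * Re (tr (b^m) B)"
  using A B
proof (induction m arbitrary: A B)
  case 0
  show ?case by (simp add: qf_def tr_def)
next
  case (Suc m)
  have A: "psdk (a^m * a) A" and B: "psdk (b^m * b) B" using Suc.prems by (simp_all add: mult.commute)
  let ?T = "tv L a e m" and ?S = "tv L b f m"
  have "(\<Sum>x<L^Suc m. gm L g (Suc m) x * (Re (qf (a^Suc m) A (tv L a e (Suc m) x)) * Re (qf (b^Suc m) B (tv L b f (Suc m) x))))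
    = (\<Sum>x'<L^m. \<Sum>x0<L. gm L g m x' * (g x0 * (Re (qf a (pcontr (a^m) a A (?T x')) (e x0)) * Re (qf b (pcontr (b^m) b B (?S x')) (f x0)))))"
    unfolding power_Suc2 sum_prod_index
    by (intro sum.cong refl) (simp add: tv_Suc_pv qf_pcontr del: tv.simps(2))
  also have "\<dots> \<le> (\<Sum>x'<L^m. gm L g m x' * (Re (tr a (pcontr (a^m) a A (?T x'))) * Re (tr b (pcontr (b^m) b B (?S x')))))"
    unfolding sum_distrib_left[symmetric]
    by (intro sum_mono mult_left_mono one psdk_pcontr A B gm_nonneg g)
  also have "\<dots> = (\<Sum>x'<L^m. gm L g m x' * (Re (qf (a^m) (ptr a A) (?T x')) * Re (qf (b^m) (ptr b B) (?S x'))))"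
    by (simp only: tr_pcontr)
  also have "\<dots> \<le> Re (tr (a^m) (ptr a A)) * Re (tr (b^m) (ptr b B))"
    by (rule Suc.IH[OF psdk_ptr[OF A] psdk_ptr[OF B]])
  also have "\<dots> = Re (tr (a^Suc m) A) * Re (tr (b^Suc m) B)"
    unfolding tr_ptr power_Suc2 ..
  finally show ?case .
qed

lemma ker_kron:
  assumes "A \<in> carrier_mat m m" "B \<in> carrier_mat p p" "r < m*p" "s < m*p"
  shows "ker (kron A B) r s = ker A (r div p) (s div p) * ker B (r mod p) (s mod p)"
  unfolding ker_def by (rule kron_entry[OF assms])

lemma tr_kron:
  assumes "A \<in> carrier_mat m m" "B \<in> carrier_mat p p"
  shows "tr (m*p) (ker (kron A B)) = tr m (ker A) * tr p (ker B)"
proof -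
  have "tr (m*p) (ker (kron A B)) = (\<Sum>r<m*p. ker A (r div p) (r div p) * ker B (r mod p) (r mod p))"
    unfolding tr_def using assms by (intro sum.cong refl ker_kron) auto
  also have "\<dots> = (\<Sum>i<m. \<Sum>j<p. ker A i i * ker B j j)"
    unfolding sum_prod_index by (intro sum.cong refl) simp
  also have "\<dots> = tr m (ker A) * tr p (ker B)" unfolding tr_def by (rule sum_product[symmetric])
  finally show ?thesis .
qed

lemma qf_kron_mat:
  assumes "A \<in> carrier_mat m m" "B \<in> carrier_mat p p"
  shows "qf (m*p) (ker (kron A B)) (pv p v w) = qf m (ker A) v * qf p (ker B) w"
proof -
  have "qf (m*p) (ker (kron A B)) (pv p v w)
    = qf (m*p) (\<lambda>r s. ker A (r div p) (s div p) * ker B (r mod p) (s mod p)) (pv p v w)"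
    using assms by (intro qf_cong ker_kron refl)
  thus ?thesis by (simp only: qf_kron)
qed

lemma psdk_Im: "psdk n A \<Longrightarrow> Im (qf n A v) = 0"
  by (simp add: psdk_def less_eq_complex_def)

lemma psdk_tr_Im: "psdk n A \<Longrightarrow> Im (tr n A) = 0"
  using psdk_tr[of n A] by (simp add: less_eq_complex_def)

lemma sum_qf_complete:
  assumes "\<And>r s. r < N \<Longrightarrow> s < N \<Longrightarrow> (\<Sum>x\<in>I. V x r * cnj (V x s)) = (if r = s then 1 else 0)"
  shows "(\<Sum>x\<in>I. qf N A (V x)) = tr N A"
proof -
  have "(\<Sum>x\<in>I. qf N A (V x)) = (\<Sum>x\<in>I. \<Sum>r<N. \<Sum>s<N. A r s * (V x s * cnj (V x r)))"
    by (simp add: qf_def mult_ac)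
  also have "\<dots> = (\<Sum>r<N. \<Sum>x\<in>I. \<Sum>s<N. A r s * (V x s * cnj (V x r)))" by (rule sum.swap)
  also have "\<dots> = (\<Sum>r<N. \<Sum>s<N. \<Sum>x\<in>I. A r s * (V x s * cnj (V x r)))"
    by (intro sum.cong refl sum.swap)
  also have "\<dots> = (\<Sum>r<N. \<Sum>s<N. if s = r then A r r else 0)"
    unfolding sum_distrib_left[symmetric] by (intro sum.cong refl) (simp add: assms)
  also have "\<dots> = tr N A" by (simp add: tr_def)
  finally show ?thesis .
qed

text \<open>The effect of outcome x is the rank-one operator of the unnormalised product vector e x
  \<otimes> f x.\<close>

locale product_povm =
  fixes a b L :: nat and e f :: "nat \<Rightarrow> nat \<Rightarrow> complex"
  assumes complete: "\<And>r s. r < a*b \<Longrightarrow> s < a*b \<Longrightarrow>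
    (\<Sum>x<L. pv b (e x) (f x) r * cnj (pv b (e x) (f x) s)) = (if r = s then 1 else 0)"
begin

definition U :: "nat \<Rightarrow> nat \<Rightarrow> nat \<Rightarrow> complex" where
  "U m x = pv (b^m) (tv L a e m x) (tv L b f m x)"

definition prob :: "nat \<Rightarrow> complex mat \<Rightarrow> nat \<Rightarrow> real" where
  "prob m X x = Re (qf (a^m * b^m) (ker X) (U m x))"

lemma U_Suc:
  assumes "r < a ^ Suc m * b ^ Suc m"
  shows "U (Suc m) x r = pv b (e (x mod L)) (f (x mod L)) (lo a b m r) * U m (x div L) (hi a b m r)"
  by (simp add: U_def pv_def lo_div[OF assms] lo_mod[OF assms] hi_div[OF assms] hi_mod[OF assms]
      del: power_Suc)

lemma U_complete:
  "r < a^m * b^m \<Longrightarrow> s < a^m * b^m \<Longrightarrow> (\<Sum>x<L^m. U m x r * cnj (U m x s)) = (if r = s then 1 else 0)"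
proof (induction m arbitrary: r s)
  case 0
  thus ?case by (simp add: U_def pv_def)
next
  case (Suc m)
  note r = Suc.prems(1) and s = Suc.prems(2)
  let ?u = "\<lambda>x. pv b (e x) (f x)"
  have "(\<Sum>x<L^Suc m. U (Suc m) x r * cnj (U (Suc m) x s))
    = (\<Sum>x<L^m * L. (U m (x div L) (hi a b m r) * cnj (U m (x div L) (hi a b m s)))
        * (?u (x mod L) (lo a b m r) * cnj (?u (x mod L) (lo a b m s))))"
    unfolding power_Suc2[of L] by (intro sum.cong refl) (simp add: U_Suc[OF r] U_Suc[OF s])
  also have "\<dots> = (\<Sum>x'<L^m. \<Sum>x0<L. (U m x' (hi a b m r) * cnj (U m x' (hi a b m s)))
        * (?u x0 (lo a b m r) * cnj (?u x0 (lo a b m s))))"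
    unfolding sum_prod_index by (intro sum.cong refl) simp
  also have "\<dots> = (\<Sum>x'<L^m. U m x' (hi a b m r) * cnj (U m x' (hi a b m s)))
     * (\<Sum>x0<L. ?u x0 (lo a b m r) * cnj (?u x0 (lo a b m s)))"
    by (rule sum_product[symmetric])
  also have "\<dots> = (if hi a b m r = hi a b m s then 1 else 0) * (if lo a b m r = lo a b m s then 1 else 0)"
    by (simp only: Suc.IH[OF hi_less[OF r] hi_less[OF s]] complete[OF lo_less[OF r] lo_less[OF s]])
  also have "\<dots> = (if r = s then 1 else 0)"
    unfolding hi_lo_inj[OF r s, symmetric] by simp
  finally show ?case .
qed

lemma sum_prob: "(\<Sum>x<L^m. prob m X x) = Re (tr (a^m * b^m) (ker X))"
  unfolding prob_def Re_sum[symmetric] using sum_qf_complete[OF U_complete] by simp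

lemma prob_nonneg: "psd (a^m * b^m) X \<Longrightarrow> prob m X x \<ge> 0"
  unfolding prob_def by (rule psdk_Re) (simp add: psd_iff)

lemma prob_tpow_Suc:
  assumes \<rho>: "density (a*b) \<rho>"
  shows "prob (Suc m) (tpow a b \<rho> (Suc m)) x
    = Re (qf (a*b) (ker \<rho>) (pv b (e (x mod L)) (f (x mod L)))) * prob m (tpow a b \<rho> m) (x div L)"
proof -
  let ?N = "a ^ Suc m * b ^ Suc m" and ?M = "a^m * b^m"
  let ?u = "pv b (e (x mod L)) (f (x mod L))" and ?V = "U m (x div L)" and ?K = "ker (tpow a b \<rho> m)"
  define h where "h = hi a b m"
  define l where "l = lo a b m"
  have s: "(\<Sum>r<?N. F (h r) (l r)) = (\<Sum>r'<?M. \<Sum>r0<a*b. F r' r0)" for F :: "nat \<Rightarrow> nat \<Rightarrow> complex"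
    unfolding h_def l_def by (rule sum_hi_lo)
  have "qf ?N (ker (tpow a b \<rho> (Suc m))) (U (Suc m) x)
    = (\<Sum>r<?N. \<Sum>s<?N. (cnj (?V (h r)) * ?K (h r) (h s) * ?V (h s)) * (cnj (?u (l r)) * ker \<rho> (l r) (l s) * ?u (l s)))"
    unfolding qf_def h_def l_def ker_def
    by (intro sum.cong refl) (simp add: U_Suc tpow_Suc_entry mult_ac del: power_Suc)
  also have "\<dots> = (\<Sum>r<?N. \<Sum>s'<?M. \<Sum>s0<a*b. (cnj (?V (h r)) * ?K (h r) s' * ?V s') * (cnj (?u (l r)) * ker \<rho> (l r) s0 * ?u s0))"
    by (intro sum.cong refl s)
  also have "\<dots> = (\<Sum>r'<?M. \<Sum>r0<a*b. \<Sum>s'<?M. \<Sum>s0<a*b. (cnj (?V r') * ?K r' s' * ?V s') * (cnj (?u r0) * ker \<rho> r0 s0 * ?u s0))"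
    by (rule s)
  also have "\<dots> = (\<Sum>r'<?M. \<Sum>s'<?M. \<Sum>r0<a*b. \<Sum>s0<a*b. (cnj (?V r') * ?K r' s' * ?V s') * (cnj (?u r0) * ker \<rho> r0 s0 * ?u s0))"
    by (intro sum.cong refl sum.swap)
  also have "\<dots> = qf ?M ?K ?V * qf (a*b) (ker \<rho>) ?u"
    unfolding qf_def[of ?M] sum_distrib_right unfolding qf_def sum_distrib_left ..
  finally have "qf ?N (ker (tpow a b \<rho> (Suc m))) (U (Suc m) x) = qf ?M ?K ?V * qf (a*b) (ker \<rho>) ?u" .
  moreover have "Im (qf (a*b) (ker \<rho>) ?u) = 0" using \<rho> by (simp add: density_iff psdk_Im)
  ultimately show ?thesis by (simp add: prob_def mult.commute)
qed

end

context product_povm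
begin

lemma prob_diff:
  assumes "X \<in> carrier_mat (a^m * b^m) (a^m * b^m)" "Y \<in> carrier_mat (a^m * b^m) (a^m * b^m)"
  shows "prob m (X - Y) x = prob m X x - prob m Y x"
proof -
  have "qf (a^m * b^m) (ker (X - Y)) (U m x) = qf (a^m * b^m) (\<lambda>i j. ker X i j - ker Y i j) (U m x)"
    using assms by (intro qf_cong refl) (simp add: ker_def)
  thus ?thesis by (simp add: prob_def qf_diff)
qed

text \<open>Both sides are additive in X, so the bound for products of positive operators
  suffices.\<close>

lemma separable_test:
  assumes g: "\<And>x. g x \<ge> 0"
    and one: "\<And>A B. psdk a A \<Longrightarrow> psdk b B \<Longrightarrow>
      (\<Sum>x<L. g x * (Re (qf a A (e x)) * Re (qf b B (f x)))) \<le> Re (tr a A) * Re (tr b B)"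
    and X: "sepc (a^m) (b^m) X"
  shows "(\<Sum>x<L^m. gm L g m x * prob m X x) \<le> Re (tr (a^m * b^m) (ker X))"
  using X
proof (induction rule: sepc.induct)
  case sepc_zero
  have "prob m (0\<^sub>m (a^m * b^m) (a^m * b^m)) x = 0" for x
    unfolding prob_def qf_def ker_def by simp
  thus ?case by (simp add: tr_def ker_def)
next
  case (sepc_add_kron X A B)
  let ?N = "a^m * b^m"
  have c: "X \<in> carrier_mat ?N ?N" "A \<in> carrier_mat (a^m) (a^m)" "B \<in> carrier_mat (b^m) (b^m)"
    using sepc_carrier[OF sepc_add_kron(1)] sepc_add_kron(2,3) by (auto simp: psd_iff)
  have k: "kron A B \<in> carrier_mat ?N ?N" using c by simp
  have e: "ker (X + kron A B) i j = ker X i j + ker (kron A B) i j" if "i < ?N" "j < ?N" for i j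
    using that c(1) k by (simp add: ker_def)
  have AB: "psdk (a^m) (ker A)" "psdk (b^m) (ker B)" using sepc_add_kron(2,3) by (auto simp: psd_iff)
  have "prob m (X + kron A B) x = prob m X x + Re (qf (a^m) (ker A) (tv L a e m x)) * Re (qf (b^m) (ker B) (tv L b f m x))" for x
  proof -
    have "qf ?N (ker (X + kron A B)) (U m x) = qf ?N (\<lambda>i j. ker X i j + ker (kron A B) i j) (U m x)"
      by (intro qf_cong refl e)
    also have "\<dots> = qf ?N (ker X) (U m x) + qf (a^m) (ker A) (tv L a e m x) * qf (b^m) (ker B) (tv L b f m x)"
      unfolding qf_add U_def qf_kron_mat[OF c(2,3)] ..
    finally show ?thesis using psdk_Im[OF AB(1)] by (simp add: prob_def)
  qed
  hence "(\<Sum>x<L^m. gm L g m x * prob m (X + kron A B) x) = (\<Sum>x<L^m. gm L g m x * prob m X x)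
    + (\<Sum>x<L^m. gm L g m x * (Re (qf (a^m) (ker A) (tv L a e m x)) * Re (qf (b^m) (ker B) (tv L b f m x))))"
    by (simp add: ring_distribs sum.distrib)
  also have "\<dots> \<le> Re (tr ?N (ker X)) + Re (tr (a^m) (ker A)) * Re (tr (b^m) (ker B))"
    by (intro add_mono sepc_add_kron(4) product_test_tensor_power g one AB)
  also have "\<dots> = Re (tr ?N (ker (X + kron A B)))"
  proof -
    have "tr ?N (ker (X + kron A B)) = (\<Sum>i<?N. ker X i i + ker (kron A B) i i)"
      unfolding tr_def by (intro sum.cong refl e) auto
    also have "\<dots> = tr ?N (ker X) + tr ?N (ker (kron A B))" by (simp add: tr_def sum.distrib)
    also have "\<dots> = tr ?N (ker X) + tr (a^m) (ker A) * tr (b^m) (ker B)"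
      by (simp only: tr_kron[OF c(2,3)])
    finally show ?thesis using psdk_tr_Im[OF AB(1)] by simp
  qed
  finally show ?case .
qed

lemma gm_pos: "(\<And>x. g x > 0) \<Longrightarrow> gm L g m x > 0"
  by (induction m arbitrary: x) auto

lemma ln_gm_Suc:
  assumes "\<And>x. g x > 0"
  shows "ln (gm L g (Suc m) x) = ln (g (x mod L)) + ln (gm L g m (x div L))"
  using assms[of "x mod L"] gm_pos[of g m "x div L", OF assms] by (simp add: ln_mult)

lemma ln_gm_bound:
  assumes "\<And>x. g x > 0" "\<And>x. \<bar>ln (g x)\<bar> \<le> C"
  shows "\<bar>ln (gm L g m x)\<bar> \<le> real m * C"
proof (induction m arbitrary: x)
  case (Suc m)
  show ?case
    unfolding ln_gm_Suc[of g, OF assms(1)]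
    using assms(2)[of "x mod L"] Suc[of "x div L"] by (simp add: algebra_simps)
qed simp

text \<open>The expected log-weight per copy. If the weights have mean at most 1 on separable
  states, concavity of ln makes it at most 0 there, so a positive value detects
  entanglement.\<close>

definition mean_log :: "(nat \<Rightarrow> real) \<Rightarrow> complex mat \<Rightarrow> real" where
  "mean_log g \<rho> = (\<Sum>x<L. Re (qf (a*b) (ker \<rho>) (pv b (e x) (f x))) * ln (g x))"

lemma sum_prob_tpow_ln:
  assumes \<rho>: "density (a*b) \<rho>" and g: "\<And>x. g x > 0"
  shows "(\<Sum>x<L^m. prob m (tpow a b \<rho> m) x * ln (gm L g m x)) = real m * mean_log g \<rho>"
proof (induction m)
  case (Suc m)
  let ?P = "\<lambda>x. Re (qf (a*b) (ker \<rho>) (pv b (e x) (f x)))" and ?Q = "prob m (tpow a b \<rho> m)"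
  have P1: "(\<Sum>x<L. ?P x) = 1"
    unfolding Re_sum[symmetric] using sum_qf_complete[OF complete, where A = "ker \<rho>"] \<rho> by (simp add: density_iff)
  have Q1: "(\<Sum>x<L^m. ?Q x) = 1"
    using sum_prob[of m "tpow a b \<rho> m"] density_tpow[OF \<rho>, of m] by (simp add: density_iff)
  have "(\<Sum>x<L^Suc m. prob (Suc m) (tpow a b \<rho> (Suc m)) x * ln (gm L g (Suc m) x))
    = (\<Sum>x<L^m * L. (?P (x mod L) * ?Q (x div L)) * (ln (g (x mod L)) + ln (gm L g m (x div L))))"
    unfolding power_Suc2[of L]
    by (intro sum.cong refl) (simp only: prob_tpow_Suc[OF \<rho>] ln_gm_Suc[of g, OF g])
  also have "\<dots> = (\<Sum>x'<L^m. \<Sum>x0<L. ?Q x' * (?P x0 * ln (g x0)) + (?Q x' * ln (gm L g m x')) * ?P x0)"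
    unfolding sum_prod_index by (intro sum.cong refl) (simp add: algebra_simps)
  also have "\<dots> = (\<Sum>x'<L^m. ?Q x' * mean_log g \<rho> + (?Q x' * ln (gm L g m x')))"
    by (simp add: sum.distrib sum_distrib_left[symmetric] P1 mean_log_def)
  also have "\<dots> = mean_log g \<rho> + real m * mean_log g \<rho>"
    by (simp add: sum.distrib sum_distrib_right[symmetric] Q1 Suc)
  finally show ?case by (simp add: algebra_simps)
qed simp

text \<open>The two parts of the optimal splitting of X - Y have nonnegative outcome values, and
  these add up to their traces.\<close>

lemma sum_prob_distance:
  assumes X: "psd (a^m * b^m) X" and Y: "psd (a^m * b^m) Y"
  shows "(\<Sum>x<L^m. \<bar>prob m X x - prob m Y x\<bar>) \<le> trace_norm (X - Y)"
proof -
  let ?N = "a^m * b^m"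
  have c: "X \<in> carrier_mat ?N ?N" "Y \<in> carrier_mat ?N ?N" using X Y by (auto simp: psd_iff)
  from trace_norm_decompose[OF minus_carrier_mat[OF c(2)] herm_diff[OF X Y]]
  obtain P Q where PQ: "psdk ?N P" "psdk ?N Q" "\<forall>i<?N. \<forall>j<?N. (X - Y) $$ (i,j) = P i j - Q i j"
    "trace_norm (X - Y) = Re (tr ?N P) + Re (tr ?N Q)" by blast
  have "\<bar>prob m X x - prob m Y x\<bar> \<le> Re (qf ?N P (U m x)) + Re (qf ?N Q (U m x))" for x
  proof -
    have "qf ?N (ker (X - Y)) (U m x) = qf ?N (\<lambda>i j. P i j - Q i j) (U m x)"
      using PQ(3) by (intro qf_cong refl) (simp only: ker_def)
    hence "prob m X x - prob m Y x = Re (qf ?N P (U m x)) - Re (qf ?N Q (U m x))"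
      unfolding prob_diff[OF c, symmetric] by (simp add: prob_def qf_diff)
    thus ?thesis using psdk_Re[OF PQ(1), of "U m x"] psdk_Re[OF PQ(2), of "U m x"] by simp
  qed
  hence "(\<Sum>x<L^m. \<bar>prob m X x - prob m Y x\<bar>) \<le> (\<Sum>x<L^m. Re (qf ?N P (U m x)) + Re (qf ?N Q (U m x)))"
    by (intro sum_mono)
  also have "\<dots> = Re (\<Sum>x<L^m. qf ?N P (U m x)) + Re (\<Sum>x<L^m. qf ?N Q (U m x))"
    by (simp add: sum.distrib)
  also have "\<dots> = trace_norm (X - Y)"
    by (simp only: sum_qf_complete[OF U_complete] PQ(4))
  finally show ?thesis .
qed

text \<open>Jensen's inequality for the logarithm replaces the typicality argument of a Stein-type
  converse: no concentration estimate for the iid outcome distribution is needed.\<close>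

lemma entanglement_bound:
  assumes g: "\<And>x. g x > 0" and C: "\<And>x. \<bar>ln (g x)\<bar> \<le> C"
    and one: "\<And>A B. psdk a A \<Longrightarrow> psdk b B \<Longrightarrow>
      (\<Sum>x<L. g x * (Re (qf a A (e x)) * Re (qf b B (f x)))) \<le> Re (tr a A) * Re (tr b B)"
    and \<rho>: "density (a*b) \<rho>" and \<sigma>: "density (a^m * b^m) \<sigma>"
    and S: "sepc (a^m) (b^m) S" and le: "psd (a^m * b^m) (S - \<sigma>)"
  shows "real m * (mean_log g \<rho> - C * trace_norm (\<sigma> - tpow a b \<rho> m)) \<le> ln (Re (tr (a^m * b^m) (ker S)))"
proof -
  let ?N = "a^m * b^m" and ?\<tau> = "tpow a b \<rho> m" and ?g = "gm L g m"
  let ?Z = "\<Sum>x<L^m. prob m \<sigma> x * ?g x"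
  have \<sigma>p: "psd ?N \<sigma>" and \<tau>p: "psd ?N ?\<tau>" using \<sigma> density_tpow[OF \<rho>, of m] by (auto simp: density_def)
  have \<sigma>1: "(\<Sum>x<L^m. prob m \<sigma> x) = 1" using \<sigma> unfolding sum_prob by (simp add: density_iff)
  have gp: "?g x > 0" for x by (rule gm_pos[of g, OF g])
  have Z: "?Z > 0"
  proof -
    have "\<exists>x\<in>{..<L^m}. prob m \<sigma> x \<noteq> 0"
    proof (rule ccontr)
      assume "\<not> ?thesis"
      hence "(\<Sum>x<L^m. prob m \<sigma> x) = 0" by (intro sum.neutral) blast
      with \<sigma>1 show False by simp
    qed
    then obtain y where y: "y \<in> {..<L^m}" "prob m \<sigma> y \<noteq> 0" by blast
    have y0: "prob m \<sigma> y > 0" using y(2) prob_nonneg[OF \<sigma>p, of y] by simp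
    show ?thesis
      by (rule sum_pos2[OF _ y(1)]) (use y0 gp prob_nonneg[OF \<sigma>p] in \<open>auto intro!: mult_pos_pos mult_nonneg_nonneg less_imp_le[OF gp]\<close>)
  qed
  have jensen: "(\<Sum>x<L^m. prob m \<sigma> x * ln (?g x)) \<le> ln ?Z"
  proof -
    have "(\<Sum>x<L^m. prob m \<sigma> x * ln (?g x)) \<le> (\<Sum>x<L^m. prob m \<sigma> x * (ln ?Z + (?g x / ?Z - 1)))"
    proof (intro sum_mono mult_left_mono prob_nonneg[OF \<sigma>p])
      fix x
      \<comment> \<open>Jensen's inequality by the tangent of ln at 1, applied to the weight
        relative to its mean.\<close>
      have "ln (?g x / ?Z) \<le> ?g x / ?Z - 1" using gp Z by (intro ln_le_minus_one divide_pos_pos)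
      thus "ln (?g x) \<le> ln ?Z + (?g x / ?Z - 1)" using gp[of x] Z by (simp add: ln_div)
    qed
    also have "\<dots> = (\<Sum>x<L^m. prob m \<sigma> x) * (ln ?Z - 1) + ?Z / ?Z"
      unfolding sum_distrib_right sum_divide_distrib sum.distrib[symmetric]
      by (intro sum.cong refl) (simp add: algebra_simps)
    also have "\<dots> = ln ?Z" using Z by (simp add: \<sigma>1)
    finally show ?thesis .
  qed
  have Sc: "S \<in> carrier_mat ?N ?N" by (rule sepc_carrier[OF S])
  have \<sigma>c: "\<sigma> \<in> carrier_mat ?N ?N" using \<sigma>p by (simp add: psd_iff)
  \<comment> \<open>Domination of \<sigma> by S passes to every outcome, since S - \<sigma> is
    positive.\<close>
  have "?Z \<le> (\<Sum>x<L^m. ?g x * prob m S x)"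
  proof (intro sum_mono)
    fix x
    have "prob m \<sigma> x \<le> prob m S x"
      using prob_nonneg[OF le, of x] prob_diff[OF Sc \<sigma>c, of x] by simp
    thus "prob m \<sigma> x * ?g x \<le> ?g x * prob m S x" using gp[of x] by (simp add: mult.commute)
  qed
  also have "\<dots> \<le> Re (tr ?N (ker S))"
    by (rule separable_test[OF less_imp_le[OF g] one S])
  finally have "ln ?Z \<le> ln (Re (tr ?N (ker S)))" using Z by simp
  \<comment> \<open>Replacing the ideal copies by \<sigma> costs at most the distance times the
    largest log-weight, which is linear in m by \<open>ln_gm_bound\<close>.\<close>
  moreover have "real m * mean_log g \<rho> - real m * C * trace_norm (\<sigma> - ?\<tau>) \<le> (\<Sum>x<L^m. prob m \<sigma> x * ln (?g x))"
  proof -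
    have "real m * mean_log g \<rho> - (\<Sum>x<L^m. prob m \<sigma> x * ln (?g x)) = (\<Sum>x<L^m. (prob m ?\<tau> x - prob m \<sigma> x) * ln (?g x))"
      unfolding sum_prob_tpow_ln[OF \<rho> g, symmetric] sum_subtractf[symmetric]
      by (intro sum.cong refl) (simp add: left_diff_distrib)
    also have "\<dots> \<le> (\<Sum>x<L^m. \<bar>prob m \<sigma> x - prob m ?\<tau> x\<bar> * (real m * C))"
    proof (intro sum_mono)
      fix x
      have "(prob m ?\<tau> x - prob m \<sigma> x) * ln (?g x) \<le> \<bar>prob m ?\<tau> x - prob m \<sigma> x\<bar> * \<bar>ln (?g x)\<bar>"
        unfolding abs_mult[symmetric] by (rule abs_ge_self)
      also have "\<dots> \<le> \<bar>prob m ?\<tau> x - prob m \<sigma> x\<bar> * (real m * C)"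
        by (intro mult_left_mono ln_gm_bound g C abs_ge_zero)
      finally show "(prob m ?\<tau> x - prob m \<sigma> x) * ln (?g x) \<le> \<bar>prob m \<sigma> x - prob m ?\<tau> x\<bar> * (real m * C)"
        by (simp add: abs_minus_commute)
    qed
    also have "\<dots> \<le> trace_norm (\<sigma> - ?\<tau>) * (real m * C)"
      unfolding sum_distrib_right[symmetric]
    proof (rule mult_right_mono[OF sum_prob_distance[OF \<sigma>p \<tau>p]])
      have "0 \<le> C" using C[of 0] by simp
      thus "0 \<le> real m * C" by simp
    qed
    finally show ?thesis by (simp add: mult_ac)
  qed
  ultimately show ?thesis using jensen by (simp add: algebra_simps)
qed

end

section \<open>An informationally complete product measurement\<close>

text \<open>The polarisation vectors e_i + \<i>^c e_j, where \<open>y = (i * a + j) * 4 + c\<close>, scaled so that the rank-one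
  operators they define sum to the identity.\<close>

definition pol :: "nat \<Rightarrow> nat \<Rightarrow> nat \<Rightarrow> complex" where
  "pol a y k = ((if k = y div 4 div a then 1 else 0) + \<i> ^ (y mod 4) * (if k = y div 4 mod a then 1 else 0))
     / complex_of_real (sqrt (8 * real a))"

lemma pol_index:
  assumes "j < a" "c < 4"
  shows "pol a ((i*a+j)*4+c) k = ((if k = i then 1 else 0) + \<i> ^ c * (if k = j then 1 else 0))
     / complex_of_real (sqrt (8 * real a))"
proof -
  have "((i*a+j)*4+c) div 4 = i*a+j" "((i*a+j)*4+c) mod 4 = c"
    using assms(2) by (simp_all only: pair_index_div pair_index_mod)
  moreover have "(i*a+j) div a = i" "(i*a+j) mod a = j"
    using assms(1) by (simp_all only: pair_index_div pair_index_mod)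
  ultimately show ?thesis by (simp only: pol_def)
qed

lemma sum_lessThan_4: "(\<Sum>c<4. F c) = F 0 + F 1 + F 2 + F (3::nat)" for F :: "nat \<Rightarrow> complex"
  by (simp add: eval_nat_numeral)

lemma i_power_3: "\<i> ^ 3 = - \<i>"
  by (simp add: eval_nat_numeral)

text \<open>The constant 8 a: the sum over the four phases cancels the cross terms and leaves a
  factor 4, and each of the two diagonal terms then occurs a times among the pairs of
  indices.\<close>

lemma pol_complete:
  assumes "a > 0" "k < a" "l < a"
  shows "(\<Sum>y<a*a*4. pol a y k * cnj (pol a y l)) = (if k = l then 1 else 0)"
proof -
  let ?d = "\<lambda>k i. if k = i then 1 else (0::complex)"
  have s: "complex_of_real (sqrt (8 * real a)) * complex_of_real (sqrt (8 * real a)) = 8 * of_nat a"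
    unfolding of_real_mult[symmetric] by simp
  have "(\<Sum>y<a*a*4. pol a y k * cnj (pol a y l))
    = (\<Sum>i<a. \<Sum>j<a. \<Sum>c<4. ((?d k i + \<i> ^ c * ?d k j) * (?d l i + cnj (\<i> ^ c) * ?d l j)) / (8 * of_nat a))"
    unfolding sum_prod_index
  proof (intro sum.cong refl)
    fix i j c assume "j \<in> {..<a}" "c \<in> {..<4::nat}"
    hence "j < a" "c < 4" by auto
    note p = pol_index[OF this, of i]
    have c1: "cnj (?d l i) = ?d l i" for i by simp
    show "pol a ((i*a+j)*4+c) k * cnj (pol a ((i*a+j)*4+c) l)
      = ((?d k i + \<i> ^ c * ?d k j) * (?d l i + cnj (\<i> ^ c) * ?d l j)) / (8 * of_nat a)"
      unfolding p complex_cnj_divide complex_cnj_add complex_cnj_mult c1 complex_cnj_complex_of_real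
        times_divide_times_eq s ..
  qed
  also have "\<dots> = (\<Sum>i<a. \<Sum>j<a. (?d k i * ?d l i + ?d k j * ?d l j) * (4 / (8 * of_nat a)))"
    by (intro sum.cong refl) (simp only: sum_lessThan_4, simp add: i_power_3 field_simps)
  also have "\<dots> = (\<Sum>i<a. \<Sum>j<a. ?d k i * ?d l i + ?d k j * ?d l j) * (4 / (8 * of_nat a))"
    by (simp only: sum_distrib_right)
  also have "(\<Sum>i<a. \<Sum>j<a. ?d k i * ?d l i + ?d k j * ?d l j) = 2 * of_nat a * ?d k l"
  proof -
    have "(\<Sum>i<a. ?d k i * ?d l i) = (\<Sum>i<a. if i = k then ?d k l else 0)"
      by (intro sum.cong refl) auto
    also have "\<dots> = ?d k l" using assms by simp
    finally have "(\<Sum>i<a. ?d k i * ?d l i) = ?d k l" .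
    moreover from this have "(\<Sum>i<a. \<Sum>j<a. ?d k i * ?d l i) = of_nat a * ?d k l"
      by (simp only: sum_constant sum_distrib_left[symmetric] card_lessThan)
    ultimately show ?thesis by (simp add: sum.distrib)
  qed
  finally show ?thesis using assms(1) by simp
qed

lemma qf_pol:
  assumes "i < a" "j < a" "c < 4"
  shows "qf a A (pol a ((i*a+j)*4+c))
    = (A i i + \<i> ^ c * A i j + cnj (\<i> ^ c) * A j i + cnj (\<i> ^ c) * \<i> ^ c * A j j)
      / (complex_of_real (sqrt (8 * real a)) * complex_of_real (sqrt (8 * real a)))"
proof -
  let ?s = "complex_of_real (sqrt (8 * real a))"
  let ?v = "\<lambda>k. (if k = i then 1 else 0) + \<i> ^ c * (if k = j then 1 else 0)"
  have d: "(\<Sum>k<a. F k * (if k = l then 1 else 0)) = F l" if "l < a" for F :: "nat \<Rightarrow> complex" and l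
  proof -
    have "(\<Sum>k<a. F k * (if k = l then 1 else 0)) = (\<Sum>k<a. if k = l then F l else 0)"
      by (intro sum.cong refl) auto
    thus ?thesis using that by simp
  qed
  have v: "(\<Sum>k<a. F k * ?v k) = F i + \<i> ^ c * F j" for F :: "nat \<Rightarrow> complex"
  proof -
    have "(\<Sum>k<a. F k * ?v k) = (\<Sum>k<a. F k * (if k = i then 1 else 0)) + (\<Sum>k<a. (\<i> ^ c * F k) * (if k = j then 1 else 0))"
      unfolding sum.distrib[symmetric] by (intro sum.cong refl) (simp only: ring_distribs mult_ac)
    thus ?thesis by (simp only: d[OF assms(1)] d[OF assms(2)])
  qed
  have vc: "(\<Sum>k<a. F k * cnj (?v k)) = F i + cnj (\<i> ^ c) * F j" for F :: "nat \<Rightarrow> complex"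
  proof -
    have "(\<Sum>k<a. F k * cnj (?v k)) = cnj (\<Sum>k<a. cnj (F k) * ?v k)" by simp
    also have "\<dots> = F i + cnj (\<i> ^ c) * F j" unfolding v by simp
    finally show ?thesis .
  qed
  have "qf a A (pol a ((i*a+j)*4+c)) = (\<Sum>k<a. \<Sum>l<a. cnj (?v k) * A k l * ?v l / (?s * ?s))"
    unfolding qf_def pol_index[OF assms(2,3)]
    by (intro sum.cong refl) (simp only: complex_cnj_divide complex_cnj_complex_of_real times_divide_eq_left times_divide_eq_right divide_divide_eq_left)
  also have "\<dots> = (\<Sum>k<a. (\<Sum>l<a. A k l * ?v l) * cnj (?v k)) / (?s * ?s)"
    unfolding sum_divide_distrib sum_distrib_right by (intro sum.cong refl) (simp only: mult_ac)
  also have "\<dots> = ((A i i + \<i> ^ c * A i j) + cnj (\<i> ^ c) * (A j i + \<i> ^ c * A j j)) / (?s * ?s)"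
    unfolding v vc ..
  finally show ?thesis by (simp only: ring_distribs add.assoc mult.assoc)
qed

text \<open>Polarisation: the phases 1 and -1 isolate A i j + A j i, the phases i and -i isolate A i
  j - A j i.\<close>

lemma pol_injective:
  assumes z: "\<And>y. y < a*a*4 \<Longrightarrow> qf a A (pol a y) = 0" and ij: "i < a" "j < a"
  shows "A i j = 0"
proof -
  have a: "complex_of_real (sqrt (8 * real a)) * complex_of_real (sqrt (8 * real a)) \<noteq> 0" using ij by simp
  have E: "A i i + \<i> ^ c * A i j + cnj (\<i> ^ c) * A j i + cnj (\<i> ^ c) * \<i> ^ c * A j j = 0" if c: "c < 4" for c
  proof -
    have "(i*a+j)*4+c < a*a*4" by (intro pair_index_less ij c)
    from z[OF this] show ?thesis unfolding qf_pol[OF ij c] using a by simp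
  qed
  have e0: "A i i + A i j + A j i + A j j = 0" using E[of 0] by simp
  have e1: "A i i + \<i> * A i j - \<i> * A j i + A j j = 0" using E[of 1] by simp
  have e2: "A i i - A i j - A j i + A j j = 0" using E[of 2] by simp
  have e3: "A i i - \<i> * A i j + \<i> * A j i + A j j = 0" using E[of 3] by (simp add: i_power_3)
  have "A i j + A j i = 0" using e0 e2 by (simp add: complex_eq_iff)
  moreover have "\<i> * (A i j - A j i) = 0" using e1 e3 by (simp add: complex_eq_iff)
  hence "A i j - A j i = 0" by simp
  ultimately show ?thesis by (simp add: complex_eq_iff)
qed

text \<open>One outcome number encodes the pair of local outcomes, Alice's as the quotient and Bob's
  as the remainder modulo the number of Bob's outcomes.\<close>

definition polA :: "nat \<Rightarrow> nat \<Rightarrow> nat \<Rightarrow> nat \<Rightarrow> complex" where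
  "polA a b x = pol a (x div (b*b*4))"

definition polB :: "nat \<Rightarrow> nat \<Rightarrow> nat \<Rightarrow> nat \<Rightarrow> complex" where
  "polB a b x = pol b (x mod (b*b*4))"

lemma product_povm_pol:
  assumes "a > 0" "b > 0"
  shows "product_povm a b (a*a*4*(b*b*4)) (polA a b) (polB a b)"
proof
  fix r s assume r: "r < a*b" and s: "s < a*b"
  note rr = index_div_less[OF r] index_mod_less[OF r] and ss = index_div_less[OF s] index_mod_less[OF s]
  have "(\<Sum>x<a*a*4*(b*b*4). pv b (polA a b x) (polB a b x) r * cnj (pv b (polA a b x) (polB a b x) s))
    = (\<Sum>y<a*a*4. \<Sum>z<b*b*4. (pol a y (r div b) * cnj (pol a y (s div b))) * (pol b z (r mod b) * cnj (pol b z (s mod b))))"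
    unfolding sum_prod_index[of _ "a*a*4" "b*b*4"]
  proof (intro sum.cong refl)
    fix y z assume "z \<in> {..<b*b*4}"
    hence "z < b*b*4" by simp
    hence "(y*(b*b*4)+z) div (b*b*4) = y" "(y*(b*b*4)+z) mod (b*b*4) = z"
      by (simp_all only: pair_index_div pair_index_mod)
    thus "pv b (polA a b (y*(b*b*4)+z)) (polB a b (y*(b*b*4)+z)) r * cnj (pv b (polA a b (y*(b*b*4)+z)) (polB a b (y*(b*b*4)+z)) s)
      = (pol a y (r div b) * cnj (pol a y (s div b))) * (pol b z (r mod b) * cnj (pol b z (s mod b)))"
      by (simp only: pv_def polA_def polB_def complex_cnj_mult mult_ac)
  qed
  also have "\<dots> = (\<Sum>y<a*a*4. pol a y (r div b) * cnj (pol a y (s div b))) * (\<Sum>z<b*b*4. pol b z (r mod b) * cnj (pol b z (s mod b)))"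
    by (rule sum_product[symmetric])
  also have "\<dots> = (if r div b = s div b then 1 else 0) * (if r mod b = s mod b then 1 else 0)"
    by (simp only: pol_complete[OF assms(1) rr(1) ss(1)] pol_complete[OF assms(2) rr(2) ss(2)])
  also have "\<dots> = (if r = s then 1 else 0)" by (rule delta_div_mod)
  finally show "(\<Sum>x<a*a*4*(b*b*4). pv b (polA a b x) (polB a b x) r * cnj (pv b (polA a b x) (polB a b x) s)) = (if r = s then 1 else 0)" .
qed

text \<open>Injectivity passes to the product measurement: for each outcome of Alice, Bob's
  conditional operator vanishes; each of its entries is in turn a form on Alice's side that vanishes
  for all her outcomes.\<close>

lemma product_pol_injective:
  assumes z: "\<And>x. x < a*a*4*(b*b*4) \<Longrightarrow> qf (a*b) D (pv b (polA a b x) (polB a b x)) = 0"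
    and rs: "r < a*b" "s < a*b"
  shows "D r s = 0"
proof -
  have 1: "qf b (pcontr a b D (pol a y)) (pol b z) = 0" if y: "y < a*a*4" and zz: "z < b*b*4" for y z
  proof -
    have "(y*(b*b*4)+z) div (b*b*4) = y" "(y*(b*b*4)+z) mod (b*b*4) = z"
      using zz by (simp_all only: pair_index_div pair_index_mod)
    hence "qf b (pcontr a b D (pol a y)) (pol b z) = qf (a*b) D (pv b (polA a b (y*(b*b*4)+z)) (polB a b (y*(b*b*4)+z)))"
      by (simp only: qf_pcontr polA_def polB_def)
    also have "\<dots> = 0" by (intro z pair_index_less y zz)
    finally show ?thesis .
  qed
  have 2: "pcontr a b D (pol a y) i j = 0" if "y < a*a*4" "i < b" "j < b" for y i j
    by (rule pol_injective[OF 1[OF that(1)] that(2,3)])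
  have "qf a (\<lambda>k l. D (k*b+i) (l*b+j)) (pol a y) = 0" if "y < a*a*4" "i < b" "j < b" for y i j
    using 2[OF that] by (simp only: qf_def pcontr_def)
  hence 3: "D (k*b+i) (l*b+j) = 0" if "i < b" "j < b" "k < a" "l < a" for i j k l
    using pol_injective[of a "\<lambda>k l. D (k*b+i) (l*b+j)" k l] that by blast
  have "D (r div b * b + r mod b) (s div b * b + s mod b) = 0"
    by (intro 3 index_div_less[OF rs(1)] index_mod_less[OF rs(1)] index_div_less[OF rs(2)] index_mod_less[OF rs(2)])
  thus ?thesis by simp
qed

section \<open>Compactness of the set of density matrices\<close>

text \<open>Testing on e_i + x e_j with x = 1, -1, i, -i bounds twice the real or imaginary part of
  A i j by the sum of two diagonal entries, which is at most the trace.\<close>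

lemma density_entry_bound:
  assumes A: "psdk n A" "tr n A = 1" and ij: "i < n" "j < n"
  shows "\<bar>Re (A i j)\<bar> \<le> 1" "\<bar>Im (A i j)\<bar> \<le> 1"
proof -
  have d: "0 \<le> Re (A k k)" "Im (A k k) = 0" if "k < n" for k
    using psdk_diag[OF A(1) that] by (auto simp: less_eq_complex_def)
  have t: "(\<Sum>k<n. Re (A k k)) = 1" using A(2) by (simp add: tr_def flip: Re_sum)
  have h: "A j i = cnj (A i j)" using psdk_herm[OF A(1)] ij unfolding herm_def by blast
  have "\<bar>Re (A i j)\<bar> \<le> 1 \<and> \<bar>Im (A i j)\<bar> \<le> 1"
  proof (cases "i = j")
    case True
    have "Re (A i i) \<le> (\<Sum>k<n. Re (A k k))" using d ij by (intro member_le_sum) auto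
    thus ?thesis using d[OF ij(1)] t True by simp
  next
    case False
    have "sum (\<lambda>k. Re (A k k)) {i,j} \<le> (\<Sum>k<n. Re (A k k))" using d ij by (intro sum_mono2) auto
    hence le: "Re (A i i) + Re (A j j) \<le> 1" using False t by simp
    have q: "0 \<le> Re (cnj x * A i i * x + cnj x * A i j * y + cnj y * A j i * x + cnj y * A j j * y)" for x y
      unfolding qf_two_point[OF ij False, symmetric] by (rule psdk_Re[OF A(1)])
    have "0 \<le> Re (A i i) + 2 * Re (A i j) + Re (A j j)" using q[of 1 1] h by simp
    moreover have "0 \<le> Re (A i i) - 2 * Re (A i j) + Re (A j j)" using q[of 1 "- 1"] h by simp
    moreover have "0 \<le> Re (A i i) - 2 * Im (A i j) + Re (A j j)" using q[of 1 \<i>] h by simp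
    moreover have "0 \<le> Re (A i i) + 2 * Im (A i j) + Re (A j j)" using q[of 1 "- \<i>"] h by simp
    ultimately show ?thesis using le d[OF ij(1)] d[OF ij(2)] by linarith
  qed
  thus "\<bar>Re (A i j)\<bar> \<le> 1" "\<bar>Im (A i j)\<bar> \<le> 1" by auto
qed

lemma density_seq_compact:
  assumes s: "\<And>n. density a (s n)"
  shows "\<exists>r \<alpha>. strict_mono (r :: nat \<Rightarrow> nat) \<and> density a \<alpha> \<and> (\<forall>v. (\<lambda>n. qf a (ker (s (r n))) v) \<longlonglongrightarrow> qf a (ker \<alpha>) v)"
proof -
  have d: "psdk a (ker (s n))" "tr a (ker (s n)) = 1" for n using s by (auto simp: density_iff)
  \<comment> \<open>Real and imaginary parts form one finite family of real sequences, the Boolean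
    choosing between them, so that a single subsequence serves all entries.\<close>
  define F where "F p n = (if snd p then Re (ker (s n) (fst (fst p)) (snd (fst p))) else Im (ker (s n) (fst (fst p)) (snd (fst p))))"
    for p :: "(nat \<times> nat) \<times> bool" and n
  have "finite (({..<a} \<times> {..<a}) \<times> (UNIV :: bool set))" by simp
  moreover have "\<bar>F p n\<bar> \<le> 1" if "p \<in> ({..<a} \<times> {..<a}) \<times> UNIV" for p n
    using density_entry_bound[OF d, of "fst (fst p)" "snd (fst p)" n] that by (auto simp: F_def)
  ultimately have "\<exists>r. strict_mono r \<and> (\<forall>p\<in>({..<a} \<times> {..<a}) \<times> UNIV. convergent (\<lambda>n. F p (r n)))"
    by (rule bounded_family_subsequence)
  then obtain r where r: "strict_mono r" "\<forall>p\<in>({..<a} \<times> {..<a}) \<times> UNIV. convergent (\<lambda>n. F p (r n))" by blast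
  define G where "G i j = Complex (lim (\<lambda>n. F ((i,j),True) (r n))) (lim (\<lambda>n. F ((i,j),False) (r n)))" for i j
  have lim: "(\<lambda>n. ker (s (r n)) i j) \<longlonglongrightarrow> G i j" if "i < a" "j < a" for i j
  proof -
    have "convergent (\<lambda>n. F ((i,j),True) (r n))" "convergent (\<lambda>n. F ((i,j),False) (r n))"
      using r(2) that by blast+
    hence "(\<lambda>n. Re (ker (s (r n)) i j)) \<longlonglongrightarrow> Re (G i j)" "(\<lambda>n. Im (ker (s (r n)) i j)) \<longlonglongrightarrow> Im (G i j)"
      by (simp_all add: G_def convergent_LIMSEQ_iff F_def)
    thus ?thesis by (simp add: tendsto_complex_iff)
  qed
  let ?\<alpha> = "mat a a (\<lambda>(i,j). G i j)"
  have qlim: "(\<lambda>n. qf a (ker (s (r n))) v) \<longlonglongrightarrow> qf a G v" for v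
    unfolding qf_def by (intro tendsto_sum tendsto_mult tendsto_const lim) auto
  have qa: "qf a (ker ?\<alpha>) v = qf a G v" for v by (intro qf_cong refl ker_mat)
  have "psdk a G"
    unfolding psdk_def
  proof
    fix v
    have "(\<lambda>n. Re (qf a (ker (s (r n))) v)) \<longlonglongrightarrow> Re (qf a G v)" by (intro tendsto_Re qlim)
    hence "Re (qf a G v) \<ge> 0" by (rule LIMSEQ_le_const) (use psdk_Re[OF d(1)] in auto)
    moreover have "(\<lambda>n. Im (qf a (ker (s (r n))) v)) \<longlonglongrightarrow> Im (qf a G v)" by (intro tendsto_Im qlim)
    hence "Im (qf a G v) = 0" by (simp add: psdk_Im[OF d(1)] LIMSEQ_const_iff)
    ultimately show "0 \<le> qf a G v" by (simp add: less_eq_complex_def)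
  qed
  moreover have "tr a G = 1"
  proof -
    have "(\<lambda>n. tr a (ker (s (r n)))) \<longlonglongrightarrow> tr a G"
      unfolding tr_def by (intro tendsto_sum lim) auto
    thus ?thesis by (simp add: d(2) LIMSEQ_const_iff)
  qed
  ultimately have "density a ?\<alpha>" using psd_mat[of a G] tr_mat[of a G] by (simp add: density_iff psd_iff)
  moreover have "\<forall>v. (\<lambda>n. qf a (ker (s (r n))) v) \<longlonglongrightarrow> qf a (ker ?\<alpha>) v" using qlim qa by simp
  ultimately show ?thesis using r(1) by blast
qed

section \<open>The witness of an entangled state\<close>

definition dpair :: "nat \<Rightarrow> nat \<Rightarrow> (complex mat \<times> complex mat) set" where
  "dpair a b = {t. density a (fst t) \<and> density b (snd t)}"

definition dprob :: "nat \<Rightarrow> nat \<Rightarrow> complex mat \<times> complex mat \<Rightarrow> nat \<Rightarrow> real" where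
  "dprob a b t x = Re (qf a (ker (fst t)) (polA a b x)) * Re (qf b (ker (snd t)) (polB a b x))"

lemma dpair_seq_compact: "seq_compact_family L (dprob a b) (dpair a b)"
  unfolding seq_compact_family_def
proof (intro allI impI)
  fix s :: "nat \<Rightarrow> complex mat \<times> complex mat" assume s: "\<forall>n. s n \<in> dpair a b"
  have "\<And>n. density a (fst (s n))" using s by (simp add: dpair_def)
  from density_seq_compact[of a "\<lambda>n. fst (s n)", OF this] obtain r \<alpha> where
    r: "strict_mono r" "density a \<alpha>" "\<forall>v. (\<lambda>n. qf a (ker (fst (s (r n)))) v) \<longlonglongrightarrow> qf a (ker \<alpha>) v" by blast
  have "\<And>n. density b (snd (s (r n)))" using s by (simp add: dpair_def)
  from density_seq_compact[of b "\<lambda>n. snd (s (r n))", OF this] obtain q \<beta> where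
    q: "strict_mono q" "density b \<beta>" "\<forall>v. (\<lambda>n. qf b (ker (snd (s (r (q n))))) v) \<longlonglongrightarrow> qf b (ker \<beta>) v" by blast
  have "(\<lambda>n. dprob a b (s (r (q n))) x) \<longlonglongrightarrow> dprob a b (\<alpha>, \<beta>) x" for x
  proof -
    have "(\<lambda>n. Re (qf a (ker (fst (s (r n)))) (polA a b x))) \<longlonglongrightarrow> Re (qf a (ker \<alpha>) (polA a b x))"
      using r(3) by (intro tendsto_Re) blast
    from tendsto_subseq[OF this q(1)]
    have "(\<lambda>n. Re (qf a (ker (fst (s (r (q n))))) (polA a b x))) \<longlonglongrightarrow> Re (qf a (ker \<alpha>) (polA a b x))" .
    moreover have "(\<lambda>n. Re (qf b (ker (snd (s (r (q n))))) (polB a b x))) \<longlonglongrightarrow> Re (qf b (ker \<beta>) (polB a b x))"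
      using q(3) by (intro tendsto_Re) blast
    ultimately show ?thesis unfolding dprob_def fst_conv snd_conv by (rule tendsto_mult)
  qed
  moreover have "strict_mono (\<lambda>n. r (q n))" using r(1) q(1) by (simp add: strict_mono_def)
  moreover have "(\<alpha>, \<beta>) \<in> dpair a b" using r(2) q(2) by (simp add: dpair_def)
  ultimately show "\<exists>r t. strict_mono r \<and> t \<in> dpair a b \<and> (\<forall>x<L. (\<lambda>n. dprob a b (s (r n)) x) \<longlonglongrightarrow> dprob a b t x)"
    by blast
qed

lemma density_exists: "n > 0 \<Longrightarrow> \<exists>\<alpha>. density n \<alpha>"
proof -
  assume n: "n > 0"
  define v where "v i = (if i = 0 then 1 else (0::complex))" for i :: nat
  have "psd n (mat n n (\<lambda>(i,j). v i * cnj (v j)))" by (rule psd_mat[OF psdk_rank1])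
  moreover have "tr n (\<lambda>i j. v i * cnj (v j)) = 1"
  proof -
    have "tr n (\<lambda>i j. v i * cnj (v j)) = (\<Sum>i<n. if i = 0 then 1 else 0)"
      unfolding tr_def by (intro sum.cong refl) (simp add: v_def)
    thus ?thesis using n by simp
  qed
  ultimately have "density n (mat n n (\<lambda>(i,j). v i * cnj (v j)))"
    unfolding density_iff psd_iff tr_mat[of n "\<lambda>i j. v i * cnj (v j)"] by simp
  thus ?thesis by blast
qed

text \<open>The measurement is injective on operators, so a state with the outcome distribution of a
  mixture of product states is that mixture.\<close>

lemma comb_imp_separable:
  assumes \<rho>: "density (a*b) \<rho>"
    and c: "comb (a*a*4*(b*b*4)) (dprob a b) (dpair a b) K p t
      (\<lambda>x. Re (qf (a*b) (ker \<rho>) (pv b (polA a b x) (polB a b x))))"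
  shows "separable a b \<rho>"
proof -
  let ?L = "a*a*4*(b*b*4)"
  \<comment> \<open>Padding yields an initial segment of the naturals as index set, the form
    demanded by \<open>separable\<close>.\<close>
  from caratheodory_padded[OF c] obtain p t where
    c: "comb ?L (dprob a b) (dpair a b) {..?L} p t (\<lambda>x. Re (qf (a*b) (ker \<rho>) (pv b (polA a b x) (polB a b x))))"
    by blast
  let ?N = "Suc ?L"
  have p: "p k \<ge> 0" "density a (fst (t k))" "density b (snd (t k))" if "k < ?N" for k
    using c that by (auto simp: comb_def dpair_def)
  have p1: "(\<Sum>k<?N. p k) = 1" using c by (simp add: comb_def lessThan_Suc_atMost)
  have y: "Re (qf (a*b) (ker \<rho>) (pv b (polA a b x) (polB a b x))) = (\<Sum>k<?N. p k * dprob a b (t k) x)" if "x < ?L" for x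
    using c that unfolding comb_def lessThan_Suc_atMost by blast
  define S where "S r s = (\<Sum>k<?N. complex_of_real (p k) * ker (kron (fst (t k)) (snd (t k))) r s)" for r s
  have D: "ker \<rho> r s - S r s = 0" if rs: "r < a*b" "s < a*b" for r s
  proof (rule product_pol_injective[of a b "\<lambda>r s. ker \<rho> r s - S r s", OF _ rs])
    fix x assume x: "x < ?L"
    let ?u = "pv b (polA a b x) (polB a b x)"
    have "qf (a*b) S ?u = (\<Sum>k<?N. complex_of_real (p k) * qf (a*b) (ker (kron (fst (t k)) (snd (t k)))) ?u)"
      unfolding S_def[abs_def] by (simp only: qf_sum qf_scale)
    also have "\<dots> = (\<Sum>k<?N. complex_of_real (p k * dprob a b (t k) x))"
    proof (intro sum.cong refl)
      fix k assume "k \<in> {..<?N}"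
      hence k: "k < ?N" by simp
      have d: "fst (t k) \<in> carrier_mat a a" "snd (t k) \<in> carrier_mat b b" "psdk a (ker (fst (t k)))" "psdk b (ker (snd (t k)))"
        using p[OF k] by (auto simp: density_iff)
      have "qf (a*b) (ker (kron (fst (t k)) (snd (t k)))) ?u = qf a (ker (fst (t k))) (polA a b x) * qf b (ker (snd (t k))) (polB a b x)"
        by (rule qf_kron_mat[OF d(1,2)])
      also have "\<dots> = complex_of_real (dprob a b (t k) x)"
        using psdk_Im[OF d(3)] psdk_Im[OF d(4)] by (simp add: dprob_def complex_eq_iff)
      finally show "complex_of_real (p k) * qf (a*b) (ker (kron (fst (t k)) (snd (t k)))) ?u = complex_of_real (p k * dprob a b (t k) x)"
        by simp
    qed
    also have "\<dots> = complex_of_real (Re (qf (a*b) (ker \<rho>) ?u))"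
      unfolding y[OF x] of_real_sum ..
    also have "\<dots> = qf (a*b) (ker \<rho>) ?u"
      using \<rho> psdk_Im[of "a*b" "ker \<rho>" ?u] by (simp add: density_iff complex_eq_iff)
    finally show "qf (a*b) (\<lambda>r s. ker \<rho> r s - S r s) ?u = 0" by (simp add: qf_diff)
  qed
  have "\<rho> = mat (a*b) (a*b) (\<lambda>(r,s). \<Sum>k<?N. complex_of_real (p k) * kron (fst (t k)) (snd (t k)) $$ (r,s))"
  proof (rule eq_matI)
    fix r s assume "r < dim_row (mat (a*b) (a*b) (\<lambda>(r,s). \<Sum>k<?N. complex_of_real (p k) * kron (fst (t k)) (snd (t k)) $$ (r,s)))"
      "s < dim_col (mat (a*b) (a*b) (\<lambda>(r,s). \<Sum>k<?N. complex_of_real (p k) * kron (fst (t k)) (snd (t k)) $$ (r,s)))"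
    hence rs: "r < a*b" "s < a*b" by simp_all
    have "\<rho> $$ (r,s) = S r s" using D[OF rs] by (simp add: ker_def)
    thus "\<rho> $$ (r,s) = mat (a*b) (a*b) (\<lambda>(r,s). \<Sum>k<?N. complex_of_real (p k) * kron (fst (t k)) (snd (t k)) $$ (r,s)) $$ (r,s)"
      using rs by (simp only: S_def ker_def index_mat prod.case)
  qed (use \<rho> in \<open>auto simp: density_iff\<close>)
  thus ?thesis unfolding separable_def using \<rho> p p1
    by (intro conjI exI[of _ ?N] exI[of _ p] exI[of _ "\<lambda>k. fst (t k)"] exI[of _ "\<lambda>k. snd (t k)"]) auto
qed

lemma (in product_povm) sum_product_prob:
  assumes "psdk a A" "psdk b B"
  shows "(\<Sum>x<L. Re (qf a A (e x)) * Re (qf b B (f x))) = Re (tr a A) * Re (tr b B)"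
proof -
  let ?K = "\<lambda>r s. A (r div b) (s div b) * B (r mod b) (s mod b)"
  have "(\<Sum>x<L. Re (qf a A (e x)) * Re (qf b B (f x))) = (\<Sum>x<L. Re (qf (a*b) ?K (pv b (e x) (f x))))"
    using psdk_Im[OF assms(1)] by (simp add: qf_kron)
  also have "\<dots> = Re (tr (a*b) ?K)"
    unfolding Re_sum[symmetric] using sum_qf_complete[OF complete, where A = ?K] by simp
  also have "tr (a*b) ?K = (\<Sum>i<a. \<Sum>j<b. A i i * B j j)"
    unfolding tr_def sum_prod_index by (intro sum.cong refl) simp
  also have "\<dots> = tr a A * tr b B" unfolding tr_def by (rule sum_product[symmetric])
  finally show ?thesis using psdk_tr_Im[OF assms(1)] by simp
qed

lemma psdk_tr_zero:
  assumes "psdk n A" "Re (tr n A) = 0"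
  shows "Re (qf n A v) = 0"
  using psdk_qf_le[OF assms(1), of v] psdk_Re[OF assms(1), of v] assms(2) by simp

lemma psdk_normalise:
  assumes A: "psdk n A" and t: "Re (tr n A) > 0"
  shows "\<exists>\<alpha>. density n \<alpha> \<and> (\<forall>v. Re (qf n A v) = Re (tr n A) * Re (qf n (ker \<alpha>) v))"
proof -
  define c where "c = Re (tr n A)"
  define B where "B = (\<lambda>i j. complex_of_real (1 / c) * A i j)"
  have c: "c > 0" "tr n A = complex_of_real c"
    using t psdk_tr_Im[OF A] by (auto simp: c_def complex_eq_iff)
  have "psdk n B" unfolding B_def using c by (intro psdk_scale A) (simp add: less_eq_complex_def)
  moreover have "tr n B = 1"
  proof -
    have "tr n B = complex_of_real (1 / c) * tr n A" by (simp only: B_def tr_def sum_distrib_left)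
    thus ?thesis using c by simp
  qed
  ultimately have "density n (mat n n (\<lambda>(i,j). B i j))"
    using psd_mat[of n B] tr_mat[of n B] by (simp add: density_iff psd_iff)
  moreover have "Re (qf n A v) = c * Re (qf n (ker (mat n n (\<lambda>(i,j). B i j))) v)" for v
  proof -
    have "qf n (ker (mat n n (\<lambda>(i,j). B i j))) v = qf n B v" by (intro qf_cong refl ker_mat)
    also have "\<dots> = complex_of_real (1 / c) * qf n A v" unfolding B_def by (rule qf_scale)
    finally show ?thesis using c(1) by simp
  qed
  ultimately show ?thesis unfolding c_def by blast
qed

text \<open>A separating functional v can be shifted to be nonnegative on product states with mean
  -\<delta> on \<rho>. The weights 1 - t v then have mean at most 1 on product states, while the
  mean of their logarithm under \<rho> is at least t \<delta> minus a term of order t^2, hence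
  positive for small t.\<close>

theorem entangled_witness:
  assumes "entangled a b \<rho>"
  shows "\<exists>g C. (\<forall>x. g x > 0) \<and> (\<forall>x. \<bar>ln (g x)\<bar> \<le> C) \<and>
    (\<forall>A B. psdk a A \<longrightarrow> psdk b B \<longrightarrow>
      (\<Sum>x<a*a*4*(b*b*4). g x * (Re (qf a A (polA a b x)) * Re (qf b B (polB a b x)))) \<le> Re (tr a A) * Re (tr b B)) \<and>
    product_povm.mean_log a b (a*a*4*(b*b*4)) (polA a b) (polB a b) g \<rho> > 0"
proof -
  let ?L = "a*a*4*(b*b*4)"
  have \<rho>: "density (a*b) \<rho>" and ns: "\<not> separable a b \<rho>" using assms by (auto simp: entangled_def)
  have "a*b \<noteq> 0"
  proof
    assume "a*b = 0"
    with \<rho> show False by (simp add: density_iff tr_def)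
  qed
  hence ab: "a > 0" "b > 0" by auto
  interpret product_povm a b ?L "polA a b" "polB a b" by (rule product_povm_pol[OF ab])
  define y where "y x = Re (qf (a*b) (ker \<rho>) (pv b (polA a b x) (polB a b x)))" for x
  have y0: "y x \<ge> 0" for x unfolding y_def using \<rho> by (intro psdk_Re) (simp add: density_iff)
  have y1: "(\<Sum>x<?L. y x) = 1"
    unfolding y_def Re_sum[symmetric] using sum_qf_complete[OF complete, where A = "ker \<rho>"] \<rho> by (simp add: density_iff)
  have "dpair a b \<noteq> {}" using density_exists[OF ab(1)] density_exists[OF ab(2)] by (auto simp: dpair_def)
  moreover have "\<not> comb ?L (dprob a b) (dpair a b) K p t y" for K p t
    using comb_imp_separable[OF \<rho>, of K p t] ns unfolding y_def[abs_def] by blast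
  ultimately obtain w c where w: "\<forall>t\<in>dpair a b. c \<le> (\<Sum>x<?L. w x * dprob a b t x)" "(\<Sum>x<?L. w x * y x) < c"
    using hull_separation[OF dpair_seq_compact, of a b ?L y] by blast
  \<comment> \<open>Outcome probabilities sum to 1, so subtracting the constant c moves the
    threshold of separation to 0.\<close>
  define v where "v x = w x - c" for x
  define \<delta> where "\<delta> = c - (\<Sum>x<?L. w x * y x)"
  have \<delta>: "\<delta> > 0" using w(2) by (simp add: \<delta>_def)
  have vy: "(\<Sum>x<?L. v x * y x) = - \<delta>"
    unfolding v_def \<delta>_def left_diff_distrib sum_subtractf sum_distrib_left[symmetric] y1 by simp
  have vt: "0 \<le> (\<Sum>x<?L. v x * dprob a b t x)" if t: "t \<in> dpair a b" for t
  proof -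
    have "(\<Sum>x<?L. dprob a b t x) = 1"
      unfolding dprob_def using t sum_product_prob[of "ker (fst t)" "ker (snd t)"]
      by (simp add: dpair_def density_iff)
    hence "(\<Sum>x<?L. v x * dprob a b t x) = (\<Sum>x<?L. w x * dprob a b t x) - c"
      by (simp add: v_def left_diff_distrib sum_subtractf sum_distrib_left[symmetric])
    thus ?thesis using w(1) t by simp
  qed
  define M where "M = 1 + (\<Sum>x<?L. \<bar>v x\<bar>)"
  have M1: "M \<ge> 1" by (simp add: M_def sum_nonneg)
  have vM: "\<bar>v x\<bar> \<le> M" if "x < ?L" for x
  proof -
    have "\<bar>v x\<bar> \<le> (\<Sum>x<?L. \<bar>v x\<bar>)" using that by (intro member_le_sum) auto
    thus ?thesis by (simp add: M_def)
  qed
  \<comment> \<open>The first bound gives \<open>\<bar>t * v x\<bar> \<le> 1 / 2\<close>, so that g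
    is positive and the expansion of ln applies; the second limits the second-order loss to half of
    the gain t \<delta>.\<close>
  define t where "t = min (1 / (2 * M)) (\<delta> / (4 * M\<^sup>2))"
  have t0: "t > 0" using M1 \<delta> by (simp add: t_def)
  have tM: "t * M \<le> 1 / 2"
  proof -
    have "t * M \<le> 1 / (2 * M) * M" using M1 by (intro mult_right_mono) (auto simp: t_def)
    thus ?thesis using M1 by simp
  qed
  have tM2: "t * (2 * M\<^sup>2) \<le> \<delta> / 2"
  proof -
    have "t * (2 * M\<^sup>2) \<le> \<delta> / (4 * M\<^sup>2) * (2 * M\<^sup>2)" by (intro mult_right_mono) (auto simp: t_def)
    thus ?thesis using M1 by simp
  qed
  have tv: "\<bar>t * v x\<bar> \<le> 1 / 2" if "x < ?L" for x
  proof -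
    have "\<bar>t * v x\<bar> \<le> t * M" using vM[OF that] t0 by (simp add: abs_mult)
    thus ?thesis using tM by simp
  qed
  \<comment> \<open>The value 1 beyond the range of outcomes keeps positivity and the bound on ln g
    valid for all naturals.\<close>
  define g where "g x = (if x < ?L then 1 - t * v x else 1)" for x
  define C where "C = (\<Sum>x<?L. \<bar>ln (g x)\<bar>)"
  have g: "g x > 0" for x using tv[of x] by (auto simp: g_def abs_le_iff)
  have C: "\<bar>ln (g x)\<bar> \<le> C" for x
  proof (cases "x < ?L")
    case True
    thus ?thesis unfolding C_def by (intro member_le_sum) auto
  next
    case False
    hence "ln (g x) = 0" by (simp add: g_def)
    thus ?thesis unfolding C_def by (simp only: abs_zero) (intro sum_nonneg abs_ge_zero)
  qed
  have one: "(\<Sum>x<?L. g x * (Re (qf a A (polA a b x)) * Re (qf b B (polB a b x)))) \<le> Re (tr a A) * Re (tr b B)"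
    if A: "psdk a A" and B: "psdk b B" for A B
  proof (cases "Re (tr a A) = 0 \<or> Re (tr b B) = 0")
    \<comment> \<open>A positive operator of trace 0 cannot be normalised to a state, but all its
      outcome values vanish.\<close>
    case True
    hence "Re (qf a A (polA a b x)) * Re (qf b B (polB a b x)) = 0" for x
      using psdk_tr_zero[OF A] psdk_tr_zero[OF B] by auto
    thus ?thesis using True by auto
  next
    case False
    have "Re (tr a A) \<ge> 0" "Re (tr b B) \<ge> 0"
      using psdk_tr[OF A] psdk_tr[OF B] by (auto simp: less_eq_complex_def)
    with False have pos: "Re (tr a A) > 0" "Re (tr b B) > 0" by auto
    obtain \<alpha> where \<alpha>: "density a \<alpha>" "\<forall>v. Re (qf a A v) = Re (tr a A) * Re (qf a (ker \<alpha>) v)"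
      using psdk_normalise[OF A pos(1)] by blast
    obtain \<beta> where \<beta>: "density b \<beta>" "\<forall>v. Re (qf b B v) = Re (tr b B) * Re (qf b (ker \<beta>) v)"
      using psdk_normalise[OF B pos(2)] by blast
    have "(\<Sum>x<?L. g x * (Re (qf a A (polA a b x)) * Re (qf b B (polB a b x))))
      = (\<Sum>x<?L. (Re (qf a A (polA a b x)) * Re (qf b B (polB a b x))) - (t * (Re (tr a A) * Re (tr b B))) * (v x * dprob a b (\<alpha>,\<beta>) x))"
    proof (intro sum.cong refl)
      fix x assume "x \<in> {..<?L}"
      moreover have "Re (qf a A (polA a b x)) * Re (qf b B (polB a b x)) = (Re (tr a A) * Re (tr b B)) * dprob a b (\<alpha>,\<beta>) x"
        using \<alpha>(2) \<beta>(2) by (simp add: dprob_def)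
      ultimately show "g x * (Re (qf a A (polA a b x)) * Re (qf b B (polB a b x)))
        = (Re (qf a A (polA a b x)) * Re (qf b B (polB a b x))) - (t * (Re (tr a A) * Re (tr b B))) * (v x * dprob a b (\<alpha>,\<beta>) x)"
        by (simp add: g_def algebra_simps)
    qed
    also have "\<dots> = Re (tr a A) * Re (tr b B) - (t * (Re (tr a A) * Re (tr b B))) * (\<Sum>x<?L. v x * dprob a b (\<alpha>,\<beta>) x)"
      unfolding sum_subtractf sum_product_prob[OF A B] sum_distrib_left ..
    also have "\<dots> \<le> Re (tr a A) * Re (tr b B)"
      using vt[of "(\<alpha>,\<beta>)"] \<alpha>(1) \<beta>(1) pos t0 by (simp add: dpair_def)
    finally show ?thesis .
  qed
  have "mean_log g \<rho> \<ge> t * \<delta> - t * (t * (2 * M\<^sup>2))"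
  proof -
    have "t * \<delta> - t * (t * (2 * M\<^sup>2)) = (\<Sum>x<?L. y x * (- (t * v x) - 2 * (t * M)\<^sup>2))"
    proof -
      have "(\<Sum>x<?L. y x * (- (t * v x) - 2 * (t * M)\<^sup>2)) = (\<Sum>x<?L. (- t) * (v x * y x) - (2 * (t * M)\<^sup>2) * y x)"
        by (intro sum.cong refl) (simp add: algebra_simps)
      also have "\<dots> = (- t) * (- \<delta>) - 2 * (t * M)\<^sup>2"
        unfolding sum_subtractf sum_distrib_left[symmetric] vy y1 by simp
      finally show ?thesis by (simp add: power2_eq_square mult_ac)
    qed
    also have "\<dots> \<le> (\<Sum>x<?L. y x * ln (g x))"
    proof (intro sum_mono mult_left_mono y0)
      fix x assume "x \<in> {..<?L}"
      hence x: "x < ?L" by simp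
      \<comment> \<open>Supplies ln (1 + u) \<ge> u - 2 u^2 for u of absolute value at most 1/2,
        with u = - t v.\<close>
      have "\<bar>ln (1 + - (t * v x)) - - (t * v x)\<bar> \<le> 2 * (- (t * v x))\<^sup>2"
        using tv[OF x] by (intro abs_ln_one_plus_x_minus_x_bound) simp
      moreover have "(- (t * v x))\<^sup>2 \<le> (t * M)\<^sup>2"
      proof -
        have "\<bar>t * v x\<bar> \<le> \<bar>t * M\<bar>" using vM[OF x] t0 M1 by (simp add: abs_mult)
        thus ?thesis unfolding abs_le_square_iff by simp
      qed
      ultimately show "- (t * v x) - 2 * (t * M)\<^sup>2 \<le> ln (g x)" using x by (simp add: g_def)
    qed
    finally show ?thesis unfolding mean_log_def y_def .
  qed
  moreover have "t * \<delta> - t * (t * (2 * M\<^sup>2)) > 0"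
  proof -
    have "t * (t * (2 * M\<^sup>2)) \<le> t * (\<delta> / 2)" using tM2 t0 by (intro mult_left_mono) auto
    moreover have "t * (\<delta> / 2) < t * \<delta>" using t0 \<delta> by simp
    ultimately show ?thesis by linarith
  qed
  ultimately have "mean_log g \<rho> > 0" by linarith
  with g C one show ?thesis by blast
qed

section \<open>Composition, symmetry and finiteness of rates\<close>

definition achievable :: "nat \<Rightarrow> nat \<Rightarrow> complex mat \<Rightarrow> nat \<Rightarrow> nat \<Rightarrow> complex mat \<Rightarrow> real \<Rightarrow> bool" where
  "achievable a b \<rho> c d \<sigma> r \<longleftrightarrow> r \<ge> 0 \<and>
     (\<exists>\<Lambda> m. (\<forall>n. LOCC (a^n) (b^n) (c^(m n)) (d^(m n)) (\<Lambda> n)) \<and>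
        (\<lambda>n. real (m n) / real n) \<longlonglongrightarrow> r \<and>
        (\<lambda>n. trace_norm (\<Lambda> n (tpow a b \<rho> n) - tpow c d \<sigma> (m n))) \<longlonglongrightarrow> 0)"

lemma rate_alt: "rate a b \<rho> c d \<sigma> = (SUP r\<in>{r. achievable a b \<rho> c d \<sigma> r}. ereal r)"
  unfolding rate_def achievable_def by (rule arg_cong[where f = Sup]) blast

lemma achievable_le_rate: "achievable a b \<rho> c d \<sigma> r \<Longrightarrow> ereal r \<le> rate a b \<rho> c d \<sigma>"
  unfolding rate_alt by (intro SUP_upper) simp

lemma density_psd: "density n X \<Longrightarrow> psd n X"
  by (simp add: density_def)

lemma density_dims:
  assumes "density (a*b) \<rho>"
  shows "a > 0" "b > 0"
proof -
  have "a*b \<noteq> 0"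
  proof
    assume "a*b = 0"
    with assms show False by (simp add: density_iff tr_def)
  qed
  thus "a > 0" "b > 0" by auto
qed

lemma LOCC_density:
  assumes "LOCC a b c d L" "density (a*b) X"
  shows "density (c*d) (L X)"
proof -
  have X: "psd (a*b) X" "X \<in> carrier_mat (a*b) (a*b)" "tr (a*b) (ker X) = 1"
    using assms(2) by (auto simp: density_iff psd_iff)
  note ch = LOCC_channel[OF assms(1)]
  show ?thesis using channel_psd[OF ch X(1)] channel_tr[OF ch X(2)] X(3) by (simp add: density_iff psd_iff)
qed

text \<open>The bras of the standard basis: a measurement that destroys the system and leaves
  dimension 1.\<close>

lemma complete_kraus_rows:
  "complete_kraus n 1 n (\<lambda>k. mat 1 n (\<lambda>(i,j). if j = k then 1 else 0))"
proof -
  let ?K = "\<lambda>k. mat 1 n (\<lambda>(i,j). if j = k then 1 else (0::complex))"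
  have "(\<Sum>k<n. (adj (?K k) * ?K k) $$ (r,s)) = (if r = s then 1 else 0)" if rs: "r < n" "s < n" for r s
  proof -
    have K: "?K k \<in> carrier_mat 1 n" for k by simp
    have "(adj (?K k) * ?K k) $$ (r,s) = cnj (?K k $$ (0,r)) * ?K k $$ (0,s)" for k
      unfolding mult_entry[OF adj_carrier[OF K] K rs] using adj_entry[OF K rs(1), of 0] by simp
    hence "(\<Sum>k<n. (adj (?K k) * ?K k) $$ (r,s)) = (\<Sum>k<n. cnj (?K k $$ (0,r)) * ?K k $$ (0,s))"
      by (intro sum.cong refl)
    also have "\<dots> = (\<Sum>k<n. if k = r then (if r = s then 1 else 0) else 0)"
      using rs by (intro sum.cong refl) auto
    finally have "(\<Sum>k<n. (adj (?K k) * ?K k) $$ (r,s)) = (\<Sum>k<n. if k = r then (if r = s then 1 else 0) else 0)" .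
    thus ?thesis using rs by simp
  qed
  thus ?thesis by (simp add: complete_kraus_def)
qed

lemma LOCC_discard: "\<exists>L. LOCC a b 1 1 L"
proof -
  have 1: "LOCC 1 b 1 1 (\<lambda>X. lcomb (1*1) b (\<lambda>_. 1) (\<lambda>k. cj (kron (1\<^sub>m 1) (mat 1 b (\<lambda>(i,j). if j = k then 1 else 0))) X))"
    by (rule LOCC_Bob'[OF complete_kraus_rows LOCC_id])
  show ?thesis
    by (rule exI, rule LOCC_Alice'[OF complete_kraus_rows 1])
qed

text \<open>Everything is discarded and no copies are produced. This keeps the supremum in
  \<open>rate\<close> away from the empty set, where it would be minus infinity.\<close>

lemma achievable_zero:
  assumes \<rho>: "density (a*b) \<rho>" and \<sigma>: "density (c*d) \<sigma>"
  shows "achievable a b \<rho> c d \<sigma> 0"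
proof -
  have "\<forall>n. \<exists>L. LOCC (a^n) (b^n) 1 1 L" using LOCC_discard by blast
  from choice[OF this] obtain \<Lambda> where \<Lambda>: "\<And>n. LOCC (a^n) (b^n) 1 1 (\<Lambda> n)" by blast
  have "trace_norm (\<Lambda> n (tpow a b \<rho> n) - tpow c d \<sigma> 0) = 0" for n
  proof -
    have d: "density (1*1) (\<Lambda> n (tpow a b \<rho> n))" by (rule LOCC_density[OF \<Lambda> density_tpow[OF \<rho>]])
    have e: "density (1*1) (tpow c d \<sigma> 0)" using density_tpow[OF \<sigma>, of 0] by simp
    have "\<Lambda> n (tpow a b \<rho> n) = tpow c d \<sigma> 0"
      using d e by (intro eq_matI) (auto simp: density_iff tr_def ker_def)
    thus ?thesis using trace_norm_self[OF density_psd[OF e]] by simp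
  qed
  thus ?thesis unfolding achievable_def using \<Lambda>
    by (intro conjI exI[of _ \<Lambda>] exI[of _ "\<lambda>_. 0"]) simp_all
qed

lemma rate_nonneg: "density (a*b) \<rho> \<Longrightarrow> density (c*d) \<sigma> \<Longrightarrow> 0 \<le> rate a b \<rho> c d \<sigma>"
  using achievable_le_rate[OF achievable_zero[of a b \<rho> c d \<sigma>]] by (simp add: zero_ereal_def)

text \<open>For r > 0 the number m n of intermediate copies tends to infinity, so the second
  protocol runs in its asymptotic regime. By contractivity it does not amplify the error of the
  first one, and the two errors add.\<close>

lemma achievable_compose:
  assumes \<rho>: "density (a*b) \<rho>" and \<sigma>: "density (c*d) \<sigma>" and \<tau>: "density (e*f) \<tau>"
    and r: "achievable a b \<rho> c d \<sigma> r" "r > 0" and s: "achievable c d \<sigma> e f \<tau> s"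
  shows "achievable a b \<rho> e f \<tau> (r * s)"
proof -
  obtain \<Lambda> m where \<Lambda>: "\<And>n. LOCC (a^n) (b^n) (c^(m n)) (d^(m n)) (\<Lambda> n)"
    and m: "(\<lambda>n. real (m n) / real n) \<longlonglongrightarrow> r"
    and t1: "(\<lambda>n. trace_norm (\<Lambda> n (tpow a b \<rho> n) - tpow c d \<sigma> (m n))) \<longlonglongrightarrow> 0"
    using r(1) unfolding achievable_def by blast
  obtain \<Gamma> l where \<Gamma>: "\<And>n. LOCC (c^n) (d^n) (e^(l n)) (f^(l n)) (\<Gamma> n)"
    and l: "(\<lambda>n. real (l n) / real n) \<longlonglongrightarrow> s"
    and t2: "(\<lambda>n. trace_norm (\<Gamma> n (tpow c d \<sigma> n) - tpow e f \<tau> (l n))) \<longlonglongrightarrow> 0"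
    using s unfolding achievable_def by blast
  have "\<forall>n. \<exists>D. LOCC (a^n) (b^n) (e^(l (m n))) (f^(l (m n))) D \<and>
      (\<forall>X\<in>carrier_mat (a^n * b^n) (a^n * b^n). D X = \<Gamma> (m n) (\<Lambda> n X))"
    using LOCC_compose[OF \<Lambda> \<Gamma>] by blast
  from choice[OF this] obtain D where D: "\<And>n. LOCC (a^n) (b^n) (e^(l (m n))) (f^(l (m n))) (D n)"
    "\<And>n X. X \<in> carrier_mat (a^n * b^n) (a^n * b^n) \<Longrightarrow> D n X = \<Gamma> (m n) (\<Lambda> n X)" by blast
  have "filterlim (\<lambda>n. real (m n) / real n * real n) at_top sequentially"
    by (rule filterlim_tendsto_pos_mult_at_top[OF m r(2) filterlim_real_sequentially])
  moreover have "\<forall>\<^sub>F n in sequentially. real (m n) / real n * real n = real (m n)"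
    using eventually_gt_at_top[of 0] by eventually_elim simp
  ultimately have "filterlim (\<lambda>n. real (m n)) at_top sequentially"
    by (simp add: filterlim_cong[OF refl refl])
  hence mtop: "filterlim m at_top sequentially" by (simp add: filterlim_sequentially_iff_filterlim_real)
  have "(\<lambda>n. (real (l (m n)) / real (m n)) * (real (m n) / real n)) \<longlonglongrightarrow> s * r"
    by (intro tendsto_mult m filterlim_compose[OF l mtop])
  moreover have "\<forall>\<^sub>F n in sequentially. (real (l (m n)) / real (m n)) * (real (m n) / real n) = real (l (m n)) / real n"
  proof -
    have "\<forall>\<^sub>F n in sequentially. m n > 0" using mtop eventually_gt_at_top[of 0] by (rule filterlim_iff[THEN iffD1, rule_format])
    thus ?thesis by eventually_elim simp
  qed
  ultimately have lim: "(\<lambda>n. real (l (m n)) / real n) \<longlonglongrightarrow> r * s"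
    using tendsto_cong[of "\<lambda>n. (real (l (m n)) / real (m n)) * (real (m n) / real n)"] by (simp add: mult.commute)
  have "(\<lambda>n. trace_norm (D n (tpow a b \<rho> n) - tpow e f \<tau> (l (m n)))) \<longlonglongrightarrow> 0"
  proof -
    let ?u = "\<lambda>n. trace_norm (\<Lambda> n (tpow a b \<rho> n) - tpow c d \<sigma> (m n)) + trace_norm (\<Gamma> (m n) (tpow c d \<sigma> (m n)) - tpow e f \<tau> (l (m n)))"
    have "(\<lambda>n. trace_norm (\<Gamma> (m n) (tpow c d \<sigma> (m n)) - tpow e f \<tau> (l (m n)))) \<longlonglongrightarrow> 0"
      by (rule filterlim_compose[OF t2 mtop])
    from tendsto_add[OF t1 this] have u: "?u \<longlonglongrightarrow> 0" by simp
    have bnd: "0 \<le> trace_norm (D n (tpow a b \<rho> n) - tpow e f \<tau> (l (m n))) \<and>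
        trace_norm (D n (tpow a b \<rho> n) - tpow e f \<tau> (l (m n))) \<le> ?u n" for n
    proof -
      let ?N = "e^(l (m n)) * f^(l (m n))"
      have p1: "density (c^(m n) * d^(m n)) (\<Lambda> n (tpow a b \<rho> n))" by (rule LOCC_density[OF \<Lambda> density_tpow[OF \<rho>]])
      have p2: "density (c^(m n) * d^(m n)) (tpow c d \<sigma> (m n))" by (rule density_tpow[OF \<sigma>])
      have q1: "psd ?N (\<Gamma> (m n) (\<Lambda> n (tpow a b \<rho> n)))" by (rule density_psd[OF LOCC_density[OF \<Gamma> p1]])
      have q2: "psd ?N (\<Gamma> (m n) (tpow c d \<sigma> (m n)))" by (rule density_psd[OF LOCC_density[OF \<Gamma> p2]])
      have q3: "psd ?N (tpow e f \<tau> (l (m n)))" by (rule density_psd[OF density_tpow[OF \<tau>]])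
      have De: "D n (tpow a b \<rho> n) = \<Gamma> (m n) (\<Lambda> n (tpow a b \<rho> n))" by (intro D(2)) simp
      show ?thesis unfolding De
        using trace_norm_nonneg[OF q1 q3] trace_norm_triangle[OF q1 q2 q3]
          trace_norm_channel[OF LOCC_channel[OF \<Gamma>] density_psd[OF p1] density_psd[OF p2]] by simp
    qed
    show ?thesis
      by (rule tendsto_sandwich[OF _ _ tendsto_const u]) (use bnd in \<open>auto intro!: always_eventually\<close>)
  qed
  moreover have "r * s \<ge> 0" using r s by (simp add: achievable_def)
  ultimately show ?thesis unfolding achievable_def using D(1) lim
    by (intro conjI exI[of _ D] exI[of _ "\<lambda>n. l (m n)"]) simp_all
qed

theorem rate_compose:
  assumes \<rho>: "density (a*b) \<rho>" and \<sigma>: "density (c*d) \<sigma>" and \<tau>: "density (e*f) \<tau>"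
  shows "rate a b \<rho> c d \<sigma> * rate c d \<sigma> e f \<tau> \<le> rate a b \<rho> e f \<tau>"
proof -
  let ?A = "{r. achievable a b \<rho> c d \<sigma> r}" and ?B = "{s. achievable c d \<sigma> e f \<tau> s}"
  have ne: "?A \<noteq> {}" "?B \<noteq> {}" using achievable_zero[OF \<rho> \<sigma>] achievable_zero[OF \<sigma> \<tau>] by blast+
  have nn: "0 \<le> ereal r" if "r \<in> ?A" for r using that by (simp add: achievable_def)
  have nn': "0 \<le> ereal s" if "s \<in> ?B" for s using that by (simp add: achievable_def)
  have prod: "ereal s * ereal r \<le> rate a b \<rho> e f \<tau>" if r: "r \<in> ?A" and s: "s \<in> ?B" for r s
  proof (cases "r = 0")
    case True
    thus ?thesis using rate_nonneg[OF \<rho> \<tau>] by (simp add: zero_ereal_def)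
  next
    case False
    hence "r > 0" using r by (simp add: achievable_def)
    hence "achievable a b \<rho> e f \<tau> (r * s)" using r s by (intro achievable_compose[OF \<rho> \<sigma> \<tau>]) auto
    from achievable_le_rate[OF this] show ?thesis by (simp add: mult.commute)
  qed
  have "rate a b \<rho> c d \<sigma> * rate c d \<sigma> e f \<tau> = (SUP s\<in>?B. rate a b \<rho> c d \<sigma> * ereal s)"
    unfolding rate_alt[of c d] by (rule SUP_ereal_mult_left[symmetric, OF ne(2) nn' rate_nonneg[OF \<rho> \<sigma>]])
  also have "\<dots> \<le> rate a b \<rho> e f \<tau>"
  proof (rule SUP_least)
    fix s assume s: "s \<in> ?B"
    have "rate a b \<rho> c d \<sigma> * ereal s = ereal s * (SUP r\<in>?A. ereal r)" by (simp only: rate_alt mult.commute)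
    also have "\<dots> = (SUP r\<in>?A. ereal s * ereal r)"
      by (rule SUP_ereal_mult_left[symmetric, OF ne(1) nn nn'[OF s]])
    also have "\<dots> \<le> rate a b \<rho> e f \<tau>" by (intro SUP_least prod s)
    finally show "rate a b \<rho> c d \<sigma> * ereal s \<le> rate a b \<rho> e f \<tau>" .
  qed
  finally show ?thesis .
qed

lemma achievable_swap:
  assumes \<rho>: "density (a*b) \<rho>" and \<sigma>: "density (c*d) \<sigma>" and r: "achievable a b \<rho> c d \<sigma> r"
  shows "achievable b a (swap_state a b \<rho>) d c (swap_state c d \<sigma>) r"
proof -
  note ab = density_dims[OF \<rho>] and cd = density_dims[OF \<sigma>]
  obtain \<Lambda> m where \<Lambda>: "\<And>n. LOCC (a^n) (b^n) (c^(m n)) (d^(m n)) (\<Lambda> n)"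
    and m: "(\<lambda>n. real (m n) / real n) \<longlonglongrightarrow> r"
    and t: "(\<lambda>n. trace_norm (\<Lambda> n (tpow a b \<rho> n) - tpow c d \<sigma> (m n))) \<longlonglongrightarrow> 0"
    using r unfolding achievable_def by blast
  have "\<forall>n. \<exists>D. LOCC (b^n) (a^n) (d^(m n)) (c^(m n)) D \<and>
      (\<forall>X\<in>carrier_mat (a^n * b^n) (a^n * b^n). D (swap_state (a^n) (b^n) X) = swap_state (c^(m n)) (d^(m n)) (\<Lambda> n X))"
    using LOCC_swap[OF \<Lambda>] by blast
  from choice[OF this] obtain D where D: "\<And>n. LOCC (b^n) (a^n) (d^(m n)) (c^(m n)) (D n)"
    "\<And>n X. X \<in> carrier_mat (a^n * b^n) (a^n * b^n) \<Longrightarrow> D n (swap_state (a^n) (b^n) X) = swap_state (c^(m n)) (d^(m n)) (\<Lambda> n X)"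
    by blast
  have bnd: "0 \<le> trace_norm (D n (tpow b a (swap_state a b \<rho>) n) - tpow d c (swap_state c d \<sigma>) (m n)) \<and>
      trace_norm (D n (tpow b a (swap_state a b \<rho>) n) - tpow d c (swap_state c d \<sigma>) (m n))
        \<le> trace_norm (\<Lambda> n (tpow a b \<rho> n) - tpow c d \<sigma> (m n))" for n
  proof -
    have p: "psd (c^(m n) * d^(m n)) (\<Lambda> n (tpow a b \<rho> n))" "psd (c^(m n) * d^(m n)) (tpow c d \<sigma> (m n))"
      by (rule density_psd[OF LOCC_density[OF \<Lambda> density_tpow[OF \<rho>]]], rule density_psd[OF density_tpow[OF \<sigma>]])
    have e: "D n (tpow b a (swap_state a b \<rho>) n) = swap_state (c^(m n)) (d^(m n)) (\<Lambda> n (tpow a b \<rho> n))"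
      "tpow d c (swap_state c d \<sigma>) (m n) = swap_state (c^(m n)) (d^(m n)) (tpow c d \<sigma> (m n))"
      unfolding swap_tpow[OF ab, symmetric] swap_tpow[OF cd, symmetric] by (simp_all add: D(2))
    show ?thesis unfolding e
      using trace_norm_channel[OF swap_channel p] trace_norm_nonneg[OF channel_psd[OF swap_channel p(1)] channel_psd[OF swap_channel p(2)]]
      by blast
  qed
  have "(\<lambda>n. trace_norm (D n (tpow b a (swap_state a b \<rho>) n) - tpow d c (swap_state c d \<sigma>) (m n))) \<longlonglongrightarrow> 0"
    by (rule tendsto_sandwich[OF _ _ tendsto_const t]) (use bnd in \<open>auto intro!: always_eventually\<close>)
  thus ?thesis unfolding achievable_def using D(1) m r
    by (intro conjI exI[of _ D] exI[of _ m]) (simp_all add: achievable_def)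
qed

lemma rate_swap:
  assumes "density (a*b) \<rho>" "density (c*d) \<sigma>"
  shows "rate a b \<rho> c d \<sigma> \<le> rate b a (swap_state a b \<rho>) d c (swap_state c d \<sigma>)"
  unfolding rate_alt[of a b] by (intro SUP_least achievable_le_rate achievable_swap[OF assms]) simp

lemma density_swap: "density (a*b) \<rho> \<Longrightarrow> density (b*a) (swap_state a b \<rho>)"
  using swap_channel[of a b] channel_psd[OF swap_channel, of a b \<rho>] channel_tr[OF swap_channel, of \<rho> a b]
  by (simp add: density_iff psd_iff)

section \<open>Finiteness of rates into entangled states\<close>

lemma psd_one_minus:
  assumes "density n \<tau>"
  shows "psd n (1\<^sub>m n - \<tau>)"
proof -
  have \<tau>: "\<tau> \<in> carrier_mat n n" "psdk n (ker \<tau>)" "tr n (ker \<tau>) = 1" using assms by (auto simp: density_iff)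
  have "psdk n (ker (1\<^sub>m n - \<tau>))"
    unfolding psdk_def
  proof
    fix v
    have "qf n (ker (1\<^sub>m n - \<tau>)) v = qf n (\<lambda>i j. (if i = j then 1 else 0) - ker \<tau> i j) v"
      using \<tau>(1) by (intro qf_cong refl) (simp add: ker_def)
    also have "\<dots> = qf n (\<lambda>i j. if i = j then 1 else 0) v - qf n (ker \<tau>) v" by (rule qf_diff)
    also have "qf n (\<lambda>i j. if i = j then 1 else 0) v = (\<Sum>i<n. \<Sum>j<n. if j = i then cnj (v i) * v i else 0)"
      unfolding qf_def by (intro sum.cong refl) auto
    also have "\<dots> = ip n v v" by (simp add: ip_def)
    finally have e: "qf n (ker (1\<^sub>m n - \<tau>)) v = complex_of_real (\<Sum>i<n. (cmod (v i))\<^sup>2) - qf n (ker \<tau>) v"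
      by (simp only: ip_self)
    show "0 \<le> qf n (ker (1\<^sub>m n - \<tau>)) v"
      unfolding e using psdk_qf_le[OF \<tau>(2), of v] psdk_Im[OF \<tau>(2), of v] \<tau>(3)
      by (simp add: less_eq_complex_def del: of_real_sum)
  qed
  thus ?thesis using \<tau>(1) by (simp add: psd_iff minus_carrier_mat)
qed

lemma psd_one: "psd n (1\<^sub>m n)"
proof -
  have "psdk n (ker (1\<^sub>m n))"
  proof (rule psdk_gramI[where K = "{..<n}" and v = "\<lambda>k i. if i = k then 1 else 0"])
    fix i j assume ij: "i < n" "j < n"
    have "(\<Sum>k<n. (if i = k then 1 else 0) * cnj (if j = k then 1 else (0::complex))) = (\<Sum>k<n. if k = i then (if i = j then 1 else 0) else 0)"
      by (intro sum.cong refl) auto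
    thus "ker (1\<^sub>m n) i j = (\<Sum>k<n. (if i = k then 1 else 0) * cnj (if j = k then 1 else (0::complex)))"
      using ij by (simp add: ker_def)
  qed
  thus ?thesis by (simp add: psd_iff)
qed

lemma kron_one: "kron (1\<^sub>m a) (1\<^sub>m b) = 1\<^sub>m (a*b)"
proof (rule eq_matI)
  fix r s assume "r < dim_row (1\<^sub>m (a*b) :: complex mat)" "s < dim_col (1\<^sub>m (a*b) :: complex mat)"
  hence rs: "r < a*b" "s < a*b" by auto
  have "kron (1\<^sub>m a) (1\<^sub>m b) $$ (r,s) = (if r div b = s div b then 1 else 0) * (if r mod b = s mod b then 1 else 0)"
    using rs index_div_less[OF rs(1)] index_mod_less[OF rs(1)] index_div_less[OF rs(2)] index_mod_less[OF rs(2)]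
    by (simp add: kron_entry[OF one_carrier_mat one_carrier_mat rs])
  also have "\<dots> = (1\<^sub>m (a*b)) $$ (r,s)" unfolding delta_div_mod using rs by simp
  finally show "kron (1\<^sub>m a) (1\<^sub>m b) $$ (r,s) = (1\<^sub>m (a*b)) $$ (r,s)" .
qed (simp_all add: kron_def)

theorem rate_to_entangled_finite:
  assumes \<rho>: "entangled a b \<rho>" and \<tau>: "density (c*d) \<tau>"
  shows "rate c d \<tau> a b \<rho> < \<infinity>"
proof -
  have \<rho>d: "density (a*b) \<rho>" using \<rho> by (simp add: entangled_def)
  obtain g C where g: "\<And>x. g x > 0" "\<And>x. \<bar>ln (g x)\<bar> \<le> C"
    and one: "\<And>A B. psdk a A \<Longrightarrow> psdk b B \<Longrightarrow>
      (\<Sum>x<a*a*4*(b*b*4). g x * (Re (qf a A (polA a b x)) * Re (qf b B (polB a b x)))) \<le> Re (tr a A) * Re (tr b B)"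
    and \<eta>: "product_povm.mean_log a b (a*a*4*(b*b*4)) (polA a b) (polB a b) g \<rho> > 0"
    using entangled_witness[OF \<rho>] by blast
  interpret product_povm a b "a*a*4*(b*b*4)" "polA a b" "polB a b"
    by (rule product_povm_pol[OF density_dims[OF \<rho>d]])
  let ?\<eta> = "mean_log g \<rho>" and ?D = "ln (real (c*d))"
  have "r * ?\<eta> \<le> ?D" if r: "achievable c d \<tau> a b \<rho> r" for r
  proof -
    obtain \<Lambda> m where \<Lambda>: "\<And>n. LOCC (c^n) (d^n) (a^(m n)) (b^(m n)) (\<Lambda> n)"
      and m: "(\<lambda>n. real (m n) / real n) \<longlonglongrightarrow> r"
      and t: "(\<lambda>n. trace_norm (\<Lambda> n (tpow c d \<tau> n) - tpow a b \<rho> (m n))) \<longlonglongrightarrow> 0"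
      using r unfolding achievable_def by blast
    let ?t = "\<lambda>n. trace_norm (\<Lambda> n (tpow c d \<tau> n) - tpow a b \<rho> (m n))"
    have main: "real (m n) * (?\<eta> - C * ?t n) \<le> real n * ?D" for n
    proof -
      let ?N = "c^n * d^n" and ?M = "a^(m n) * b^(m n)" and ?S = "\<Lambda> n (1\<^sub>m (c^n * d^n))"
      note ch = LOCC_channel[OF \<Lambda>, of n]
      have \<tau>n: "density ?N (tpow c d \<tau> n)" by (rule density_tpow[OF \<tau>])
      \<comment> \<open>The identity is a product operator, so its image under the protocol is in
        the separable cone.\<close>
      have S: "sepc (a^(m n)) (b^(m n)) ?S"
        by (rule LOCC_sepc[OF \<Lambda>]) (simp only: kron_one[symmetric] sepc_kron[OF psd_one psd_one])
      have "\<Lambda> n (1\<^sub>m ?N - tpow c d \<tau> n) = ?S - \<Lambda> n (tpow c d \<tau> n)"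
        by (rule channel_diff[OF ch]) simp_all
      hence le: "psd ?M (?S - \<Lambda> n (tpow c d \<tau> n))"
        using channel_psd[OF ch psd_one_minus[OF \<tau>n]] by simp
      have "real (m n) * (?\<eta> - C * ?t n) \<le> ln (Re (tr ?M (ker ?S)))"
        by (rule entanglement_bound[OF g one \<rho>d LOCC_density[OF \<Lambda> \<tau>n] S le])
      also have "tr ?M (ker ?S) = complex_of_real (real ?N)"
        unfolding channel_tr[OF ch one_carrier_mat] by (simp add: tr_def ker_def)
      also have "ln (Re (complex_of_real (real ?N))) = real n * ?D"
        using density_dims[OF \<tau>] by (simp add: power_mult_distrib[symmetric] ln_realpow)
      finally show ?thesis .
    qed
    \<comment> \<open>After division by n the error term is a convergent factor times a null
      sequence, so only \<eta> survives in the limit.\<close>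
    have "(\<lambda>n. real (m n) / real n * (?\<eta> - C * ?t n)) \<longlonglongrightarrow> r * (?\<eta> - C * 0)"
      by (intro tendsto_intros m t)
    moreover have "real (m n) / real n * (?\<eta> - C * ?t n) \<le> ?D" if "n \<ge> 1" for n
    proof -
      have "real (m n) * (?\<eta> - C * ?t n) / real n \<le> real n * ?D / real n"
        by (intro divide_right_mono main) simp
      thus ?thesis using that by simp
    qed
    ultimately have "r * (?\<eta> - C * 0) \<le> ?D" by (intro LIMSEQ_le_const2) auto
    thus ?thesis by simp
  qed
  hence "rate c d \<tau> a b \<rho> \<le> ereal (?D / ?\<eta>)"
    unfolding rate_alt using \<eta> by (intro SUP_least) (simp add: pos_le_divide_eq)
  thus ?thesis by (rule order.strict_trans1) simp
qed

lemma rate_self_le_one: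
  assumes \<rho>: "entangled a b \<rho>"
  shows "rate a b \<rho> a b \<rho> \<le> 1"
proof -
  have \<rho>d: "density (a*b) \<rho>" using \<rho> by (simp add: entangled_def)
  have "rate a b \<rho> a b \<rho> < \<infinity>" by (rule rate_to_entangled_finite[OF \<rho> \<rho>d])
  moreover have "0 \<le> rate a b \<rho> a b \<rho>" by (rule rate_nonneg[OF \<rho>d \<rho>d])
  ultimately obtain x where x: "rate a b \<rho> a b \<rho> = ereal x" "x \<ge> 0"
    by (cases "rate a b \<rho> a b \<rho>") auto
  have "x * x \<le> x" using rate_compose[OF \<rho>d \<rho>d \<rho>d] x by simp
  hence "x \<le> 1" using x(2) by (cases "x = 0") (simp_all add: mult_le_cancel_left)
  thus ?thesis using x by simp
qed

theorem sym_ent_le_one: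
  assumes \<rho>: "entangled a b \<rho>"
  shows "sym_ent a b \<rho> \<le> 1"
proof (rule ccontr)
  let ?V = "swap_state a b \<rho>" and ?S = "sym_ent a b \<rho>"
  assume h: "\<not> ?thesis"
  have \<rho>d: "density (a*b) \<rho>" using \<rho> by (simp add: entangled_def)
  have Vd: "density (b*a) ?V" by (rule density_swap[OF \<rho>d])
  have vv: "swap_state b a ?V = \<rho>" using \<rho>d by (intro swap_swap) (simp add: density_iff)
  have "?S \<le> rate b a ?V a b \<rho>" unfolding sym_ent_def using rate_swap[OF \<rho>d Vd] vv by simp
  moreover have "1 < ?S" using h by simp
  moreover have "0 \<le> ?S" unfolding sym_ent_def by (rule rate_nonneg[OF \<rho>d Vd])
  ultimately have "?S * ?S \<le> ?S * rate b a ?V a b \<rho>" by (intro ereal_mult_left_mono)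
  also have "\<dots> \<le> rate a b \<rho> a b \<rho>" unfolding sym_ent_def by (rule rate_compose[OF \<rho>d Vd \<rho>d])
  also have "\<dots> \<le> 1" by (rule rate_self_le_one[OF \<rho>])
  finally have "?S * ?S \<le> 1" .
  \<comment> \<open>Strict monotonicity of the product in the extended reals, which covers an
    infinite \<open>?S\<close> as well.\<close>
  moreover have "1 < ?S * ?S" using \<open>1 < ?S\<close> ereal_mult_mono_strict'[of 1 1 ?S ?S] by simp
  ultimately show False by simp
qed

section \<open>Preparing states from maximally entangled states\<close>

text \<open>The Walsh characters of the dimension \<open>2 ^ n\<close> replace the phase operators of teleportation.\<close>

primrec wal :: "nat \<Rightarrow> nat \<Rightarrow> nat \<Rightarrow> complex" where
  "wal 0 c p = 1"
| "wal (Suc n) c p = (if odd c \<and> odd p then - 1 else 1) * wal n (c div 2) (p div 2)"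

lemma wal_square: "wal n c p * wal n c p = 1"
  by (induction n arbitrary: c p) (auto simp: algebra_simps)

lemma wal_cnj: "cnj (wal n c p) = wal n c p"
  by (induction n arbitrary: c p) auto

lemma wal_orthogonal:
  "p < 2^n \<Longrightarrow> q < 2^n \<Longrightarrow> (\<Sum>c<2^n. wal n c p * wal n c q) = (if p = q then 2^n else 0)"
proof (induction n arbitrary: p q)
  case (Suc n)
  let ?s = "\<lambda>(c::nat) (p::nat). if odd c \<and> odd p then - 1 else (1::complex)"
  have two: "(\<Sum>c<2. F c) = F 0 + F (1::nat)" for F :: "nat \<Rightarrow> complex" by (simp add: numeral_2_eq_2)
  have "(\<Sum>c<2^Suc n. wal (Suc n) c p * wal (Suc n) c q)
    = (\<Sum>c<2^n*2. (wal n (c div 2) (p div 2) * wal n (c div 2) (q div 2)) * (?s (c mod 2) p * ?s (c mod 2) q))"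
    unfolding power_Suc2 by (intro sum.cong refl) (simp add: mult_ac)
  also have "\<dots> = (\<Sum>c'<2^n. \<Sum>c0<2. (wal n c' (p div 2) * wal n c' (q div 2)) * (?s c0 p * ?s c0 q))"
    unfolding sum_prod_index by (intro sum.cong refl) auto
  also have "\<dots> = (\<Sum>c'<2^n. wal n c' (p div 2) * wal n c' (q div 2)) * (\<Sum>c0<2. ?s c0 p * ?s c0 q)"
    by (rule sum_product[symmetric])
  also have "(\<Sum>c'<2^n. wal n c' (p div 2) * wal n c' (q div 2)) = (if p div 2 = q div 2 then 2^n else 0)"
    using Suc.prems by (intro Suc.IH) auto
  also have "(\<Sum>c0<2. ?s c0 p * ?s c0 q) = (if p mod 2 = q mod 2 then 2 else 0)"
    unfolding two by (simp add: mod2_eq_if)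
  also have "(if p div 2 = q div 2 then 2^n else 0) * (if p mod 2 = q mod 2 then 2 else 0) = (if p = q then 2^Suc n else (0::complex))"
    unfolding div_mod_eq_iff[of p 2 q, symmetric] by simp
  finally show ?case .
qed simp

text \<open>Addition modulo d for arguments below d, written as a case distinction over linear
  arithmetic.\<close>

definition shift :: "nat \<Rightarrow> nat \<Rightarrow> nat \<Rightarrow> nat" where
  "shift d k p = (if p + k < d then p + k else p + k - d)"

lemma shift_less: "p < d \<Longrightarrow> k < d \<Longrightarrow> shift d k p < d"
  by (auto simp: shift_def)

lemma shift_inj: "p < d \<Longrightarrow> q < d \<Longrightarrow> shift d k p = shift d k q \<longleftrightarrow> p = q"
  by (auto simp: shift_def)

lemma sum_shift: "k < d \<Longrightarrow> (\<Sum>p<d. F (shift d k p)) = (\<Sum>p<d. F p)"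
  by (rule sum.reindex_bij_witness[where j = "shift d k" and i = "\<lambda>j. if k \<le> j then j - k else j + d - k"])
    (auto simp: shift_def)

lemma shift_commute: "shift d k p = shift d p k"
  by (simp add: shift_def add.commute)

lemma sum_shift': "p < d \<Longrightarrow> (\<Sum>k<d. F (shift d k p)) = (\<Sum>k<d. F k)"
  using sum_shift[of p d F] by (simp add: shift_commute)

text \<open>The maximally entangled state of local dimension d.\<close>

definition phi :: "nat \<Rightarrow> complex mat" where
  "phi d = mat (d*d) (d*d) (\<lambda>(r,s). if r div d = r mod d \<and> s div d = s mod d then 1 / of_nat d else 0)"

lemma phi_carrier: "phi d \<in> carrier_mat (d*d) (d*d)"
  by (simp add: phi_def)

text \<open>Up to the factor 1 / d, \<open>phi d\<close> is the rank-one operator of the sum of the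
  vectors |kk>. The local operators A and B turn that vector into the list of entries of A times the
  transpose of B.\<close>

lemma cj_kron_phi:
  assumes A: "A \<in> carrier_mat m d" and B: "B \<in> carrier_mat p d" and r: "r < m*p" and s: "s < m*p"
  shows "cj (kron A B) (phi d) $$ (r,s)
    = (\<Sum>k<d. A $$ (r div p,k) * B $$ (r mod p,k)) * cnj (\<Sum>k<d. A $$ (s div p,k) * B $$ (s mod p,k)) / of_nat d"
proof -
  have y: "(\<Sum>i<d*d. kron A B $$ (r,i) * (if i div d = i mod d then 1 else 0)) = (\<Sum>k<d. A $$ (r div p,k) * B $$ (r mod p,k))"
    if r: "r < m*p" for r
  proof -
    have "(\<Sum>i<d*d. kron A B $$ (r,i) * (if i div d = i mod d then 1 else 0))
      = (\<Sum>i<d*d. A $$ (r div p, i div d) * B $$ (r mod p, i mod d) * (if i div d = i mod d then 1 else 0))"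
      by (intro sum.cong refl) (simp add: kron_entry[OF A B r])
    also have "\<dots> = (\<Sum>i<d. \<Sum>j<d. if j = i then A $$ (r div p, i) * B $$ (r mod p, i) else 0)"
      unfolding sum_prod_index by (intro sum.cong refl) auto
    finally show ?thesis by simp
  qed
  let ?d = "\<lambda>i. if i div d = i mod d then 1 else (0::complex)"
  have "cj (kron A B) (phi d) $$ (r,s)
    = (\<Sum>i<d*d. \<Sum>j<d*d. kron A B $$ (r,i) * phi d $$ (i,j) * cnj (kron A B $$ (s,j)))"
    by (rule cj_entry[OF kron_carrier[OF A B] phi_carrier r s])
  also have "\<dots> = (\<Sum>i<d*d. \<Sum>j<d*d. (kron A B $$ (r,i) * ?d i) * cnj (kron A B $$ (s,j) * ?d j) / of_nat d)"
    by (intro sum.cong refl) (auto simp: phi_def)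
  also have "\<dots> = (\<Sum>i<d*d. kron A B $$ (r,i) * ?d i) * cnj (\<Sum>j<d*d. kron A B $$ (s,j) * ?d j) / of_nat d"
    by (simp only: sum_divide_distrib cnj_sum sum_product)
  finally show ?thesis by (simp only: y[OF r] y[OF s])
qed

lemma cj_cj:
  assumes "F \<in> carrier_mat m n" "G \<in> carrier_mat n p" "X \<in> carrier_mat p p"
  shows "cj F (cj G X) = cj (F * G) X"
proof (rule eq_matI)
  have FG: "F * G \<in> carrier_mat m p" using assms by simp
  fix r s assume "r < dim_row (cj (F * G) X)" "s < dim_col (cj (F * G) X)"
  hence rs: "r < m" "s < m" using cj_carrier[OF FG assms(3)] by auto
  have "cj F (cj G X) $$ (r,s)
    = (\<Sum>i<n. \<Sum>j<n. \<Sum>k<p. \<Sum>l<p. (F $$ (r,i) * G $$ (i,k)) * X $$ (k,l) * cnj (F $$ (s,j) * G $$ (j,l)))"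
    unfolding cj_entry[OF assms(1) cj_carrier[OF assms(2,3)] rs]
    by (intro sum.cong refl) (simp add: cj_entry[OF assms(2,3)] sum_distrib_left sum_distrib_right mult_ac)
  also have "\<dots> = (\<Sum>i<n. \<Sum>k<p. \<Sum>j<n. \<Sum>l<p. (F $$ (r,i) * G $$ (i,k)) * X $$ (k,l) * cnj (F $$ (s,j) * G $$ (j,l)))"
    by (intro sum.cong refl sum.swap)
  also have "\<dots> = (\<Sum>k<p. \<Sum>i<n. \<Sum>j<n. \<Sum>l<p. (F $$ (r,i) * G $$ (i,k)) * X $$ (k,l) * cnj (F $$ (s,j) * G $$ (j,l)))"
    by (rule sum.swap)
  also have "\<dots> = (\<Sum>k<p. \<Sum>i<n. \<Sum>l<p. \<Sum>j<n. (F $$ (r,i) * G $$ (i,k)) * X $$ (k,l) * cnj (F $$ (s,j) * G $$ (j,l)))"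
    by (intro sum.cong refl sum.swap)
  also have "\<dots> = (\<Sum>k<p. \<Sum>l<p. \<Sum>i<n. \<Sum>j<n. (F $$ (r,i) * G $$ (i,k)) * X $$ (k,l) * cnj (F $$ (s,j) * G $$ (j,l)))"
    by (intro sum.cong refl sum.swap)
  also have "\<dots> = (\<Sum>k<p. \<Sum>l<p. (F * G) $$ (r,k) * X $$ (k,l) * cnj ((F * G) $$ (s,l)))"
  proof (intro sum.cong refl)
    fix k l assume "k \<in> {..<p}" "l \<in> {..<p}"
    hence kl: "k < p" "l < p" by auto
    show "(\<Sum>i<n. \<Sum>j<n. (F $$ (r,i) * G $$ (i,k)) * X $$ (k,l) * cnj (F $$ (s,j) * G $$ (j,l)))
      = (F * G) $$ (r,k) * X $$ (k,l) * cnj ((F * G) $$ (s,l))"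
      unfolding mult_entry[OF assms(1,2) rs(1) kl(1)] mult_entry[OF assms(1,2) rs(2) kl(2)] cnj_sum sum_distrib_right
      unfolding sum_distrib_left ..
  qed
  also have "\<dots> = cj (F * G) X $$ (r,s)" by (rule cj_entry[OF FG assms(3) rs, symmetric])
  finally show "cj F (cj G X) $$ (r,s) = cj (F * G) X $$ (r,s)" .
qed (use assms in \<open>auto simp: cj_def adj_def\<close>)


text \<open>Write \<open>\<sigma>\<close> as a sum of rank-one operators given by \<open>A\<close>-by-\<open>B\<close> matrices \<open>M l\<close>. Alice applies \<open>M l\<close> after a
  random shift and sign change, which Bob undoes on his side of the maximally entangled state. His
  remaining operators \<open>T t\<close> with \<open>t > 0\<close> only complete the truncation to dimension \<open>B\<close> to an instrument.\<close>

theorem teleportation: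
  assumes \<sigma>: "density (A*B) \<sigma>" and B: "B \<le> 2^n"
  shows "\<exists>L. LOCC (2^n) (2^n) A B L \<and> L (phi (2^n)) = \<sigma>"
proof -
  define d where "d = (2::nat)^n"
  have d0: "d > 0" and Bd: "B \<le> d" using B by (simp_all add: d_def)
  have B0: "B > 0" by (rule density_dims(2)[OF \<sigma>])
  have \<sigma>c: "\<sigma> \<in> carrier_mat (A*B) (A*B)" and \<sigma>p: "psdk (A*B) (ker \<sigma>)" and \<sigma>1: "tr (A*B) (ker \<sigma>) = 1"
    using \<sigma> by (auto simp: density_iff)
  obtain v where v: "gram (A*B) (ker \<sigma>) v" using psdk_gram[OF \<sigma>p] by blast
  \<comment> \<open>The l-th Gram vector of \<sigma>, reshaped into a matrix and padded with zero
    columns up to dimension d.\<close>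
  define M where "M l i j = (if j < B then v l (i*B+j) else 0)" for l i j
  define W where "W s c q = wal n c (shift d s q)" for s c q
  have Wsq: "W s c q * W s c q = 1" for s c q by (simp add: W_def wal_square)
  have Wc: "cnj (W s c q) = W s c q" for s c q by (simp add: W_def wal_cnj)
  have Worth: "(\<Sum>c<d. W s c p * W s c q) = (if p = q then of_nat d else 0)" if "s < d" "p < d" "q < d" for s p q
    using wal_orthogonal[of "shift d s p" n "shift d s q"] shift_less[of p d s] shift_less[of q d s] shift_inj[of p d q s] that
    by (simp add: W_def d_def)
  \<comment> \<open>Its square cancels the factor d that the sum over the d sign patterns produces
    in the completeness relation.\<close>
  define \<kappa> where "\<kappa> = complex_of_real (1 / sqrt (real d))"
  have \<kappa>: "cnj \<kappa> = \<kappa>" by (simp add: \<kappa>_def)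
  have \<kappa>2: "\<kappa> * \<kappa> = 1 / of_nat d"
    unfolding \<kappa>_def of_real_mult[symmetric] by simp
  define K where "K l s c = mat A d (\<lambda>(i,q). \<kappa> * M l i (shift d s q) * W s c q)" for l s c
  \<comment> \<open>\<open>T 0\<close> truncates to the first B coordinates. For t \<ge> B,
    \<open>T t\<close> sends basis vector t to index 0, so no discarded coordinate is lost; for 0 <
    t < B it vanishes.\<close>
  define T where "T t j p = (if (if t = 0 then j = p else j = 0 \<and> p = t \<and> B \<le> t) then 1 else (0::complex))" for t j p :: nat
  define K' where "K' s c t = mat B d (\<lambda>(j,q). T t j (shift d s q) * W s c q)" for s c t
  have Kc: "K l s c \<in> carrier_mat A d" for l s c by (simp add: K_def)
  have K'c: "K' s c t \<in> carrier_mat B d" for s c t by (simp add: K'_def)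
  have Ke: "K l s c $$ (i,q) = \<kappa> * M l i (shift d s q) * W s c q" if "i < A" "q < d" for l s c i q
    using that by (simp add: K_def)
  have K'e: "K' s c t $$ (j,q) = T t j (shift d s q) * W s c q" if "j < B" "q < d" for s c t j q
    using that by (simp add: K'_def)
  have total: "(\<Sum>l<A*B. \<Sum>i<A. \<Sum>j<d. cnj (M l i j) * M l i j) = 1"
  proof -
    have "(\<Sum>j<d. cnj (M l i j) * M l i j) = (\<Sum>j<B. v l (i*B+j) * cnj (v l (i*B+j)))" for l i
      using Bd by (intro sum.mono_neutral_cong_right) (auto simp: M_def)
    hence "(\<Sum>l<A*B. \<Sum>i<A. \<Sum>j<d. cnj (M l i j) * M l i j) = (\<Sum>l<A*B. \<Sum>r<A*B. v l r * cnj (v l r))"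
      by (simp only: sum_prod_index[of "\<lambda>r. v _ r * cnj (v _ r)" A B])
    also have "\<dots> = (\<Sum>r<A*B. \<Sum>l<A*B. v l r * cnj (v l r))" by (rule sum.swap)
    also have "\<dots> = tr (A*B) (ker \<sigma>)"
      unfolding tr_def by (intro sum.cong refl) (simp add: gramD[OF v])
    finally show ?thesis using \<sigma>1 by simp
  qed
  \<comment> \<open>The outcome k encodes the triple (l, s, c) of Gram vector, shift and sign
    pattern in mixed radix.\<close>
  have alice: "complete_kraus (A*B*d*d) A d (\<lambda>k. K (k div d div d) (k div d mod d) (k mod d))"
    unfolding complete_kraus_def
  proof (intro conjI allI impI)
    fix q q' assume q: "q < d" "q' < d"
    have "(\<Sum>k<A*B*d*d. (adj (K (k div d div d) (k div d mod d) (k mod d)) * K (k div d div d) (k div d mod d) (k mod d)) $$ (q,q'))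
      = (\<Sum>l<A*B. \<Sum>s<d. \<Sum>c<d. (adj (K l s c) * K l s c) $$ (q,q'))"
      unfolding sum_prod_index[of _ _ d] by (intro sum.cong refl) auto
    also have "\<dots> = (\<Sum>l<A*B. \<Sum>s<d. \<Sum>c<d. \<Sum>i<A. (\<kappa> * \<kappa> * (cnj (M l i (shift d s q)) * M l i (shift d s q'))) * (W s c q * W s c q'))"
    proof (intro sum.cong refl)
      fix l s c
      show "(adj (K l s c) * K l s c) $$ (q,q') = (\<Sum>i<A. (\<kappa> * \<kappa> * (cnj (M l i (shift d s q)) * M l i (shift d s q'))) * (W s c q * W s c q'))"
        unfolding mult_entry[OF adj_carrier[OF Kc] Kc q]
        using q by (intro sum.cong refl) (simp add: adj_entry[OF Kc] Ke \<kappa> Wc mult_ac)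
    qed
    also have "\<dots> = (\<Sum>l<A*B. \<Sum>s<d. \<Sum>i<A. \<Sum>c<d. (\<kappa> * \<kappa> * (cnj (M l i (shift d s q)) * M l i (shift d s q'))) * (W s c q * W s c q'))"
      by (intro sum.cong refl sum.swap)
    also have "\<dots> = (\<Sum>l<A*B. \<Sum>s<d. \<Sum>i<A. if q = q' then cnj (M l i (shift d s q)) * M l i (shift d s q) else 0)"
    proof (intro sum.cong refl)
      fix l s i assume "s \<in> {..<d}"
      hence "(\<Sum>c<d. W s c q * W s c q') = (if q = q' then of_nat d else 0)" using Worth q by simp
      thus "(\<Sum>c<d. (\<kappa> * \<kappa> * (cnj (M l i (shift d s q)) * M l i (shift d s q'))) * (W s c q * W s c q'))
        = (if q = q' then cnj (M l i (shift d s q)) * M l i (shift d s q) else 0)"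
        unfolding sum_distrib_left[symmetric] \<kappa>2 using d0 by simp
    qed
    also have "\<dots> = (if q = q' then 1 else 0)"
    proof (cases "q = q'")
      case True
      have "(\<Sum>l<A*B. \<Sum>s<d. \<Sum>i<A. cnj (M l i (shift d s q)) * M l i (shift d s q))
        = (\<Sum>l<A*B. \<Sum>i<A. \<Sum>s<d. cnj (M l i (shift d s q)) * M l i (shift d s q))"
        by (intro sum.cong refl sum.swap)
      also have "\<dots> = (\<Sum>l<A*B. \<Sum>i<A. \<Sum>j<d. cnj (M l i j) * M l i j)"
        by (intro sum.cong refl sum_shift'[OF q(1)])
      finally show ?thesis using total True by simp
    qed simp
    finally show "(\<Sum>k<A*B*d*d. (adj (K (k div d div d) (k div d mod d) (k mod d)) * K (k div d div d) (k div d mod d) (k mod d)) $$ (q,q'))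
      = (if q = q' then 1 else 0)" .
  qed (simp add: Kc)
  have Torth: "(\<Sum>t<d. \<Sum>j<B. T t j p * T t j p') = (if p = p' then 1 else 0)" if p: "p < d" "p' < d" for p p'
  proof -
    have "(\<Sum>j<B. T t j p * T t j p') = (if t = (if p < B then 0 else p) then (if p = p' then 1 else 0) else 0)" for t
    proof (cases "t = 0")
      case True
      have "(\<Sum>j<B. T t j p * T t j p') = (\<Sum>j<B. if j = p then (if p = p' then 1 else 0) else 0)"
        by (intro sum.cong refl) (auto simp: T_def True)
      thus ?thesis using True B0 by auto
    next
      case False
      have "(\<Sum>j<B. T t j p * T t j p') = (\<Sum>j<B. if j = 0 then (if p = t \<and> p' = t \<and> B \<le> t then 1 else 0) else 0)"
        using False by (intro sum.cong refl) (auto simp: T_def)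
      thus ?thesis using False B0 by auto
    qed
    thus ?thesis using p d0 by simp
  qed
  have bob: "complete_kraus d B d (K' s c)" if s: "s < d" for s c
    unfolding complete_kraus_def
  proof (intro conjI allI impI)
    fix q q' assume q: "q < d" "q' < d"
    have "(\<Sum>t<d. (adj (K' s c t) * K' s c t) $$ (q,q'))
      = (\<Sum>t<d. \<Sum>j<B. (W s c q * W s c q') * (T t j (shift d s q) * T t j (shift d s q')))"
    proof (intro sum.cong refl)
      fix t
      have Tc: "cnj (T t j p) = T t j p" for j p by (simp add: T_def)
      show "(adj (K' s c t) * K' s c t) $$ (q,q') = (\<Sum>j<B. (W s c q * W s c q') * (T t j (shift d s q) * T t j (shift d s q')))"
        unfolding mult_entry[OF adj_carrier[OF K'c] K'c q]
        using q by (intro sum.cong refl) (simp add: adj_entry[OF K'c] K'e Wc Tc mult_ac)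
    qed
    also have "\<dots> = (W s c q * W s c q') * (if shift d s q = shift d s q' then 1 else 0)"
      unfolding sum_distrib_left[symmetric] Torth[OF shift_less[OF q(1) s] shift_less[OF q(2) s]] ..
    also have "\<dots> = (if q = q' then 1 else 0)"
      using shift_inj[OF q, of s] Wsq by auto
    finally show "(\<Sum>t<d. (adj (K' s c t) * K' s c t) $$ (q,q')) = (if q = q' then 1 else 0)" .
  qed (simp add: K'c)
  \<comment> \<open>The equal signs of both parties square to 1, and the common shift disappears by
    reindexing. Outcomes t > 0 meet only zero columns of M. Every pair (s, c) yields the same
    rank-one term with weight 1 / d^2, and there are d^2 pairs.\<close>
  have res: "cj (kron (1\<^sub>m A) (K' s c t)) (cj (kron (K l s c) (1\<^sub>m d)) (phi d)) $$ (r,r')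
      = (if t = 0 then v l r * cnj (v l r') / (of_nat d * of_nat d) else 0)"
    if s: "s < d" and r: "r < A*B" "r' < A*B" and t: "t < d" for l s c t r r'
  proof -
    have y: "(\<Sum>k<d. K l s c $$ (r div B,k) * K' s c t $$ (r mod B,k)) = (if t = 0 then \<kappa> * v l r else 0)"
      if r: "r < A*B" for r
    proof -
      note rr = index_div_less[OF r] index_mod_less[OF r]
      have "(\<Sum>k<d. K l s c $$ (r div B,k) * K' s c t $$ (r mod B,k))
        = (\<Sum>k<d. \<kappa> * (M l (r div B) (shift d s k) * T t (r mod B) (shift d s k)))"
      proof (intro sum.cong refl)
        fix k assume "k \<in> {..<d}"
        hence "K l s c $$ (r div B,k) * K' s c t $$ (r mod B,k)
          = \<kappa> * (M l (r div B) (shift d s k) * T t (r mod B) (shift d s k)) * (W s c k * W s c k)"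
          using rr by (simp add: K_def K'_def mult_ac)
        thus "K l s c $$ (r div B,k) * K' s c t $$ (r mod B,k) = \<kappa> * (M l (r div B) (shift d s k) * T t (r mod B) (shift d s k))"
          by (simp only: Wsq mult_1_right)
      qed
      also have "\<dots> = (\<Sum>k<d. \<kappa> * (M l (r div B) k * T t (r mod B) k))" by (rule sum_shift[OF s])
      also have "\<dots> = (\<Sum>k<d. if k = r mod B then (if t = 0 then \<kappa> * v l r else 0) else 0)"
        using rr(2) by (intro sum.cong refl) (auto simp: M_def T_def)
      also have "\<dots> = (if t = 0 then \<kappa> * v l r else 0)" using rr(2) Bd by simp
      finally show ?thesis .
    qed
    have "cj (kron (1\<^sub>m A) (K' s c t)) (cj (kron (K l s c) (1\<^sub>m d)) (phi d)) = cj (kron (K l s c) (K' s c t)) (phi d)"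
      by (subst cj_cj[OF kron_carrier[OF one_carrier_mat K'c] kron_carrier[OF Kc one_carrier_mat] phi_carrier],
          subst kron_mult[OF one_carrier_mat K'c Kc one_carrier_mat])
        (simp add: left_mult_one_mat[OF Kc] right_mult_one_mat[OF K'c])
    hence "cj (kron (1\<^sub>m A) (K' s c t)) (cj (kron (K l s c) (1\<^sub>m d)) (phi d)) $$ (r,r')
      = (if t = 0 then \<kappa> * v l r else 0) * cnj (if t = 0 then \<kappa> * v l r' else 0) / of_nat d"
      by (simp only: cj_kron_phi[OF Kc K'c r] y[OF r(1)] y[OF r(2)])
    also have "\<dots> = (if t = 0 then (\<kappa> * \<kappa>) * (v l r * cnj (v l r')) / of_nat d else 0)"
      by (simp add: \<kappa> mult_ac)
    finally show ?thesis by (simp add: \<kappa>2)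
  qed
  define L where "L X = lcomb (A*B) (A*B*d*d) (\<lambda>_. 1) (\<lambda>k. lcomb (A*B) d (\<lambda>_. 1)
     (\<lambda>t. cj (kron (1\<^sub>m A) (K' (k div d mod d) (k mod d) t)) (cj (kron (K (k div d div d) (k div d mod d) (k mod d)) (1\<^sub>m d)) X)))" for X
  have "LOCC d d A B L"
    unfolding L_def[abs_def]
    by (rule LOCC_Alice'[OF alice, where L = "\<lambda>k Y. lcomb (A*B) d (\<lambda>_. 1) (\<lambda>t. cj (kron (1\<^sub>m A) (K' (k div d mod d) (k mod d) t)) Y)"])
      (rule LOCC_Bob'[OF bob LOCC_id], use d0 in simp)
  moreover have "L (phi d) = \<sigma>"
  proof (rule eq_matI)
    fix r r' assume "r < dim_row \<sigma>" "r' < dim_col \<sigma>"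
    hence r: "r < A*B" "r' < A*B" using \<sigma>c by auto
    have "L (phi d) $$ (r,r') = (\<Sum>k<A*B*d*d. \<Sum>t<d.
        cj (kron (1\<^sub>m A) (K' (k div d mod d) (k mod d) t)) (cj (kron (K (k div d div d) (k div d mod d) (k mod d)) (1\<^sub>m d)) (phi d)) $$ (r,r'))"
      by (simp only: L_def lcomb_entry[OF r] mult_1)
    also have "\<dots> = (\<Sum>k<A*B*d*d. \<Sum>t<d. if t = 0 then v (k div d div d) r * cnj (v (k div d div d) r') / (of_nat d * of_nat d) else 0)"
      using d0 by (intro sum.cong refl res r) auto
    also have "\<dots> = (\<Sum>k<A*B*d*d. v (k div d div d) r * cnj (v (k div d div d) r') / (of_nat d * of_nat d))"
      using d0 by simp
    also have "\<dots> = (\<Sum>l<A*B. \<Sum>s<d. \<Sum>c<d. v l r * cnj (v l r') / (of_nat d * of_nat d))"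
      unfolding sum_prod_index[of _ _ d] by (intro sum.cong refl) auto
    also have "\<dots> = (\<Sum>l<A*B. v l r * cnj (v l r'))" using d0 by simp
    also have "\<dots> = \<sigma> $$ (r,r')" using gramD[OF v r] by (simp add: ker_def)
    finally show "L (phi d) $$ (r,r') = \<sigma> $$ (r,r')" .
  qed (use \<sigma>c in \<open>auto simp: L_def lcomb_def\<close>)
  ultimately show ?thesis unfolding d_def by blast
qed

section \<open>Rates of the maximally entangled state\<close>

lemma psi_plus_carrier: "psi_plus \<in> carrier_mat 4 4"
  by (simp add: psi_plus_def)

lemma density_psi_plus: "density (2*2) psi_plus"
proof -
  define v where "v i = (if i = 0 \<or> i = (3::nat) then complex_of_real (1 / sqrt 2) else 0)" for i
  have h: "complex_of_real (1 / sqrt 2) * complex_of_real (1 / sqrt 2) = 1 / 2"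
    unfolding of_real_mult[symmetric] by (simp add: field_simps)
  have e: "ker psi_plus i j = v i * cnj (v j)" if "i < 4" "j < 4" for i j
    using that h by (auto simp: ker_def psi_plus_def v_def)
  have "psdk 4 (ker psi_plus) = psdk 4 (\<lambda>i j. v i * cnj (v j))" by (rule psdk_cong) (rule e)
  hence "psdk 4 (ker psi_plus)" using psdk_rank1 by simp
  moreover have "tr 4 (ker psi_plus) = 1"
    unfolding tr_def sum_lessThan_4 by (simp add: ker_def psi_plus_def)
  ultimately show ?thesis using psi_plus_carrier by (simp add: density_iff)
qed

lemma swap_psi_plus: "swap_state 2 2 psi_plus = psi_plus"
proof (rule eq_matI)
  fix r s assume "r < dim_row psi_plus" "s < dim_col psi_plus"
  hence rs: "r < 2*2" "s < 2*2" using psi_plus_carrier by auto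
  have "sw 2 2 r \<in> {0,3} \<longleftrightarrow> r \<in> {0,3}" if "r < 2*2" for r
  proof -
    have "r = 0 \<or> r = 1 \<or> r = 2 \<or> r = 3" using that by auto
    thus ?thesis by (auto simp: sw_def)
  qed
  thus "swap_state 2 2 psi_plus $$ (r,s) = psi_plus $$ (r,s)"
    using rs sw_less[OF rs(1)] sw_less[OF rs(2)] unfolding swap_state_entry[OF rs] psi_plus_def by simp
qed (use psi_plus_carrier in \<open>auto simp: swap_state_def\<close>)

lemma tpow_psi_plus: "tpow 2 2 psi_plus n = phi (2^n)"
proof (rule eq_matI)
  fix r s assume "r < dim_row (phi (2^n))" "s < dim_col (phi (2^n))"
  hence "r < 2^n * 2^n" "s < 2^n * 2^n" by (simp_all add: phi_def)
  moreover have "tpow 2 2 psi_plus n $$ (r,s) = (if r div 2^n = r mod 2^n \<and> s div 2^n = s mod 2^n then 1 / of_nat (2^n) else 0)"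
    if "r < 2^n * 2^n" "s < 2^n * 2^n" for r s using that
  proof (induction n arbitrary: r s)
    case 0
    thus ?case by (simp add: tpow_0_entry)
  next
    case (Suc m)
    note r = Suc.prems(1) and s = Suc.prems(2)
    \<comment> \<open>0 and 3 are the indices of |00> and |11>, so the membership says that the
      lowest digits of both parties agree.\<close>
    have eq: "lo 2 2 m r \<in> {0,3} \<and> hi 2 2 m r div 2^m = hi 2 2 m r mod 2^m \<longleftrightarrow> r div 2^Suc m = r mod 2^Suc m"
      if r: "r < 2^Suc m * 2^Suc m" for r
    proof -
      let ?i = "r div 2^Suc m" and ?j = "r mod 2^Suc m"
      have "lo 2 2 m r = ?i mod 2 * 2 + ?j mod 2" by (simp only: lo_def)
      moreover have "?i mod 2 = 0 \<or> ?i mod 2 = 1" "?j mod 2 = 0 \<or> ?j mod 2 = 1" by auto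
      ultimately have "lo 2 2 m r \<in> {0,3} \<longleftrightarrow> ?i mod 2 = ?j mod 2" by auto
      thus ?thesis unfolding hi_div[OF r] hi_mod[OF r] using div_mod_eq_iff[of ?i 2 ?j] by blast
    qed
    have l: "lo 2 2 m r < 4" "lo 2 2 m s < 4" using lo_less[OF r] lo_less[OF s] by simp_all
    have "tpow 2 2 psi_plus (Suc m) $$ (r,s) = psi_plus $$ (lo 2 2 m r, lo 2 2 m s) * tpow 2 2 psi_plus m $$ (hi 2 2 m r, hi 2 2 m s)"
      by (rule tpow_Suc_entry[OF r s])
    also have "\<dots> = (if lo 2 2 m r \<in> {0,3} \<and> lo 2 2 m s \<in> {0,3} then 1/2 else 0)
      * (if hi 2 2 m r div 2^m = hi 2 2 m r mod 2^m \<and> hi 2 2 m s div 2^m = hi 2 2 m s mod 2^m then 1 / of_nat (2^m) else 0)"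
      unfolding Suc.IH[OF hi_less[OF r] hi_less[OF s]] using l by (simp add: psi_plus_def)
    also have "\<dots> = (if (lo 2 2 m r \<in> {0,3} \<and> hi 2 2 m r div 2^m = hi 2 2 m r mod 2^m)
       \<and> (lo 2 2 m s \<in> {0,3} \<and> hi 2 2 m s div 2^m = hi 2 2 m s mod 2^m) then 1 / of_nat (2^Suc m) else 0)"
      by simp
    finally show ?case unfolding eq[OF r] eq[OF s] .
  qed
  ultimately show "tpow 2 2 psi_plus n $$ (r,s) = phi (2^n) $$ (r,s)" by (simp add: phi_def)
qed (simp_all add: phi_def tpow_def)

text \<open>k pairs per copy give a dimension 2^k \<ge> b, enough to teleport Bob's share. From n
  pairs, n div k copies are prepared without error, at the asymptotic rate 1 / k.\<close>

lemma rate_from_psi_plus_pos: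
  assumes \<rho>: "density (a*b) \<rho>"
  shows "0 < rate 2 2 psi_plus a b \<rho>"
proof -
  define k where "k = Suc b"
  have "k < 2^k" by (rule less_exp)
  hence k: "k > 0" "b \<le> 2^k" unfolding k_def by linarith+
  define m where "m n = n div k" for n
  have le: "b^(m n) \<le> 2^n" for n
  proof -
    have "b^(m n) \<le> (2^k)^(m n)" by (rule power_mono[OF k(2)]) simp
    also have "\<dots> = 2^(k * m n)" by (rule power_mult[symmetric])
    also have "\<dots> \<le> 2^n" by (rule power_increasing) (simp_all add: m_def)
    finally show ?thesis .
  qed
  have "\<forall>n. \<exists>L. LOCC (2^n) (2^n) (a^(m n)) (b^(m n)) L \<and> L (phi (2^n)) = tpow a b \<rho> (m n)"
    by (intro allI teleportation density_tpow \<rho> le)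
  from choice[OF this] obtain \<Lambda> where \<Lambda>: "\<And>n. LOCC (2^n) (2^n) (a^(m n)) (b^(m n)) (\<Lambda> n)"
    "\<And>n. \<Lambda> n (phi (2^n)) = tpow a b \<rho> (m n)" by blast
  have "trace_norm (\<Lambda> n (tpow 2 2 psi_plus n) - tpow a b \<rho> (m n)) = 0" for n
    unfolding tpow_psi_plus \<Lambda>(2) by (rule trace_norm_self[OF density_psd[OF density_tpow[OF \<rho>]]])
  moreover have "(\<lambda>n. real (m n) / real n) \<longlonglongrightarrow> 1 / real k"
  proof (rule tendsto_sandwich)
    have "(\<lambda>n. 1 / real n) \<longlonglongrightarrow> 0" by (rule lim_1_over_n)
    from tendsto_diff[OF tendsto_const this, of "1 / real k"]
    show "(\<lambda>n. 1 / real k - 1 / real n) \<longlonglongrightarrow> 1 / real k" by simp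
    have b: "1 / real k - 1 / real n \<le> real (m n) / real n \<and> real (m n) / real n \<le> 1 / real k" if n: "n > 0" for n
    proof -
      have "real (k * (n div k) + n mod k) = real n" by (simp only: mult_div_mod_eq)
      hence nd: "real n = real k * real (m n) + real (n mod k)"
        unfolding of_nat_add of_nat_mult m_def by (rule sym)
      have "real (n mod k) \<le> real k" using k(1) by simp
      hence "real n \<le> real k * (real (m n) + 1)" unfolding distrib_left using nd by linarith
      hence "1 / real k \<le> (real (m n) + 1) / real n" using n k(1) by (simp add: field_simps)
      moreover have "real k * real (m n) \<le> real n" using nd by linarith
      hence "real (m n) / real n \<le> 1 / real k" using n k(1) by (simp add: field_simps)
      ultimately show ?thesis by (simp add: add_divide_distrib)
    qed
    show "\<forall>\<^sub>F n in sequentially. 1 / real k - 1 / real n \<le> real (m n) / real n"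
      by (rule eventually_mono[OF eventually_gt_at_top[of 0]]) (simp only: b)
    show "\<forall>\<^sub>F n in sequentially. real (m n) / real n \<le> 1 / real k"
      by (rule eventually_mono[OF eventually_gt_at_top[of 0]]) (simp only: b)
  qed simp
  ultimately have "achievable 2 2 psi_plus a b \<rho> (1 / real k)"
    unfolding achievable_def using \<Lambda>(1) by (intro conjI exI[of _ \<Lambda>] exI[of _ m] allI) simp_all
  hence "ereal (1 / real k) \<le> rate 2 2 psi_plus a b \<rho>" by (rule achievable_le_rate)
  moreover have "0 < ereal (1 / real k)" using k(1) by simp
  ultimately show ?thesis by (rule order.strict_trans2[rotated])
qed

theorem theorem2:
  fixes a b :: nat and \<rho> :: "complex mat"
  assumes "entangled a b \<rho>"
  shows "E_D a b \<rho> / E_c a b \<rho> \<le> sym_ent a b \<rho>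
       \<and> sym_ent a b \<rho> \<le> 1
       \<and> E_b a b \<rho> / E_c a b \<rho> \<ge> asym_ent a b \<rho>
       \<and> (asym_ent a b \<rho> > 0 \<longrightarrow> E_D a b \<rho> < E_c a b \<rho>)"
proof -
  let ?V = "swap_state a b \<rho>"
  have \<rho>: "density (a*b) \<rho>" using assms by (simp add: entangled_def)
  have V: "density (b*a) ?V" by (rule density_swap[OF \<rho>])
  have D0: "0 \<le> E_D a b \<rho>" unfolding E_D_def by (rule rate_nonneg[OF \<rho> density_psi_plus])
  have S1: "sym_ent a b \<rho> \<le> 1" by (rule sym_ent_le_one[OF assms])
  obtain q where q: "rate 2 2 psi_plus a b \<rho> = ereal q" "q > 0"
    using rate_from_psi_plus_pos[OF \<rho>] rate_to_entangled_finite[OF assms density_psi_plus]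
    by (cases "rate 2 2 psi_plus a b \<rho>") auto
  \<comment> \<open>Exchanging the parties fixes \<psi>+, so the swapped state is obtained from it
    at least at the rate of \<rho>.\<close>
  have "E_D a b \<rho> * ereal q \<le> E_D a b \<rho> * rate 2 2 psi_plus b a ?V"
    using rate_swap[OF density_psi_plus \<rho>] unfolding q(1) swap_psi_plus
    by (rule ereal_mult_left_mono[OF _ D0])
  also have "\<dots> \<le> sym_ent a b \<rho>"
    unfolding E_D_def sym_ent_def by (rule rate_compose[OF \<rho> density_psi_plus V])
  finally have DS: "E_D a b \<rho> * ereal q \<le> sym_ent a b \<rho>" .
  have S0: "0 \<le> sym_ent a b \<rho>" unfolding sym_ent_def by (rule rate_nonneg[OF \<rho> V])
  obtain S where S: "sym_ent a b \<rho> = ereal S" using S0 S1 by (cases "sym_ent a b \<rho>") auto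
  \<comment> \<open>D is finite because q > 0 and D q \<le> S; from here on all quantities are real
    and no infinite difference can occur in \<open>E_b\<close>.\<close>
  obtain D where D: "E_D a b \<rho> = ereal D"
    using D0 DS S q(2) by (cases "E_D a b \<rho>") auto
  have c: "E_c a b \<rho> = ereal (1 / q)" unfolding E_c_def q(1) using q(2) by (simp add: inverse_eq_divide)
  have DqS: "D * q \<le> S" using DS by (simp add: D S)
  have "ereal D / ereal (1 / q) = ereal (D * q)" using q(2) by simp
  moreover have "E_b a b \<rho> / E_c a b \<rho> = ereal (1 - D * q)"
    unfolding E_b_def D c using q(2) by (simp add: field_simps)
  moreover have "asym_ent a b \<rho> = ereal (1 - S)" unfolding asym_ent_def S by (simp add: one_ereal_def)
  moreover have "D < 1 / q" if "0 < 1 - S"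
  proof -
    have "D * q < 1" using that DqS by simp
    thus ?thesis using q(2) by (simp add: field_simps)
  qed
  ultimately show ?thesis using S1 DqS by (simp add: D S c zero_ereal_def)
qed

end
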